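(* Let $\mathcal F$ be a pro-fusion system on a pro-$p$ group $S$, let $T$ be a strongly $\mathcal F$-closed subgroup of $S$ and let $\mathcal E$ be a saturated $T$-subsystem of $\mathcal F$. Suppose that $P$ and $P'$ are open subgroups of $S$ and that $\varphi\in\mathrm{Iso}_{\mathcal E}(P,P')$. Then there exist open subgroups $P=P_0,P_1,\dots,P_n=P'$ and $Q_1,Q_2,\dots,Q_n$ of $S$ and morphisms $\varphi_i\in\mathrm{Aut}_{\mathcal E}(Q_i)$ for $1\le i\le n$ such that: (a) the $Q_i$ are $\mathcal E$-essential subgroups of $S$ and are fully normalized in $\mathcal E$; (b) for each $i$, $P_{i-1},P_i\le Q_i$ and $\varphi_i(P_{i-1})=P_i$; (c) $\varphi(u)=\varphi_n\cdots\varphi_2\varphi_1(u)$ for all $u\in P$.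
   Context: Fix a prime $p$. All subgroups of profinite groups are closed and all homomorphisms are continuous. Fusion systems. A fusion system on a finite $p$-group $S$ is a category $\mathcal F$ whose objects are all subgroups of $S$ and whose morphisms are injective group homomorphisms, such that (a) $\mathcal F$ contains every homomorphism between subgroups induced by conjugation by an element of $S$; (b) every morphism of $\mathcal F$ factors as an isomorphism in $\mathcal F$ followed by an inclusion. A morphism from a fusion system $\mathcal F$ on $S$ to a fusion system $\mathcal G$ on $T$ is a group homomorphism $\alpha:S\to T$ for which there is a (necessarily unique) functor $A:\mathcal F\to\mathcal G$ with $A(P)=\alpha(P)$ for all $P\le S$ and $\alpha\varphi=A(\varphi)\alpha$ (on $P$) for all $\varphi\in\mathrm{Hom}_{\mathcal F}(P,Q)$. Pro-fusion systems. Given an inverse system of fusion systems $\mathcal F_i$ on finite $p$-groups $S_i$, indexed by a directed set $I$, with morphisms of fusion systems $(f_{i,j},F_{i,j}):\mathcal F_j\to\mathcal F_i$ for $j\ge i$ satisfying $f_{i,j}f_{j,k}=f_{i,k}$, put $S=\varprojlim_i S_i$ with projections $f_i:S\to S_i$. The pro-fusion system $\mathcal F=\varprojlim_i\mathcal F_i$ on the pro-$p$ group $S$ is the category whose objects are the closed subgroups of $S$ and with $\mathrm{Hom}_{\mathcal F}(P,Q)=\varprojlim_i\mathrm{Hom}_{\mathcal F_i}(f_i(P),f_i(Q))$, whose elements are regarded as homomorphisms $P\to Q$; this is a profinite set and $\mathrm{Aut}_{\mathcal F}(P)$ is a profinite group. $T\le S$ is strongly $\mathcal F$-closed if for all $\varphi\in\mathrm{Hom}_{\mathcal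 F}(R,S)$, $R\le T$ implies $\varphi(R)\le T$. $T$-subsystems. For $T$ strongly $\mathcal F$-closed, a $T$-subsystem $\mathcal E$ of $\mathcal F$ is a subcategory of $\mathcal F$ on the same objects, with each $\mathrm{Hom}_{\mathcal E}(P,Q)$ closed in $\mathrm{Hom}_{\mathcal F}(P,Q)$, such that: (a) $\mathcal E$ contains every homomorphism between subgroups of $S$ induced by conjugation by an element of $T$; (b) every morphism in $\mathcal E$ factors as an isomorphism of $\mathcal E$ followed by an inclusion; (c) for all $P,P'\le Q\le S$ and $\varphi\in\mathrm{Hom}_{\mathcal F}(Q,S)$ we have $\varphi|_{P'}\,\mathrm{Hom}_{\mathcal E}(P,P')=\mathrm{Hom}_{\mathcal E}(\varphi(P),\varphi(P'))\,\varphi|_P$; (d) for all $Q\le S$ and $\psi\in\mathrm{Hom}_{\mathcal E}(Q,S)$ we have $\psi(u)u^{-1}\in T$ for all $u\in Q$. Saturation of $\mathcal E$. For $\varphi\in\mathrm{Iso}_{\mathcal E}(R,Q)$ let $N^T_\varphi=\{x\in N_T(R)R\mid\exists y\in N_T(Q)Q:\ \varphi(xux^{-1})=y\varphi(u)y^{-1}\ \forall u\in R\}$. $Q$ is receptive in $\mathcal E$ if for all $R\le S$ and all $\varphi\in\mathrm{Iso}_{\mathcal E}(R,Q)$ there is $\tilde\varphi:N^T_\varphi\to N_T(Q)Q$ in $\mathcal E$ with $\tilde\varphi|_R=\varphi$. For a subgroup $U\le S$, $\mathrm{Aut}_U(Q)$ denotes the group of automorphisms of $Q$ induced by conjugation by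 elements of $N_U(Q)$. $Q$ is fully normalized in $\mathcal E$ if it is receptive in $\mathcal E$ and $\mathrm{Aut}_T(Q)$ is a Sylow pro-$p$ subgroup of $\mathrm{Aut}_{\mathcal E}(Q)$. $\mathcal E$ is saturated if every $\mathcal E$-isomorphism class contains a subgroup that is fully normalized in $\mathcal E$. Essential subgroups. $Q\le S$ is $\mathcal E$-centric if $C_T(Q')\le Z(Q')$ for all $Q'$ in the $\mathcal E$-isomorphism class of $Q$. $Q\le S$ is $\mathcal E$-essential if $T\le Q$, or if $Q$ is $\mathcal E$-centric and the partially ordered set $\mathcal S_p(\mathrm{Aut}_{\mathcal E}(Q)/\mathrm{Aut}_{T\cap Q}(Q))$ is disconnected or empty, where $\mathcal S_p(G)$ denotes the poset of non-trivial pro-$p$ subgroups of $G$ ordered by inclusion. *)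

theory Defs
  imports
    "HOL-Analysis.Analysis"
    "HOL-Algebra.Algebra"
    "HOL-Computational_Algebra.Primes"
begin

text \<open>
  A category whose objects are subgroups of one fixed group and whose morphisms are maps between
  them is given by a set \<open>Ob\<close> of objects and a function \<open>C\<close>, where \<open>C P Q\<close> is the set of
  morphisms from \<open>P\<close> to \<open>Q\<close>. Morphisms out of \<open>P\<close> are extensional functions on \<open>P\<close>, so that equality
  of maps on \<open>P\<close> is equality in HOL. The values of \<open>C\<close> outside \<open>Ob\<close> are irrelevant.
\<close>

type_synonym 'g homs = "'g set \<Rightarrow> 'g set \<Rightarrow> ('g \<Rightarrow> 'g) set"

definition map_category :: "'g set set \<Rightarrow> 'g homs \<Rightarrow> bool" where
  "map_category Ob C \<longleftrightarrow>
     (\<forall>P\<in>Ob. \<forall>Q\<in>Ob. C P Q \<subseteq> P \<rightarrow>\<^sub>E Q) \<and>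
     (\<forall>P\<in>Ob. (\<lambda>x\<in>P. x) \<in> C P P) \<and>
     (\<forall>P\<in>Ob. \<forall>Q\<in>Ob. \<forall>R\<in>Ob. \<forall>\<phi>\<in>C P Q. \<forall>\<psi>\<in>C Q R. compose P \<psi> \<phi> \<in> C P R)"

definition Iso :: "'g homs \<Rightarrow> 'g homs" where
  "Iso C P Q = {\<phi> \<in> C P Q. \<exists>\<psi>\<in>C Q P.
     compose P \<psi> \<phi> = (\<lambda>x\<in>P. x) \<and> compose Q \<phi> \<psi> = (\<lambda>x\<in>Q. x)}"

abbreviation Aut :: "'g homs \<Rightarrow> 'g set \<Rightarrow> ('g \<Rightarrow> 'g) set" where
  "Aut C P \<equiv> Iso C P P"

definition factors_iso_incl :: "'g set set \<Rightarrow> 'g homs \<Rightarrow> bool" where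
  "factors_iso_incl Ob C \<longleftrightarrow>
     (\<forall>P\<in>Ob. \<forall>Q\<in>Ob. \<forall>\<phi>\<in>C P Q. \<exists>R\<in>Ob. R \<subseteq> Q \<and>
        (\<exists>\<theta>\<in>Iso C P R. \<phi> = compose P (\<lambda>x\<in>R. x) \<theta>))"

definition conj_map :: "('g, 'b) monoid_scheme \<Rightarrow> 'g \<Rightarrow> 'g set \<Rightarrow> 'g \<Rightarrow> 'g" where
  "conj_map G g P = (\<lambda>x\<in>P. g \<otimes>\<^bsub>G\<^esub> x \<otimes>\<^bsub>G\<^esub> inv\<^bsub>G\<^esub> g)"

definition contains_conj :: "('g, 'b) monoid_scheme \<Rightarrow> 'g set set \<Rightarrow> 'g set \<Rightarrow> 'g homs \<Rightarrow> bool" where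
  "contains_conj G Ob U C \<longleftrightarrow>
     (\<forall>P\<in>Ob. \<forall>Q\<in>Ob. \<forall>g\<in>U. conj_map G g P ` P \<subseteq> Q \<longrightarrow> conj_map G g P \<in> C P Q)"


section \<open>Fusion systems on finite groups of prime power order\<close>

definition finite_p_group :: "nat \<Rightarrow> ('g, 'b) monoid_scheme \<Rightarrow> bool" where
  "finite_p_group p G \<longleftrightarrow> group G \<and> finite (carrier G) \<and> (\<exists>n. order G = p ^ n)"

definition fusion_system :: "nat \<Rightarrow> ('g, 'b) monoid_scheme \<Rightarrow> 'g homs \<Rightarrow> bool" where
  "fusion_system p S F \<longleftrightarrow>
     finite_p_group p S \<and>
     map_category {P. subgroup P S} F \<and>
     (\<forall>P Q. subgroup P S \<longrightarrow> subgroup Q S \<longrightarrow>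
        (\<forall>\<phi>\<in>F P Q. \<phi> \<in> hom (S\<lparr>carrier := P\<rparr>) (S\<lparr>carrier := Q\<rparr>) \<and> inj_on \<phi> P)) \<and>
     contains_conj S {P. subgroup P S} (carrier S) F \<and>
     factors_iso_incl {P. subgroup P S} F"

text \<open>
  In the following definition \<open>A P Q\<close> is the action on morphisms from \<open>P\<close> to \<open>Q\<close> of a functor sending
  an object \<open>P\<close> to \<open>\<alpha> ` P\<close>.
\<close>

definition fusion_morphism ::
  "('g, 'b) monoid_scheme \<Rightarrow> 'g homs \<Rightarrow> ('h, 'c) monoid_scheme \<Rightarrow> 'h homs \<Rightarrow> ('g \<Rightarrow> 'h) \<Rightarrow> bool" where
  "fusion_morphism S F T G \<alpha> \<longleftrightarrow>
     \<alpha> \<in> hom S T \<and>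
     (\<exists>A :: 'g set \<Rightarrow> 'g set \<Rightarrow> ('g \<Rightarrow> 'g) \<Rightarrow> 'h \<Rightarrow> 'h.
        (\<forall>P Q. subgroup P S \<longrightarrow> subgroup Q S \<longrightarrow>
           (\<forall>\<phi>\<in>F P Q. A P Q \<phi> \<in> G (\<alpha> ` P) (\<alpha> ` Q) \<and> (\<forall>u\<in>P. \<alpha> (\<phi> u) = A P Q \<phi> (\<alpha> u)))) \<and>
        (\<forall>P. subgroup P S \<longrightarrow> A P P (\<lambda>x\<in>P. x) = (\<lambda>y\<in>\<alpha> ` P. y)) \<and>
        (\<forall>P Q R. subgroup P S \<longrightarrow> subgroup Q S \<longrightarrow> subgroup R S \<longrightarrow>
           (\<forall>\<phi>\<in>F P Q. \<forall>\<psi>\<in>F Q R.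
              A P R (compose P \<psi> \<phi>) = compose (\<alpha> ` P) (A Q R \<psi>) (A P Q \<phi>))))"


section \<open>Pro-fusion systems\<close>

text \<open>
  An inverse system of fusion systems: the index set \<open>idx\<close> with the relation \<open>le\<close>, the groups
  \<open>grp i\<close>, the fusion systems \<open>fus i\<close> and the transition maps \<open>tr i j\<close> from \<open>grp j\<close> to \<open>grp i\<close> for
  \<open>le i j\<close>. The underlying sets of all \<open>grp i\<close> are taken in one common type.
\<close>

record ('i, 'a) fusion_diagram =
  idx :: "'i set"
  le :: "'i \<Rightarrow> 'i \<Rightarrow> bool"
  grp :: "'i \<Rightarrow> 'a monoid"
  fus :: "'i \<Rightarrow> 'a homs"
  tr :: "'i \<Rightarrow> 'i \<Rightarrow> 'a \<Rightarrow> 'a"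

definition directed_set :: "'i set \<Rightarrow> ('i \<Rightarrow> 'i \<Rightarrow> bool) \<Rightarrow> bool" where
  "directed_set I r \<longleftrightarrow>
     I \<noteq> {} \<and> (\<forall>i\<in>I. r i i) \<and>
     (\<forall>i\<in>I. \<forall>j\<in>I. \<forall>k\<in>I. r i j \<longrightarrow> r j k \<longrightarrow> r i k) \<and>
     (\<forall>i\<in>I. \<forall>j\<in>I. \<exists>k\<in>I. r i k \<and> r j k)"

definition inverse_system :: "nat \<Rightarrow> ('i, 'a) fusion_diagram \<Rightarrow> bool" where
  "inverse_system p D \<longleftrightarrow>
     directed_set (idx D) (le D) \<and>
     (\<forall>i\<in>idx D. fusion_system p (grp D i) (fus D i)) \<and>
     (\<forall>i\<in>idx D. \<forall>j\<in>idx D. le D i j \<longrightarrow>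
        fusion_morphism (grp D j) (fus D j) (grp D i) (fus D i) (tr D i j)) \<and>
     (\<forall>i\<in>idx D. \<forall>x\<in>carrier (grp D i). tr D i i x = x) \<and>
     (\<forall>i\<in>idx D. \<forall>j\<in>idx D. \<forall>k\<in>idx D. le D i j \<longrightarrow> le D j k \<longrightarrow>
        (\<forall>x\<in>carrier (grp D k). tr D i j (tr D j k x) = tr D i k x))"

definition lim_grp :: "('i, 'a) fusion_diagram \<Rightarrow> ('i \<Rightarrow> 'a) monoid" where
  "lim_grp D = (product_group (idx D) (grp D))
     \<lparr>carrier := {x \<in> carrier (product_group (idx D) (grp D)).
        \<forall>i\<in>idx D. \<forall>j\<in>idx D. le D i j \<longrightarrow> tr D i j (x j) = x i}\<rparr>"

definition lim_top :: "('i, 'a) fusion_diagram \<Rightarrow> ('i \<Rightarrow> 'a) topology" where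
  "lim_top D = subtopology
     (product_topology (\<lambda>i. discrete_topology (carrier (grp D i))) (idx D)) (carrier (lim_grp D))"

definition closed_subgroup :: "('i, 'a) fusion_diagram \<Rightarrow> ('i \<Rightarrow> 'a) set \<Rightarrow> bool" where
  "closed_subgroup D P \<longleftrightarrow> subgroup P (lim_grp D) \<and> closedin (lim_top D) P"

definition open_subgroup :: "('i, 'a) fusion_diagram \<Rightarrow> ('i \<Rightarrow> 'a) set \<Rightarrow> bool" where
  "open_subgroup D P \<longleftrightarrow> subgroup P (lim_grp D) \<and> openin (lim_top D) P"

abbreviation proj :: "'i \<Rightarrow> ('i \<Rightarrow> 'a) set \<Rightarrow> 'a set" where
  "proj i P \<equiv> (\<lambda>x. x i) ` P"

text \<open>
  The inverse limit of the sets \<open>fus D i (proj i P) (proj i Q)\<close>. The transition functor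
  sends \<open>\<Phi> j\<close> to the unique map on \<open>proj i P = tr D i j ` proj j P\<close> that satisfies the
  equation below, so the equation says that it sends \<open>\<Phi> j\<close> to \<open>\<Phi> i\<close>.
\<close>

definition lim_homs :: "('i, 'a) fusion_diagram \<Rightarrow> ('i \<Rightarrow> 'a) set \<Rightarrow> ('i \<Rightarrow> 'a) set
    \<Rightarrow> ('i \<Rightarrow> 'a \<Rightarrow> 'a) set" where
  "lim_homs D P Q = {\<Phi> \<in> (\<Pi>\<^sub>E i\<in>idx D. fus D i (proj i P) (proj i Q)).
     \<forall>i\<in>idx D. \<forall>j\<in>idx D. le D i j \<longrightarrow>
       (\<forall>x\<in>proj j P. tr D i j (\<Phi> j x) = \<Phi> i (tr D i j x))}"

definition lim_homs_top :: "('i, 'a) fusion_diagram \<Rightarrow> ('i \<Rightarrow> 'a) set \<Rightarrow> ('i \<Rightarrow> 'a) set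
    \<Rightarrow> ('i \<Rightarrow> 'a \<Rightarrow> 'a) topology" where
  "lim_homs_top D P Q = subtopology
     (product_topology (\<lambda>i. discrete_topology (fus D i (proj i P) (proj i Q))) (idx D))
     (lim_homs D P Q)"

definition lim_map :: "('i, 'a) fusion_diagram \<Rightarrow> ('i \<Rightarrow> 'a) set \<Rightarrow> ('i \<Rightarrow> 'a \<Rightarrow> 'a)
    \<Rightarrow> ('i \<Rightarrow> 'a) \<Rightarrow> ('i \<Rightarrow> 'a)" where
  "lim_map D P \<Phi> = (\<lambda>x\<in>P. \<lambda>i\<in>idx D. \<Phi> i (x i))"

definition pro_fusion :: "('i, 'a) fusion_diagram \<Rightarrow> ('i \<Rightarrow> 'a) homs" where
  "pro_fusion D P Q = lim_map D P ` lim_homs D P Q"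

text \<open>
  The map \<open>lim_map D P\<close> is injective on \<open>lim_homs D P Q\<close>; the profinite topology is transported along
  it.
\<close>

definition hom_top :: "('i, 'a) fusion_diagram \<Rightarrow> ('i \<Rightarrow> 'a) set \<Rightarrow> ('i \<Rightarrow> 'a) set
    \<Rightarrow> (('i \<Rightarrow> 'a) \<Rightarrow> ('i \<Rightarrow> 'a)) topology" where
  "hom_top D P Q = pullback_topology (pro_fusion D P Q)
     (inv_into (lim_homs D P Q) (lim_map D P)) (lim_homs_top D P Q)"

lemma group_lim_grp:
  assumes "inverse_system p D"
  shows "Group.group (lim_grp D)"
proof -
  have grp: "Group.group (grp D j)" if "j \<in> idx D" for j
    using assms that by (simp add: inverse_system_def fusion_system_def finite_p_group_def)
  have tr: "group_hom (grp D j) (grp D i) (tr D i j)"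
    if "i \<in> idx D" "j \<in> idx D" "le D i j" for i j
    using assms that grp
    by (auto simp: inverse_system_def fusion_morphism_def group_hom_def group_hom_axioms_def)
  interpret Pr: Group.group "product_group (idx D) (grp D)"
    using grp by simp
  have "subgroup (carrier (lim_grp D)) (product_group (idx D) (grp D))"
  proof (rule Pr.subgroupI)
    have "\<one>\<^bsub>product_group (idx D) (grp D)\<^esub> \<in> carrier (lim_grp D)"
      using Pr.one_closed group_hom.hom_one[OF tr] by (simp add: lim_grp_def)
    then show "carrier (lim_grp D) \<noteq> {}" by auto
  next
    fix a assume a: "a \<in> carrier (lim_grp D)"
    then have ac: "a \<in> carrier (product_group (idx D) (grp D))" by (simp add: lim_grp_def)
    have "inv\<^bsub>product_group (idx D) (grp D)\<^esub> a = (\<lambda>i\<in>idx D. inv\<^bsub>grp D i\<^esub> (a i))"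
      using ac grp by (simp add: inv_product_group)
    then show "inv\<^bsub>product_group (idx D) (grp D)\<^esub> a \<in> carrier (lim_grp D)"
      using a ac grp group_hom.hom_inv[OF tr] by (auto simp: lim_grp_def PiE_iff)
  next
    fix a b assume "a \<in> carrier (lim_grp D)" "b \<in> carrier (lim_grp D)"
    then show "a \<otimes>\<^bsub>product_group (idx D) (grp D)\<^esub> b \<in> carrier (lim_grp D)"
      using grp hom_mult[OF group_hom.homh[OF tr]]
      by (auto simp: lim_grp_def PiE_iff group.is_monoid monoid.m_closed)
  qed (simp add: lim_grp_def)
  then show ?thesis
    using Pr.subgroup_imp_group by (fastforce simp: lim_grp_def)
qed

lemma subgroup_proj:
  assumes "inverse_system p D" "i \<in> idx D" "subgroup R (lim_grp D)"
  shows "subgroup (proj i R) (grp D i)"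
proof -
  have grp: "Group.group (grp D j)" if "j \<in> idx D" for j
    using assms(1) that by (simp add: inverse_system_def fusion_system_def finite_p_group_def)
  interpret G: Group.group "grp D i" by (rule grp[OF assms(2)])
  interpret L: Group.group "lim_grp D" by (rule group_lim_grp[OF assms(1)])
  have "(\<lambda>x. x i) \<in> hom (lim_grp D) (grp D i)"
    using assms(2) by (auto simp: hom_def lim_grp_def)
  then interpret group_hom "lim_grp D" "grp D i" "\<lambda>x. x i"
    by (simp add: group_hom_def group_hom_axioms_def G.is_group L.is_group)
  show ?thesis by (rule subgroup_img_is_subgroup[OF assms(3)])
qed

lemma inj_on_lim_map:
  assumes "inverse_system p D" "closed_subgroup D P" "closed_subgroup D Q"
  shows "inj_on (lim_map D P) (lim_homs D P Q)"
proof (rule inj_onI)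
  fix \<Phi> \<Psi>
  assume \<Phi>: "\<Phi> \<in> lim_homs D P Q" and \<Psi>: "\<Psi> \<in> lim_homs D P Q"
    and eq: "lim_map D P \<Phi> = lim_map D P \<Psi>"
  show "\<Phi> = \<Psi>"
  proof (rule PiE_ext)
    show "\<Phi> \<in> (\<Pi>\<^sub>E i\<in>idx D. fus D i (proj i P) (proj i Q))"
      "\<Psi> \<in> (\<Pi>\<^sub>E i\<in>idx D. fus D i (proj i P) (proj i Q))"
      using \<Phi> \<Psi> by (auto simp: lim_homs_def)
  next
    fix i assume i: "i \<in> idx D"
    have sub: "subgroup (proj i R) (grp D i)" if "closed_subgroup D R" for R
      using subgroup_proj[OF assms(1) i] that by (auto simp: closed_subgroup_def)
    have "fus D i (proj i P) (proj i Q) \<subseteq> proj i P \<rightarrow>\<^sub>E proj i Q"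
      using assms(1) i sub[OF assms(2)] sub[OF assms(3)]
      by (auto simp: inverse_system_def fusion_system_def map_category_def)
    moreover have "\<Phi> i \<in> fus D i (proj i P) (proj i Q)" "\<Psi> i \<in> fus D i (proj i P) (proj i Q)"
      using \<Phi> \<Psi> i PiE_mem unfolding lim_homs_def by fast+
    ultimately have mem: "\<Phi> i \<in> proj i P \<rightarrow>\<^sub>E proj i Q" "\<Psi> i \<in> proj i P \<rightarrow>\<^sub>E proj i Q"
      by (blast intro: subsetD)+
    show "\<Phi> i = \<Psi> i"
    proof (rule PiE_ext[OF mem])
      fix y assume "y \<in> proj i P"
      then obtain x where x: "x \<in> P" "y = x i" by auto
      have "lim_map D P \<Phi> x i = lim_map D P \<Psi> x i" using eq by simp
      then show "\<Phi> i y = \<Psi> i y" using x i by (simp add: lim_map_def)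
    qed
  qed
qed

definition strongly_closed :: "('i, 'a) fusion_diagram \<Rightarrow> ('i \<Rightarrow> 'a) set \<Rightarrow> bool" where
  "strongly_closed D T \<longleftrightarrow> closed_subgroup D T \<and>
     (\<forall>R. closed_subgroup D R \<longrightarrow>
        (\<forall>\<phi>\<in>pro_fusion D R (carrier (lim_grp D)). R \<subseteq> T \<longrightarrow> \<phi> ` R \<subseteq> T))"

definition subsystem :: "('i, 'a) fusion_diagram \<Rightarrow> ('i \<Rightarrow> 'a) set \<Rightarrow> ('i \<Rightarrow> 'a) homs \<Rightarrow> bool" where
  "subsystem D T E \<longleftrightarrow>
     map_category {P. closed_subgroup D P} E \<and>
     (\<forall>P Q. closed_subgroup D P \<longrightarrow> closed_subgroup D Q \<longrightarrow>
        E P Q \<subseteq> pro_fusion D P Q \<and> closedin (hom_top D P Q) (E P Q)) \<and>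
     contains_conj (lim_grp D) {P. closed_subgroup D P} T E \<and>
     factors_iso_incl {P. closed_subgroup D P} E \<and>
     (\<forall>P P' Q. closed_subgroup D P \<longrightarrow> closed_subgroup D P' \<longrightarrow> closed_subgroup D Q \<longrightarrow>
        P \<subseteq> Q \<longrightarrow> P' \<subseteq> Q \<longrightarrow>
        (\<forall>\<phi>\<in>pro_fusion D Q (carrier (lim_grp D)).
           (\<lambda>\<alpha>. compose P (restrict \<phi> P') \<alpha>) ` E P P' =
           (\<lambda>\<beta>. compose P \<beta> (restrict \<phi> P)) ` E (\<phi> ` P) (\<phi> ` P'))) \<and>
     (\<forall>Q. closed_subgroup D Q \<longrightarrow>
        (\<forall>\<psi>\<in>E Q (carrier (lim_grp D)). \<forall>u\<in>Q. \<psi> u \<otimes>\<^bsub>lim_grp D\<^esub> inv\<^bsub>lim_grp D\<^esub> u \<in> T))"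


section \<open>Pro-p subgroups\<close>

text \<open>
  In the next three definitions \<open>\<tau>\<close> is the topology of a profinite group \<open>G\<close>; its closed
  subgroups are then profinite in the subspace topology. In \<open>sylow_pro_p\<close>, the indices of
  the subgroups \<open>HN\<close> with \<open>N\<close> open normal are those whose least common multiple is the supernatural
  index of \<open>H\<close>.
\<close>

definition pro_p_subgroup :: "nat \<Rightarrow> ('g, 'b) monoid_scheme \<Rightarrow> 'g topology \<Rightarrow> 'g set \<Rightarrow> bool" where
  "pro_p_subgroup p G \<tau> H \<longleftrightarrow> subgroup H G \<and> closedin \<tau> H \<and>
     (\<forall>N. N \<lhd> (G\<lparr>carrier := H\<rparr>) \<and> openin (subtopology \<tau> H) N \<longrightarrow>
        (\<exists>n. card (rcosets\<^bsub>G\<lparr>carrier := H\<rparr>\<^esub> N) = p ^ n))"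

definition sylow_pro_p :: "nat \<Rightarrow> ('g, 'b) monoid_scheme \<Rightarrow> 'g topology \<Rightarrow> 'g set \<Rightarrow> bool" where
  "sylow_pro_p p G \<tau> H \<longleftrightarrow> pro_p_subgroup p G \<tau> H \<and>
     (\<forall>N. N \<lhd> G \<and> openin \<tau> N \<longrightarrow> \<not> p dvd card (rcosets\<^bsub>G\<^esub> (H <#>\<^bsub>G\<^esub> N)))"

definition pro_p_poset :: "nat \<Rightarrow> ('g, 'b) monoid_scheme \<Rightarrow> 'g topology \<Rightarrow> 'g set set" where
  "pro_p_poset p G \<tau> = {H. pro_p_subgroup p G \<tau> H \<and> H \<noteq> {\<one>\<^bsub>G\<^esub>}}"

text \<open>
  A set of sets ordered by inclusion is connected when any two members are joined by a finite chain of
  comparable members, i.e. when its order complex is connected.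
\<close>

definition poset_connected :: "'g set set \<Rightarrow> bool" where
  "poset_connected \<A> \<longleftrightarrow>
     (\<forall>A\<in>\<A>. \<forall>B\<in>\<A>. (\<lambda>U V. U \<in> \<A> \<and> V \<in> \<A> \<and> (U \<subseteq> V \<or> V \<subseteq> U))\<^sup>*\<^sup>* A B)"

definition quotient_top :: "('g, 'b) monoid_scheme \<Rightarrow> 'g topology \<Rightarrow> 'g set \<Rightarrow> 'g set topology" where
  "quotient_top G \<tau> N = topology (\<lambda>U. U \<subseteq> carrier (G Mod N) \<and>
     openin \<tau> {x \<in> topspace \<tau>. N #>\<^bsub>G\<^esub> x \<in> U})"

lemma openin_quotient_top:
  "openin (quotient_top G \<tau> N) U \<longleftrightarrow>
     U \<subseteq> carrier (G Mod N) \<and> openin \<tau> {x \<in> topspace \<tau>. N #>\<^bsub>G\<^esub> x \<in> U}"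
proof -
  have split: "{x \<in> topspace \<tau>. f x \<in> U \<inter> V} = {x \<in> topspace \<tau>. f x \<in> U} \<inter> {x \<in> topspace \<tau>. f x \<in> V}"
    "{x \<in> topspace \<tau>. f x \<in> \<Union>\<K>} = (\<Union>K\<in>\<K>. {x \<in> topspace \<tau>. f x \<in> K})"
    for f and U V :: "'a set set" and \<K>
    by auto
  have "istopology (\<lambda>U. U \<subseteq> carrier (G Mod N) \<and> openin \<tau> {x \<in> topspace \<tau>. N #>\<^bsub>G\<^esub> x \<in> U})"
    unfolding istopology_def split by (auto intro!: openin_Union simp: split)
  then show ?thesis by (simp add: quotient_top_def)
qed


section \<open>Saturation and essential subgroups\<close>

definition norm_in :: "('i, 'a) fusion_diagram \<Rightarrow> ('i \<Rightarrow> 'a) set \<Rightarrow> ('i \<Rightarrow> 'a) set \<Rightarrow> ('i \<Rightarrow> 'a) set" where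
  "norm_in D U Q = U \<inter> normalizer (lim_grp D) Q"

definition Aut_by :: "('i, 'a) fusion_diagram \<Rightarrow> ('i \<Rightarrow> 'a) set \<Rightarrow> ('i \<Rightarrow> 'a) set
    \<Rightarrow> (('i \<Rightarrow> 'a) \<Rightarrow> ('i \<Rightarrow> 'a)) set" where
  "Aut_by D U Q = (\<lambda>g. conj_map (lim_grp D) g Q) ` norm_in D U Q"

definition aut_grp :: "('i \<Rightarrow> 'a) homs \<Rightarrow> ('i \<Rightarrow> 'a) set \<Rightarrow> (('i \<Rightarrow> 'a) \<Rightarrow> ('i \<Rightarrow> 'a)) monoid" where
  "aut_grp E Q = (BijGroup Q)\<lparr>carrier := Aut E Q\<rparr>"

definition aut_top :: "('i, 'a) fusion_diagram \<Rightarrow> ('i \<Rightarrow> 'a) homs \<Rightarrow> ('i \<Rightarrow> 'a) set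
    \<Rightarrow> (('i \<Rightarrow> 'a) \<Rightarrow> ('i \<Rightarrow> 'a)) topology" where
  "aut_top D E Q = subtopology (hom_top D Q Q) (Aut E Q)"

definition norm_mult :: "('i, 'a) fusion_diagram \<Rightarrow> ('i \<Rightarrow> 'a) set \<Rightarrow> ('i \<Rightarrow> 'a) set \<Rightarrow> ('i \<Rightarrow> 'a) set" where
  "norm_mult D T Q = norm_in D T Q <#>\<^bsub>lim_grp D\<^esub> Q"

definition ext_domain :: "('i, 'a) fusion_diagram \<Rightarrow> ('i \<Rightarrow> 'a) set \<Rightarrow> ('i \<Rightarrow> 'a) set \<Rightarrow> ('i \<Rightarrow> 'a) set
    \<Rightarrow> (('i \<Rightarrow> 'a) \<Rightarrow> ('i \<Rightarrow> 'a)) \<Rightarrow> ('i \<Rightarrow> 'a) set" where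
  "ext_domain D T R Q \<phi> = {x \<in> norm_mult D T R. \<exists>y\<in>norm_mult D T Q. \<forall>u\<in>R.
     \<phi> (x \<otimes>\<^bsub>lim_grp D\<^esub> u \<otimes>\<^bsub>lim_grp D\<^esub> inv\<^bsub>lim_grp D\<^esub> x) =
     y \<otimes>\<^bsub>lim_grp D\<^esub> \<phi> u \<otimes>\<^bsub>lim_grp D\<^esub> inv\<^bsub>lim_grp D\<^esub> y}"

definition receptive :: "('i, 'a) fusion_diagram \<Rightarrow> ('i \<Rightarrow> 'a) set \<Rightarrow> ('i \<Rightarrow> 'a) homs
    \<Rightarrow> ('i \<Rightarrow> 'a) set \<Rightarrow> bool" where
  "receptive D T E Q \<longleftrightarrow>
     (\<forall>R. closed_subgroup D R \<longrightarrow> (\<forall>\<phi>\<in>Iso E R Q.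
        \<exists>\<phi>'\<in>E (ext_domain D T R Q \<phi>) (norm_mult D T Q). restrict \<phi>' R = \<phi>))"

definition fully_normalized :: "nat \<Rightarrow> ('i, 'a) fusion_diagram \<Rightarrow> ('i \<Rightarrow> 'a) set \<Rightarrow> ('i \<Rightarrow> 'a) homs
    \<Rightarrow> ('i \<Rightarrow> 'a) set \<Rightarrow> bool" where
  "fully_normalized p D T E Q \<longleftrightarrow> receptive D T E Q \<and>
     sylow_pro_p p (aut_grp E Q) (aut_top D E Q) (Aut_by D T Q)"

definition saturated :: "nat \<Rightarrow> ('i, 'a) fusion_diagram \<Rightarrow> ('i \<Rightarrow> 'a) set \<Rightarrow> ('i \<Rightarrow> 'a) homs \<Rightarrow> bool" where
  "saturated p D T E \<longleftrightarrow>
     (\<forall>P. closed_subgroup D P \<longrightarrow>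
        (\<exists>Q. closed_subgroup D Q \<and> Iso E P Q \<noteq> {} \<and> fully_normalized p D T E Q))"

definition centric :: "('i, 'a) fusion_diagram \<Rightarrow> ('i \<Rightarrow> 'a) set \<Rightarrow> ('i \<Rightarrow> 'a) homs
    \<Rightarrow> ('i \<Rightarrow> 'a) set \<Rightarrow> bool" where
  "centric D T E Q \<longleftrightarrow>
     (\<forall>Q'. closed_subgroup D Q' \<and> Iso E Q Q' \<noteq> {} \<longrightarrow>
        {t \<in> T. \<forall>q\<in>Q'. t \<otimes>\<^bsub>lim_grp D\<^esub> q = q \<otimes>\<^bsub>lim_grp D\<^esub> t} \<subseteq>
        {z \<in> Q'. \<forall>q\<in>Q'. z \<otimes>\<^bsub>lim_grp D\<^esub> q = q \<otimes>\<^bsub>lim_grp D\<^esub> z})"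

definition essential :: "nat \<Rightarrow> ('i, 'a) fusion_diagram \<Rightarrow> ('i \<Rightarrow> 'a) set \<Rightarrow> ('i \<Rightarrow> 'a) homs
    \<Rightarrow> ('i \<Rightarrow> 'a) set \<Rightarrow> bool" where
  "essential p D T E Q \<longleftrightarrow>
     T \<subseteq> Q \<or>
     centric D T E Q \<and>
     (let G = aut_grp E Q; N = Aut_by D (T \<inter> Q) Q;
          \<A> = pro_p_poset p (G Mod N) (quotient_top G (aut_top D E Q) N)
      in \<not> poset_connected \<A> \<or> \<A> = {})"

end

theory Submission
  imports Defs
begin

text \<open>
  The proof is by induction on the index of \<open>P\<close>. Choose \<open>Q\<close> fully normalized and isomorphic to \<open>P\<close>; it
  suffices to decompose isomorphisms onto \<open>Q\<close>. If \<open>T \<subseteq> P\<close>, then \<open>P\<close> is alone in its class and essential.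
  Otherwise \<open>N\<^sub>T(P)P\<close> is strictly larger than \<open>P\<close>, and since \<open>Aut\<^sub>T(Q)\<close> is a Sylow pro-\<open>p\<close> subgroup of
  \<open>Aut\<^sub>E(Q)\<close>, every isomorphism from \<open>P\<close> to \<open>Q\<close> extends to \<open>N\<^sub>T(P)P\<close> after composition with an
  automorphism of \<open>Q\<close>. This leaves the automorphisms of \<open>Q\<close>. If \<open>Q\<close> is essential there is nothing to do.
  If \<open>Q\<close> is not centric, then \<open>C\<^sub>T(Q)\<close> is not contained in \<open>Q\<close> and every automorphism extends to
  \<open>C\<^sub>T(Q)Q\<close>. Otherwise the poset of pro-\<open>p\<close> subgroups of \<open>Aut\<^sub>E(Q)/Aut\<^bsub>T \<inter> Q\<^esub>(Q)\<close> is connected; moving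
  along a path in it from the image of \<open>Aut\<^sub>T(Q)\<close> to a conjugate writes every automorphism as a product
  of automorphisms \<open>\<alpha>\<close> with \<open>Aut\<^sub>T(Q) \<inter> \<alpha>\<^sup>-\<^sup>1 Aut\<^sub>T(Q) \<alpha>\<close> larger than \<open>Aut\<^bsub>T \<inter> Q\<^esub>(Q)\<close>, and these extend.
\<close>

section \<open>Actions of groups of prime power order\<close>

text \<open>Openness of P makes the induction possible: its index is finite, and
  \<open>E\<close>-isomorphisms preserve it because they preserve the size of every projection to a
  finite level. Receptivity gives no control over the image of an extension inside N_T(Q)Q, so the
  induction has to cover isomorphisms between arbitrary open subgroups. Reaching \<open>Q\<close> is
  enough because decompositions compose and can be reversed. The quotient by Aut_{T \<inter> Q}(Q)
  appears because elements of Q always lie in the domain of an extension and so never enlarge it,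
  whereas a member of Aut_T(Q) outside this subgroup is induced by some g outside Q. Since Aut_E(Q)
  is in general infinite, Sylow conjugation is solved in each finite quotient, and a common solution
  comes from compactness, which rests on \<open>E Q Q\<close> being closed.\<close>

lemma (in group) order_prime_power:
  assumes fin: "finite (carrier G)" and p: "Factorial_Ring.prime p"
    and pel: "\<And>x. x \<in> carrier G \<Longrightarrow> \<exists>n::nat. x [^] (p ^ n) = \<one>"
  shows "\<exists>n. order G = p ^ n"
proof (rule ccontr)
  assume np: "\<not> (\<exists>n. order G = p ^ n)"
  have pos: "order G > 0" using fin by (simp add: order_gt_0_iff_finite)
  have "\<exists>q. Factorial_Ring.prime q \<and> q dvd order G \<and> q \<noteq> p"
  proof (rule ccontr)
    assume "\<not> ?thesis"
    then have "prime_factors (order G) \<subseteq> {p}" by (auto simp: in_prime_factors_iff)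
    then have "order G = p ^ multiplicity p (order G)"
      using prime_factorization_nat[OF pos] p pos
      by (cases "p \<in> prime_factors (order G)")
        (auto simp: prime_factors_multiplicity not_dvd_imp_multiplicity_0 subset_singleton_iff)
    with np show False by blast
  qed
  then obtain q where q: "Factorial_Ring.prime q" "q dvd order G" "q \<noteq> p" by blast
  \<comment> \<open>Exponent 1 in the Sylow theorem gives Cauchy's theorem: a subgroup of order q.
    The order of a nontrivial element of it would divide both q and a power of p.\<close>
  obtain m where "order G = q ^ 1 * m" using q(2) by auto
  then obtain H where H: "subgroup H G" "card H = q"
    using sylow_thm[OF q(1) is_group _ fin] by (metis power_one_right)
  have "\<not> H \<subseteq> {\<one>}"
  proof
    assume "H \<subseteq> {\<one>}"
    then have "card H \<le> 1" using card_mono[of "{\<one>}" H] by simp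
    then show False using H(2) prime_gt_1_nat[OF q(1)] by simp
  qed
  then obtain x where x: "x \<in> H" "x \<noteq> \<one>" by blast
  have xc: "x \<in> carrier G" using x H(1) subgroup.mem_carrier by metis
  interpret H: group "G\<lparr>carrier := H\<rparr>" using subgroup_imp_group H(1) by blast
  have "x [^]\<^bsub>G\<lparr>carrier := H\<rparr>\<^esub> order (G\<lparr>carrier := H\<rparr>) = \<one>"
    using H.pow_order_eq_1[of x] x by simp
  then have "x [^] q = \<one>" using H(2) by (simp add: order_def nat_pow_def)
  then have "ord x dvd q" using pow_eq_id xc by blast
  moreover obtain n where "x [^] (p ^ n) = \<one>" using pel[OF xc] by blast
  then have "ord x dvd p ^ n" using pow_eq_id xc by blast
  moreover have "coprime q (p ^ n)" using q p by (simp add: primes_coprime)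
  ultimately have "ord x = 1" by (metis coprime_common_divisor_nat nat_dvd_1_iff_1 coprime_def)
  then show False using x(2) ord_eq_1 xc by blast
qed

text \<open>The acting group may be infinite; only the permutations that it induces have to be of
  p-power order, and \<open>act_p\<close> says so element by element. Closed subgroups of profinite
  groups can thus act on finite coset spaces without passing to a finite quotient first.\<close>

locale p_action = group +
  fixes p :: nat and \<Omega> :: "'x set" and act :: "'a \<Rightarrow> 'x \<Rightarrow> 'x"
  assumes prime: "Factorial_Ring.prime p" and finite_space: "finite \<Omega>"
    and act_closed: "\<And>g x. g \<in> carrier G \<Longrightarrow> x \<in> \<Omega> \<Longrightarrow> act g x \<in> \<Omega>"
    and act_one: "\<And>x. x \<in> \<Omega> \<Longrightarrow> act \<one> x = x"
    and act_mult: "\<And>g h x. g \<in> carrier G \<Longrightarrow> h \<in> carrier G \<Longrightarrow> x \<in> \<Omega> \<Longrightarrow> act (g \<otimes> h) x = act g (act h x)"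
    and act_p: "\<And>g. g \<in> carrier G \<Longrightarrow> \<exists>n::nat. \<forall>x\<in>\<Omega>. act (g [^] (p ^ n)) x = x"
begin

lemma act_inv: "g \<in> carrier G \<Longrightarrow> x \<in> \<Omega> \<Longrightarrow> act (inv g) (act g x) = x"
  using act_mult[of "inv g" g x] act_one by simp

lemma act_Bij: assumes g: "g \<in> carrier G" shows "restrict (act g) \<Omega> \<in> Bij \<Omega>"
proof -
  have "bij_betw (act g) \<Omega> \<Omega>"
    by (rule bij_betwI[where g = "act (inv g)"])
      (use g act_inv[of g] act_inv[of "inv g"] act_closed in auto)
  then show ?thesis by (simp add: Bij_def bij_betw_restrict_eq)
qed

lemma act_hom: "(\<lambda>g. restrict (act g) \<Omega>) \<in> hom G (BijGroup \<Omega>)"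
proof (rule homI)
  fix g h assume "g \<in> carrier G" "h \<in> carrier G"
  then show "restrict (act (g \<otimes> h)) \<Omega> =
      restrict (act g) \<Omega> \<otimes>\<^bsub>BijGroup \<Omega>\<^esub> restrict (act h) \<Omega>"
    using act_Bij act_mult act_closed by (auto simp: BijGroup_def compose_def)
qed (simp add: act_Bij BijGroup_def)

definition "orb x = (\<lambda>g. act g x) ` carrier G"

text \<open>The induced permutations form a finite group, of p-power order by
  \<open>order_prime_power\<close>, with the same orbits; the orbit-stabilizer theorem applies to
  it.\<close>

lemma card_orb: assumes "x \<in> \<Omega>" shows "\<exists>n. card (orb x) = p ^ n"
proof -
  let ?\<phi> = "\<lambda>g. restrict (act g) \<Omega>" and ?B = "BijGroup \<Omega>"
  interpret B: group ?B by (rule group_BijGroup)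
  interpret h: group_hom G ?B ?\<phi>
    using act_hom by unfold_locales
  let ?I = "?\<phi> ` carrier G" and ?G = "?B\<lparr>carrier := ?\<phi> ` carrier G\<rparr>"
  have sub: "subgroup ?I ?B" by (rule h.img_is_subgroup)
  have fin: "finite ?I"
  proof (rule finite_subset)
    show "?I \<subseteq> \<Omega> \<rightarrow>\<^sub>E \<Omega>" using act_closed by auto
  qed (simp add: finite_space finite_PiE)
  interpret I: group ?G using B.subgroup_imp_group[OF sub] .
  have "\<exists>n. order ?G = p ^ n"
  proof (rule I.order_prime_power[OF _ prime])
    fix y assume "y \<in> carrier ?G"
    then obtain g where g: "g \<in> carrier G" "y = ?\<phi> g" by auto
    obtain n where n: "\<forall>x\<in>\<Omega>. act (g [^] (p ^ n)) x = x" using act_p g by blast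
    have "y [^]\<^bsub>?B\<^esub> (p ^ n) = ?\<phi> (g [^] (p ^ n))" using h.hom_nat_pow g by simp
    also have "\<dots> = \<one>\<^bsub>?B\<^esub>" using n by (auto simp: BijGroup_def)
    finally show "\<exists>n. y [^]\<^bsub>?G\<^esub> (p ^ n) = \<one>\<^bsub>?G\<^esub>" by (auto simp: nat_pow_def)
  qed (simp add: fin)
  then obtain n where n: "order ?G = p ^ n" ..
  have "group_action ?B \<Omega> id"
    unfolding group_action_def group_hom_def group_hom_axioms_def
    using B.is_group by (auto simp: hom_def)
  then interpret ga: group_action ?G \<Omega> id by (rule group_action.induced_action[OF _ sub])
  have "card (orbit ?G id x) dvd p ^ n" using ga.orbit_stabilizer_theorem[OF assms] n by (metis dvd_triv_left)
  moreover have "orbit ?G id x = orb x" using assms by (simp add: orbit_def orb_def setcompr_eq_image image_image)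
  ultimately show ?thesis using divides_primepow_nat[OF prime] by auto
qed

lemma orb_refl: "x \<in> \<Omega> \<Longrightarrow> x \<in> orb x"
  unfolding orb_def using act_one[of x] by (metis image_eqI one_closed)

lemma orb_subset: "x \<in> \<Omega> \<Longrightarrow> orb x \<subseteq> \<Omega>"
  using act_closed by (auto simp: orb_def)

lemma orb_eq: assumes "x \<in> \<Omega>" "y \<in> orb x" shows "orb y = orb x"
proof -
  obtain g where g: "g \<in> carrier G" "y = act g x" using assms by (auto simp: orb_def)
  show ?thesis
  proof
    show "orb y \<subseteq> orb x" using g assms(1) act_mult[symmetric] by (auto simp: orb_def)
  next
    have "act h x = act (h \<otimes> inv g) y" if "h \<in> carrier G" for h
      using g assms that by (simp add: act_mult act_closed act_inv)
    then show "orb x \<subseteq> orb y"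
      unfolding orb_def using g(1) by (metis image_subsetI image_eqI inv_closed m_closed)
  qed
qed

text \<open>Without a fixed point every orbit has p-power size greater than 1, so p divides the size
  of the whole space.\<close>

lemma exists_fixed_point:
  assumes "\<not> p dvd card \<Omega>"
  shows "\<exists>x\<in>\<Omega>. \<forall>g\<in>carrier G. act g x = x"
proof (rule ccontr)
  assume nf: "\<not> ?thesis"
  have "p dvd card c" if c: "c \<in> orb ` \<Omega>" for c
  proof -
    obtain x where x: "x \<in> \<Omega>" "c = orb x" using c by auto
    obtain n where n: "card c = p ^ n" using card_orb x by blast
    have "n \<noteq> 0"
    proof
      assume "n = 0"
      then have "is_singleton (orb x)" using n x by (simp add: is_singleton_altdef)
      then have "orb x = {x}" using orb_refl[OF x(1)] by (metis is_singletonE singletonD)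
      then have "\<forall>g\<in>carrier G. act g x = x" by (auto simp: orb_def)
      then show False using nf x by blast
    qed
    then show ?thesis using n by auto
  qed
  moreover have "card \<Omega> = (\<Sum>c\<in>orb ` \<Omega>. card c)"
  proof -
    have "\<Union>(orb ` \<Omega>) = \<Omega>" using orb_refl orb_subset by blast
    moreover have "pairwise disjnt (orb ` \<Omega>)"
      unfolding pairwise_def disjnt_def using orb_eq by blast
    ultimately show ?thesis
      using card_Union_disjoint[of "orb ` \<Omega>"] finite_subset[OF orb_subset finite_space] by fastforce
  qed
  ultimately have "p dvd card \<Omega>" by (simp add: dvd_sum)
  with assms show False ..
qed

text \<open>Removing \<open>x0\<close> leaves an invariant set of size congruent to -1 modulo p, to
  which \<open>exists_fixed_point\<close> applies.\<close>

lemma second_fixed_point: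
  assumes "p dvd card \<Omega>" "x0 \<in> \<Omega>" "\<forall>g\<in>carrier G. act g x0 = x0"
  shows "\<exists>x\<in>\<Omega>. x \<noteq> x0 \<and> (\<forall>g\<in>carrier G. act g x = x)"
proof -
  have ne: "act g x \<noteq> x0" if "g \<in> carrier G" "x \<in> \<Omega>" "x \<noteq> x0" for g x
    using act_inv[of g x] assms that by auto
  interpret r: p_action G p "\<Omega> - {x0}" act
  proof unfold_locales
    fix g assume "g \<in> carrier G"
    then show "\<exists>n. \<forall>x\<in>\<Omega> - {x0}. act (g [^] (p ^ n)) x = x" using act_p by blast
  qed (use prime finite_space act_closed act_one act_mult ne in auto)
  have "card \<Omega> > 0" using assms(2) finite_space by (auto simp: card_gt_0_iff)
  then have "card \<Omega> = Suc (card (\<Omega> - {x0}))"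
    using assms(2) finite_space by (simp add: card_Diff_singleton)
  then have "\<not> p dvd card (\<Omega> - {x0})"
    using assms(1) prime by (metis One_nat_def Suc_eq_plus1 dvd_add_right_iff not_prime_unit)
  then show ?thesis using r.exists_fixed_point by auto
qed

end

section \<open>Profinite groups\<close>

text \<open>Its use is to prove a set of cosets finite by exhibiting an invariant with finitely many
  values that determines the coset.\<close>

lemma finite_image_factor:
  assumes "finite (f ` A)" "\<And>x y. x \<in> A \<Longrightarrow> y \<in> A \<Longrightarrow> f x = f y \<Longrightarrow> g x = g y"
  shows "finite (g ` A)"
proof -
  have "g x = g (inv_into A f (f x))" if "x \<in> A" for x
    using that by (intro assms(2)) (auto simp: f_inv_into_f inv_into_into)
  then have "g ` A \<subseteq> (\<lambda>c. g (inv_into A f c)) ` f ` A"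
    by fastforce
  then show ?thesis using assms(1) finite_subset by blast
qed

section \<open>Cosets, conjugation and normalizers in an abstract group\<close>

context group
begin

lemma rcos_eq_iff:
  assumes "subgroup H G" "x \<in> carrier G" "y \<in> carrier G"
  shows "H #> x = H #> y \<longleftrightarrow> x \<otimes> inv y \<in> H"
  using assms repr_independence rcos_self subgroup.rcos_module[OF assms(1) is_group] by metis

lemma rcos_mem_image_iff:
  assumes N: "subgroup N G" and H: "subgroup H G" and "N \<subseteq> H" and x: "x \<in> carrier G"
  shows "N #> x \<in> (\<lambda>h. N #> h) ` H \<longleftrightarrow> x \<in> H"
proof
  assume "N #> x \<in> (\<lambda>h. N #> h) ` H"
  then obtain h where h: "h \<in> H" "N #> x = N #> h" by blast
  have hc: "h \<in> carrier G" using h(1) H subgroup.mem_carrier by metis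
  have "x \<otimes> inv h \<in> H" using rcos_eq_iff[OF N x hc] h assms(3) by blast
  then have "x \<otimes> inv h \<otimes> h \<in> H" using h(1) H subgroup.m_closed by metis
  then show "x \<in> H" using x hc by (simp add: m_assoc)
qed blast

lemma rcosets_image: "rcosets H = (\<lambda>x. H #> x) ` carrier G"
  by (auto simp: RCOSETS_def)

lemma inv_mult_cancel:
  assumes "g \<in> carrier G" "x \<in> carrier G"
  shows "inv g \<otimes> (g \<otimes> x) = x" "g \<otimes> (inv g \<otimes> x) = x"
  using assms by (simp_all add: m_assoc[symmetric])

lemma conj_mult:
  assumes "g \<in> carrier G" "x \<in> carrier G" "y \<in> carrier G"
  shows "g \<otimes> (x \<otimes> y) \<otimes> inv g = (g \<otimes> x \<otimes> inv g) \<otimes> (g \<otimes> y \<otimes> inv g)"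
  using assms by (simp add: m_assoc inv_mult_cancel)

lemma conj_conj:
  assumes "g \<in> carrier G" "h \<in> carrier G" "x \<in> carrier G"
  shows "(g \<otimes> h) \<otimes> x \<otimes> inv (g \<otimes> h) = g \<otimes> (h \<otimes> x \<otimes> inv h) \<otimes> inv g"
  using assms by (simp add: m_assoc inv_mult_group)

lemma conj_cancel:
  assumes "g \<in> carrier G" "x \<in> carrier G"
  shows "inv g \<otimes> (g \<otimes> x \<otimes> inv g) \<otimes> g = x" "g \<otimes> (inv g \<otimes> x \<otimes> g) \<otimes> inv g = x"
  using assms by (simp_all add: m_assoc inv_mult_cancel)

lemma conj_nat_pow:
  assumes "g \<in> carrier G" "x \<in> carrier G"
  shows "g \<otimes> x [^] (n::nat) \<otimes> inv g = (g \<otimes> x \<otimes> inv g) [^] n"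
  using assms by (induction n) (simp_all add: conj_mult)

lemma subgroup_nat_pow_closed: "subgroup H G \<Longrightarrow> x \<in> H \<Longrightarrow> x [^] (n::nat) \<in> H"
  by (induction n) (auto intro: subgroup.one_closed subgroup.m_closed)

text \<open>\<open>H\<close> may be infinite, where g H g^-1 \<subseteq> H alone does not give
  equality; hence the condition on g and on its inverse.\<close>

lemma mem_normalizer_iff:
  assumes "subgroup H G"
  shows "g \<in> normalizer G H \<longleftrightarrow>
    g \<in> carrier G \<and> (\<forall>h\<in>H. g \<otimes> h \<otimes> inv g \<in> H \<and> inv g \<otimes> h \<otimes> g \<in> H)"
proof -
  have sub: "H \<subseteq> carrier G" using assms subgroup.subset by blast
  have "g <# H #> inv g = (\<lambda>h. g \<otimes> h \<otimes> inv g) ` H" by (auto simp: l_coset_def r_coset_def)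
  moreover have "(\<lambda>h. g \<otimes> h \<otimes> inv g) ` H = H \<longleftrightarrow>
      (\<forall>h\<in>H. g \<otimes> h \<otimes> inv g \<in> H \<and> inv g \<otimes> h \<otimes> g \<in> H)" if g: "g \<in> carrier G"
  proof
    assume eq: "(\<lambda>h. g \<otimes> h \<otimes> inv g) ` H = H"
    show "\<forall>h\<in>H. g \<otimes> h \<otimes> inv g \<in> H \<and> inv g \<otimes> h \<otimes> g \<in> H"
    proof (intro ballI conjI)
      fix h assume h: "h \<in> H"
      show "g \<otimes> h \<otimes> inv g \<in> H" using eq h by blast
      have "h \<in> (\<lambda>h. g \<otimes> h \<otimes> inv g) ` H" using eq h by simp
      then obtain h' where "h' \<in> H" "h = g \<otimes> h' \<otimes> inv g" by blast
      then show "inv g \<otimes> h \<otimes> g \<in> H" using conj_cancel(1)[OF g, of h'] sub by auto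
    qed
  next
    assume st: "\<forall>h\<in>H. g \<otimes> h \<otimes> inv g \<in> H \<and> inv g \<otimes> h \<otimes> g \<in> H"
    have "h \<in> (\<lambda>h. g \<otimes> h \<otimes> inv g) ` H" if "h \<in> H" for h
      by (rule image_eqI[where x = "inv g \<otimes> h \<otimes> g"])
        (use st that conj_cancel(2)[OF g, of h] sub in auto)
    then show "(\<lambda>h. g \<otimes> h \<otimes> inv g) ` H = H" using st by blast
  qed
  ultimately show ?thesis using sub by (auto simp: normalizer_def stabilizer_def)
qed

text \<open>Multiplying a coset of \<open>H\<close> by \<open>L\<close> maps the cosets of
  \<open>H\<close> onto those of \<open>L\<close>, and it identifies the distinct cosets of 1 and of
  any element of \<open>L\<close> outside \<open>H\<close>.\<close>

lemma card_rcosets_less: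
  assumes H: "subgroup H G" and L: "subgroup L G" and "H \<subset> L" and fin: "finite (rcosets H)"
  shows "card (rcosets L) < card (rcosets H)"
proof -
  have sub: "H \<subseteq> carrier G" "L \<subseteq> carrier G" using H L subgroup.subset by auto
  have LH: "L <#> (H #> x) = L #> x" if "x \<in> carrier G" for x
  proof -
    have "L <#> H = L"
    proof
      show "L <#> H \<subseteq> L" using assms(3) subgroup.m_closed[OF L] by (auto simp: set_mult_def)
      show "L \<subseteq> L <#> H"
        using subgroup.one_closed[OF H] sub by (force simp: set_mult_def)
    qed
    then show ?thesis using setmult_rcos_assoc[OF sub(2,1) that] by simp
  qed
  have im: "rcosets L = (\<lambda>c. L <#> c) ` (rcosets H)"
    using LH by (force simp: rcosets_image image_image)
  obtain g where g: "g \<in> L" "g \<notin> H" using assms(3) by blast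
  have gc: "g \<in> carrier G" using g sub by blast
  have "H #> g \<noteq> H #> \<one>" using rcos_eq_iff[OF H gc one_closed] g gc by simp
  moreover have "L <#> (H #> g) = L <#> (H #> \<one>)"
    using LH gc rcos_eq_iff[OF L gc one_closed] g(1) by simp
  ultimately have "\<not> inj_on (\<lambda>c. L <#> c) (rcosets H)"
    using gc unfolding inj_on_def rcosets_image by blast
  then have "card ((\<lambda>c. L <#> c) ` (rcosets H)) \<noteq> card (rcosets H)"
    using fin by (metis eq_card_imp_inj_on)
  then show ?thesis using card_image_le[OF fin] im by (metis le_neq_implies_less)
qed

end

text \<open>
  A profinite group is presented by a base \<open>K\<close> of neighbourhoods of the identity consisting of normal
  subgroups of finite index. Compactness is not part of the presentation.
\<close>

locale profinite_base = group G for G (structure) +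
  fixes \<tau> :: "'a topology" and I :: "'i set" and K :: "'i \<Rightarrow> 'a set"
  assumes I_nonempty: "I \<noteq> {}"
    and K_directed: "\<And>i j. i \<in> I \<Longrightarrow> j \<in> I \<Longrightarrow> \<exists>k\<in>I. K k \<subseteq> K i \<and> K k \<subseteq> K j"
    and K_normal: "\<And>i. i \<in> I \<Longrightarrow> K i \<lhd> G"
    and K_finite: "\<And>i. i \<in> I \<Longrightarrow> finite (rcosets (K i))"
    and openin_base: "\<And>U. openin \<tau> U \<longleftrightarrow> U \<subseteq> carrier G \<and> (\<forall>x\<in>U. \<exists>i\<in>I. K i #> x \<subseteq> U)"
begin

lemma K_subgroup: "i \<in> I \<Longrightarrow> subgroup (K i) G"
  using K_normal normal_imp_subgroup by blast

lemma K_coset_subset: "i \<in> I \<Longrightarrow> x \<in> carrier G \<Longrightarrow> K i #> x \<subseteq> carrier G"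
  using r_coset_subset_G subgroup.subset[OF K_subgroup] by blast

section \<open>Open and closed subgroups of a profinite group\<close>

lemma topspace_base: "topspace \<tau> = carrier G"
proof -
  have "openin \<tau> (carrier G)"
    using I_nonempty K_coset_subset by (auto simp: openin_base)
  then show ?thesis using openin_base openin_subset by (metis openin_topspace subset_antisym)
qed

lemma closedin_base:
  "closedin \<tau> C \<longleftrightarrow> C \<subseteq> carrier G \<and>
     (\<forall>x\<in>carrier G. (\<forall>i\<in>I. (K i #> x) \<inter> C \<noteq> {}) \<longrightarrow> x \<in> C)"
proof -
  have "K i #> x \<subseteq> carrier G - C \<longleftrightarrow> (K i #> x) \<inter> C = {}" if "i \<in> I" "x \<in> carrier G" for i x
    using K_coset_subset[OF that] by auto
  then have "(\<forall>x\<in>carrier G - C. \<exists>i\<in>I. K i #> x \<subseteq> carrier G - C) \<longleftrightarrow>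
      (\<forall>x\<in>carrier G. (\<forall>i\<in>I. (K i #> x) \<inter> C \<noteq> {}) \<longrightarrow> x \<in> C)"
    by (simp add: Ball_def Bex_def cong: conj_cong) blast
  then show ?thesis by (simp add: closedin_def topspace_base openin_base)
qed

lemma finite_common_K:
  assumes "finite J" "J \<subseteq> I"
  shows "\<exists>k\<in>I. \<forall>j\<in>J. K k \<subseteq> K j"
  using assms
proof (induction J)
  case empty
  then show ?case using I_nonempty by blast
next
  case (insert j J)
  then obtain k where k: "k \<in> I" "\<forall>j\<in>J. K k \<subseteq> K j" by auto
  obtain l where "l \<in> I" "K l \<subseteq> K k" "K l \<subseteq> K j" using K_directed[of k j] k insert.prems by auto
  then show ?case using k by blast
qed

lemma subgroup_contains_K_coset:
  assumes "subgroup H G" "K i \<subseteq> H" "x \<in> H"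
  shows "K i #> x \<subseteq> H"
  using assms by (auto simp: r_coset_def subgroup.m_closed)

lemma open_subgroup_iff:
  assumes "subgroup H G"
  shows "openin \<tau> H \<longleftrightarrow> (\<exists>i\<in>I. K i \<subseteq> H)"
proof
  assume "openin \<tau> H"
  then obtain i where "i \<in> I" "K i #> \<one> \<subseteq> H"
    using openin_base subgroup.one_closed[OF assms] by blast
  then show "\<exists>i\<in>I. K i \<subseteq> H" using coset_mult_one subgroup.subset[OF K_subgroup] by metis
next
  assume "\<exists>i\<in>I. K i \<subseteq> H"
  then show "openin \<tau> H"
    using subgroup_contains_K_coset[OF assms] subgroup.subset[OF assms] by (auto simp: openin_base)
qed

lemma open_subgroup_closed:
  assumes H: "subgroup H G" and "openin \<tau> H"
  shows "closedin \<tau> H"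
  unfolding closedin_base
proof (intro conjI ballI impI)
  show "H \<subseteq> carrier G" using H subgroup.subset by blast
  fix x assume x: "x \<in> carrier G" "\<forall>i\<in>I. (K i #> x) \<inter> H \<noteq> {}"
  obtain i where i: "i \<in> I" "K i \<subseteq> H" using assms open_subgroup_iff by blast
  then obtain k where k: "k \<in> K i" "k \<otimes> x \<in> H" using x by (auto simp: r_coset_def)
  have kH: "k \<in> H" using k i by blast
  have "inv k \<otimes> (k \<otimes> x) \<in> H" using kH k H by (meson subgroup.m_closed subgroup.m_inv_closed)
  then show "x \<in> H" using x kH subgroup.mem_carrier[OF H] by (simp add: m_assoc[symmetric])
qed

lemma open_supergroup:
  assumes "subgroup H G" "openin \<tau> H" "subgroup L G" "H \<subseteq> L"
  shows "openin \<tau> L"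
  using assms open_subgroup_iff by (meson subset_trans)

lemma open_subgroup_finite_index:
  assumes H: "subgroup H G" and "openin \<tau> H"
  shows "finite (rcosets H)"
proof -
  obtain i where i: "i \<in> I" "K i \<subseteq> H" using assms open_subgroup_iff by blast
  have "finite ((\<lambda>x. H #> x) ` carrier G)"
  proof (rule finite_image_factor)
    show "finite ((\<lambda>x. K i #> x) ` carrier G)" using K_finite[OF i(1)] by (simp add: rcosets_image)
    fix x y assume "x \<in> carrier G" "y \<in> carrier G" "K i #> x = K i #> y"
    then show "H #> x = H #> y" using rcos_eq_iff[OF H] rcos_eq_iff[OF K_subgroup[OF i(1)]] i by auto
  qed
  then show ?thesis by (simp add: rcosets_image)
qed

text \<open>One level works for all of \<open>C\<close> at once, because some basic coset of
  \<open>x\<close> misses \<open>C\<close> entirely.\<close>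

lemma closed_subgroup_separate:
  assumes C: "closedin \<tau> C" and "subgroup C G" and x: "x \<in> carrier G" "x \<notin> C"
  shows "\<exists>i\<in>I. \<forall>c\<in>C. x \<otimes> inv c \<notin> K i"
proof -
  obtain i where i: "i \<in> I" "(K i #> x) \<inter> C = {}" using C x closedin_base by blast
  have "x \<otimes> inv c \<notin> K i" if "c \<in> C" for c
  proof
    assume "x \<otimes> inv c \<in> K i"
    then have "c \<in> K i #> x"
      using that x assms(2) rcos_eq_iff[OF K_subgroup[OF i(1)], of x c] subgroup.mem_carrier
        rcos_self[OF _ K_subgroup[OF i(1)]] by metis
    with i that show False by blast
  qed
  then show ?thesis using i by blast
qed

text \<open>Each of the finitely many nontrivial cosets has a representative separated from
  \<open>H\<close> at some level; a common refinement of these levels is contained in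
  \<open>H\<close>.\<close>

lemma closed_finite_index_open:
  assumes H: "subgroup H G" and C: "closedin \<tau> H" and fin: "finite (rcosets H)"
  shows "openin \<tau> H"
proof -
  have "rcosets H - {H} \<subseteq> (\<lambda>x. H #> x) ` (carrier G - H)"
    using coset_join2[OF _ H] by (auto simp: rcosets_image)
  then obtain R where R: "R \<subseteq> carrier G - H" "finite R" "rcosets H - {H} = (\<lambda>x. H #> x) ` R"
    using finite_subset_image[of "rcosets H - {H}" "\<lambda>x. H #> x" "carrier G - H"] fin
    by auto
  have "\<forall>x\<in>R. \<exists>i\<in>I. \<forall>c\<in>H. x \<otimes> inv c \<notin> K i"
    using closed_subgroup_separate[OF C H] R by blast
  then obtain f where f: "\<And>x. x \<in> R \<Longrightarrow> f x \<in> I \<and> (\<forall>c\<in>H. x \<otimes> inv c \<notin> K (f x))" by metis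
  obtain k where k: "k \<in> I" "\<forall>x\<in>R. K k \<subseteq> K (f x)"
    using finite_common_K[of "f ` R"] R(2) f by auto
  have "K k \<subseteq> H"
  proof (rule ccontr)
    assume "\<not> K k \<subseteq> H"
    then obtain y where y: "y \<in> K k" "y \<notin> H" by blast
    have yc: "y \<in> carrier G" using y k K_subgroup subgroup.mem_carrier by metis
    then have ne: "H #> y \<in> rcosets H - {H}" using y H coset_join1 subgroup.subset
      by (auto simp: rcosets_image)
    then obtain x where xR: "x \<in> R" "H #> y = H #> x" using R(3) by blast
    then have x: "x \<in> carrier G" "H #> x = H #> y" using R(1) by auto
    then have "x \<otimes> inv y \<in> H" using rcos_eq_iff[OF H x(1) yc] by simp
    \<comment> \<open>The element c = x y^-1 of \<open>H\<close> violates the separation of x: x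
      c^-1 is a conjugate of y, and y lies in the normal subgroup \<open>K k\<close>.\<close>
    moreover have "x \<otimes> inv (x \<otimes> inv y) = x \<otimes> y \<otimes> inv x"
      using x yc by (simp add: inv_mult_group m_assoc)
    moreover have "x \<otimes> y \<otimes> inv x \<in> K k" using K_normal[OF k(1)] x y normal_invE by blast
    ultimately show False using f[OF xR(1)] k xR(1) by (metis subsetD)
  qed
  then show ?thesis using open_subgroup_iff[OF H] k by blast
qed

text \<open>
  Pro-\<open>p\<close> subgroups are handled elementwise: a closed subgroup is pro-\<open>p\<close> exactly when the image of each
  of its elements in every finite quotient has \<open>p\<close>-power order.
\<close>

definition p_elt :: "nat \<Rightarrow> 'a \<Rightarrow> bool" where
  "p_elt p x \<longleftrightarrow> (\<forall>i\<in>I. \<exists>n::nat. x [^] (p ^ n) \<in> K i)"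

lemma p_elt_conj:
  assumes "p_elt p x" "x \<in> carrier G" "g \<in> carrier G"
  shows "p_elt p (g \<otimes> x \<otimes> inv g)"
  unfolding p_elt_def
proof
  fix i assume i: "i \<in> I"
  then obtain n where n: "x [^] (p ^ n) \<in> K i" using assms by (auto simp: p_elt_def)
  then have "g \<otimes> x [^] (p ^ n) \<otimes> inv g \<in> K i" using normal_invE K_normal[OF i] assms by blast
  then show "\<exists>n. (g \<otimes> x \<otimes> inv g) [^] (p ^ n) \<in> K i" using assms conj_nat_pow by metis
qed

text \<open>
  The group \<open>H\<close> acts on the cosets \<open>Ht\<close> with \<open>t \<in> T\<close>, whose number is a power of \<open>p\<close> greater than \<open>1\<close>. It
  fixes the coset \<open>H\<close>, hence another one.
\<close>

lemma normalizer_growth: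
  assumes p: "Factorial_Ring.prime p"
    and H: "subgroup H G" "openin \<tau> H" and T: "subgroup T G"
    and HT: "\<And>h t. h \<in> H \<Longrightarrow> t \<in> T \<Longrightarrow> h \<otimes> t \<otimes> inv h \<in> T"
    and pe: "\<And>x. x \<in> carrier G \<Longrightarrow> p_elt p x"
    and "\<not> T \<subseteq> H"
  shows "\<exists>t\<in>T - H. \<forall>h\<in>H. t \<otimes> h \<otimes> inv t \<in> H \<and> inv t \<otimes> h \<otimes> t \<in> H"
proof -
  obtain i where i: "i \<in> I" "K i \<subseteq> H" using H open_subgroup_iff by blast
  have sub: "H \<subseteq> carrier G" "T \<subseteq> carrier G" using H T subgroup.subset by auto
  define \<Omega> where "\<Omega> = (\<lambda>t. H #> t) ` T"
  have finW: "finite \<Omega>"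
    by (rule finite_subset[OF _ open_subgroup_finite_index[OF H]]) (use sub in \<open>auto simp: \<Omega>_def rcosets_image\<close>)
  \<comment> \<open>Since \<open>K i\<close> is normal and contained in \<open>H\<close>,
    multiplying by it on the right fixes every coset of \<open>H\<close>; some p-power of g lies in
    \<open>K i\<close>.\<close>
  have act_K: "\<exists>n. \<forall>c\<in>\<Omega>. c #> inv (g [^] (p ^ n)) = c" if g: "g \<in> carrier G" for g
  proof -
    obtain n where n: "g [^] (p ^ n) \<in> K i" using pe[OF g] i by (auto simp: p_elt_def)
    let ?k = "g [^] (p ^ n)"
    have "H #> t #> inv ?k = H #> t" if t: "t \<in> T" for t
    proof -
      have tc: "t \<in> carrier G" using t sub by blast
      have "inv ?k \<in> K i" using n K_subgroup[OF i(1)] subgroup.m_inv_closed by metis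
      then have "t \<otimes> inv ?k \<otimes> inv t \<in> H" using K_normal[OF i(1)] tc i normal_invE by blast
      then show ?thesis using rcos_eq_iff[OF H(1), of "t \<otimes> inv ?k" t] tc g sub
        by (simp add: coset_mult_assoc)
    qed
    then show ?thesis by (auto simp: \<Omega>_def)
  qed
  interpret GT: group "G\<lparr>carrier := T\<rparr>" using T subgroup_imp_group by blast
  interpret GH: group "G\<lparr>carrier := H\<rparr>" using H subgroup_imp_group by blast
  have one: "x #> inv \<one> = x" if "x \<in> \<Omega>" for x using that sub by (auto simp: \<Omega>_def r_coset_subset_G)
  have mult: "x #> inv (g \<otimes> h) = x #> inv h #> inv g"
    if "x \<in> \<Omega>" "g \<in> carrier G" "h \<in> carrier G" for x g h
    using that sub by (auto simp: \<Omega>_def r_coset_subset_G coset_mult_assoc inv_mult_group m_assoc)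
  \<comment> \<open>Two actions are needed: \<open>T\<close> acts transitively, which makes the
    number of cosets a power of p, while the fixed points sought are those of
    \<open>H\<close>.\<close>
  interpret T: p_action "G\<lparr>carrier := T\<rparr>" p \<Omega> "\<lambda>g c. c #> inv g"
  proof unfold_locales
    show "Factorial_Ring.prime p" "finite \<Omega>" by fact+
    fix g c assume g: "g \<in> carrier (G\<lparr>carrier := T\<rparr>)"
    then have gc: "g \<in> carrier G" using sub by auto
    show "c #> inv g \<in> \<Omega>" if c: "c \<in> \<Omega>"
    proof -
      obtain t where t: "t \<in> T" "c = H #> t" using c by (auto simp: \<Omega>_def)
      then have "c #> inv g = H #> (t \<otimes> inv g)" using gc sub by (auto simp: coset_mult_assoc)
      moreover have "t \<otimes> inv g \<in> T" using t g T subgroup.m_closed subgroup.m_inv_closed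
        by (metis partial_object.simps(1) partial_object.update_convs(1) partial_object.surjective)
      ultimately show ?thesis by (auto simp: \<Omega>_def)
    qed
    show "\<exists>n. \<forall>x\<in>\<Omega>. x #> inv (g [^]\<^bsub>G\<lparr>carrier := T\<rparr>\<^esub> p ^ n) = x"
      using act_K[OF gc] by (simp add: nat_pow_consistent[symmetric])
  qed (use one mult subsetD[OF sub(2)] in simp_all)
  interpret H: p_action "G\<lparr>carrier := H\<rparr>" p \<Omega> "\<lambda>g c. c #> inv g"
  proof unfold_locales
    show "Factorial_Ring.prime p" "finite \<Omega>" by fact+
    fix g c assume g: "g \<in> carrier (G\<lparr>carrier := H\<rparr>)"
    then have gc: "g \<in> carrier G" "g \<in> H" using sub by auto
    show "c #> inv g \<in> \<Omega>" if c: "c \<in> \<Omega>"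
    proof -
      obtain t where t: "t \<in> T" "c = H #> t" using c by (auto simp: \<Omega>_def)
      have tc: "t \<in> carrier G" using t sub by auto
      have "c #> inv g = H #> (t \<otimes> inv g)" using t tc gc sub by (auto simp: coset_mult_assoc)
      \<comment> \<open>A left factor from \<open>H\<close> is absorbed, which replaces t g^-1 by a
        conjugate of t that lies in \<open>T\<close>.\<close>
      also have "\<dots> = H #> (g \<otimes> t \<otimes> inv g)"
        using rcos_eq_iff[OF H(1), of "g \<otimes> t \<otimes> inv g" "t \<otimes> inv g"] gc tc
        by (simp add: inv_mult_group m_assoc inv_mult_cancel)
      finally show ?thesis using HT[OF gc(2) t(1)] by (auto simp: \<Omega>_def)
    qed
    show "\<exists>n. \<forall>x\<in>\<Omega>. x #> inv (g [^]\<^bsub>G\<lparr>carrier := H\<rparr>\<^esub> p ^ n) = x"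
      using act_K[OF gc(1)] by (simp add: nat_pow_consistent[symmetric])
  qed (use one mult subsetD[OF sub(1)] in simp_all)
  have HW: "H \<in> \<Omega>" unfolding \<Omega>_def
    by (rule image_eqI[where x = \<one>]) (use subgroup.one_closed[OF T] sub in auto)
  have orbW: "T.orb H = \<Omega>"
  proof -
    have "\<Omega> \<subseteq> T.orb H"
    proof
      fix c assume "c \<in> \<Omega>"
      then obtain t where t: "t \<in> T" "c = H #> t" by (auto simp: \<Omega>_def)
      then have "inv t \<in> T" "c = H #> inv (inv t)" using T subgroup.m_inv_closed sub by auto
      then show "c \<in> T.orb H" unfolding T.orb_def by auto
    qed
    then show ?thesis using T.orb_subset[OF HW] by blast
  qed
  obtain n where n: "card \<Omega> = p ^ n" using T.card_orb[OF HW] orbW by auto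
  obtain t0 where t0: "t0 \<in> T" "t0 \<notin> H" using assms(7) by blast
  then have "H #> t0 \<in> \<Omega>" "H #> t0 \<noteq> H" using coset_join1[OF _ _ H(1)] sub
    by (auto simp: \<Omega>_def)
  then have "card \<Omega> \<noteq> 1" using HW by (metis card_1_singletonE singletonD)
  then have "p dvd card \<Omega>" using n by (cases n) auto
  moreover have "H #> inv g = H" if "g \<in> H" for g
    using that H coset_join2 subgroup.m_inv_closed subgroup.mem_carrier by metis
  ultimately obtain c where c: "c \<in> \<Omega>" "c \<noteq> H" "\<forall>g\<in>H. c #> inv g = c"
    using H.second_fixed_point[OF _ HW] by auto
  then obtain t where t: "t \<in> T" "c = H #> t" by (auto simp: \<Omega>_def)
  have tc: "t \<in> carrier G" using t sub by blast
  have tH: "t \<notin> H" using c(2) t coset_join2[OF tc H(1)] by blast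
  have conj: "t \<otimes> h \<otimes> inv t \<in> H" if h: "h \<in> H" for h
  proof -
    have hc: "h \<in> carrier G" using h sub by blast
    have "H #> (t \<otimes> h) = H #> t"
      using c(3) t subgroup.m_inv_closed[OF H(1) h] hc tc sub by (metis coset_mult_assoc inv_inv)
    then show ?thesis using rcos_eq_iff[OF H(1), of "t \<otimes> h" t] hc tc by simp
  qed
  \<comment> \<open>The fixed point gives only t H t^-1 \<subseteq> H. As t^(p^m) lies in
    \<open>H\<close> for some m, t^-1 equals t^(p^m - 1) up to a left factor from \<open>H\<close>,
    so iterating the inclusion yields the inverse one.\<close>
  have pow: "t [^] (m::nat) \<otimes> h \<otimes> inv (t [^] m) \<in> H" if "h \<in> H" for h m
    using that
  proof (induction m arbitrary: h)
    case 0
    then show ?case using sub by auto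
  next
    case (Suc m)
    then show ?case using conj[of h] tc sub Suc.IH[OF conj[of h]]
      by (simp add: conj_conj subsetD)
  qed
  obtain m where m: "t [^] (p ^ m) \<in> K i" using pe[OF tc] i by (auto simp: p_elt_def)
  have "inv t \<otimes> h \<otimes> t \<in> H" if h: "h \<in> H" for h
  proof -
    define q where "q = p ^ m - 1"
    have "p ^ m = Suc q" using prime_gt_0_nat[OF p] by (simp add: q_def)
    then have k: "t [^] q \<otimes> t \<in> H" using m i by auto
    have hc: "h \<in> carrier G" using h sub by blast
    let ?k = "t [^] q \<otimes> t"
    have "inv ?k \<otimes> (t [^] q \<otimes> h \<otimes> inv (t [^] q)) \<otimes> ?k \<in> H"
      using k pow[OF h] H(1) subgroup.m_closed subgroup.m_inv_closed by metis
    moreover have "inv ?k \<otimes> (t [^] q \<otimes> h \<otimes> inv (t [^] q)) \<otimes> ?k = inv t \<otimes> h \<otimes> t"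
      using tc hc by (simp add: inv_mult_group m_assoc inv_mult_cancel)
    ultimately show ?thesis by simp
  qed
  then show ?thesis using t tH conj by blast
qed

section \<open>Sylow conjugation and pro-p subgroups of quotients\<close>

lemma p_elt_mult_K:
  assumes i: "i \<in> I" and "p_elt p n" "n \<in> carrier G" "k \<in> K i"
  shows "\<exists>m::nat. (n \<otimes> k) [^] (p ^ m) \<in> K i"
proof -
  interpret N: normal "K i" G by (rule K_normal[OF i])
  have kc: "k \<in> carrier G" using assms by auto
  obtain m where m: "n [^] (p ^ m) \<in> K i" using assms by (auto simp: p_elt_def)
  \<comment> \<open>The normal subgroup \<open>K i\<close> absorbs the factor k also on the
    right.\<close>
  have "K i #> (n \<otimes> k) = K i #> n"
    using rcos_eq_iff[OF K_subgroup[OF i], of "n \<otimes> k" n] N.inv_op_closed2 assms kc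
    by (simp add: m_assoc)
  then have "K i #> ((n \<otimes> k) [^] (p ^ m)) = K i #> (n [^] (p ^ m))"
    using N.FactGroup_pow assms kc by (metis m_closed)
  then have "K i #> ((n \<otimes> k) [^] (p ^ m)) = K i"
    using coset_join2[OF _ K_subgroup[OF i] m] assms by simp
  then show ?thesis
    using coset_join1[OF _ _ K_subgroup[OF i]] assms(3) kc by blast
qed

text \<open>
  Modulo each \<open>K i\<close> a conjugating element is obtained from a fixed point of \<open>H\<close> on the cosets of \<open>S K\<^sub>i\<close>;
  compactness provides an element that serves all \<open>i\<close>.
\<close>

lemma sylow_conjugation:
  assumes p: "Factorial_Ring.prime p" and compact: "compact_space \<tau>"
    and S: "subgroup S G" "closedin \<tau> S"
    and index: "\<And>i. i \<in> I \<Longrightarrow> \<not> p dvd card (rcosets (S <#> K i))"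
    and H: "subgroup H G" and pe: "\<And>h. h \<in> H \<Longrightarrow> p_elt p h"
  shows "\<exists>g\<in>carrier G. \<forall>h\<in>H. g \<otimes> h \<otimes> inv g \<in> S"
proof -
  have sub: "S \<subseteq> carrier G" "H \<subseteq> carrier G" using S H subgroup.subset by auto
  have L: "subgroup (S <#> K i) G" if "i \<in> I" for i
    using S(1) K_normal[OF that] by (metis commut_normal mult_norm_subgroup)
  have KL: "K i \<subseteq> S <#> K i" if "i \<in> I" for i
  proof
    fix k assume k: "k \<in> K i"
    then have "\<one> \<otimes> k = k" using K_subgroup[OF that] subgroup.mem_carrier l_one by metis
    then show "k \<in> S <#> K i" using k subgroup.one_closed[OF S(1)] by (force simp: set_mult_def)
  qed
  \<comment> \<open>Conjugators that work modulo \<open>K i\<close>. These sets are nonempty, closed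
    and shrink with \<open>K i\<close>, as the finite intersection property requires.\<close>
  define C where "C i = {g \<in> carrier G. \<forall>h\<in>H. g \<otimes> h \<otimes> inv g \<in> S <#> K i}" for i
  have C_nonempty: "C i \<noteq> {}" if i: "i \<in> I" for i
  proof -
    let ?L = "S <#> K i"
    have Lsub: "?L \<subseteq> carrier G" using L[OF i] subgroup.subset by blast
    interpret GH: group "G\<lparr>carrier := H\<rparr>" using H subgroup_imp_group by blast
    have cosets: "\<exists>x\<in>carrier G. c = ?L #> x" if "c \<in> rcosets ?L" for c
      using that by (auto simp: rcosets_image)
    interpret a: p_action "G\<lparr>carrier := H\<rparr>" p "rcosets ?L" "\<lambda>h c. c #> inv h"
    proof unfold_locales
      show "Factorial_Ring.prime p" by fact
      \<comment> \<open>An infinite set has \<open>card\<close> 0, which p divides, so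
        \<open>index\<close> contains finiteness as well.\<close>
      show "finite (rcosets ?L)" using index[OF i] by (metis card.infinite dvd_0_right)
      fix g assume g: "g \<in> carrier (G\<lparr>carrier := H\<rparr>)"
      then have gc: "g \<in> carrier G" "g \<in> H" using sub by auto
      show "c #> inv g \<in> rcosets ?L" if "c \<in> rcosets ?L" for c
        using cosets[OF that] gc Lsub by (auto simp: coset_mult_assoc rcosets_image)
      show "c #> inv (g \<otimes>\<^bsub>G\<lparr>carrier := H\<rparr>\<^esub> h) = (c #> inv h) #> inv g"
        if "h \<in> carrier (G\<lparr>carrier := H\<rparr>)" "c \<in> rcosets ?L" for c h
      proof -
        have "h \<in> carrier G" using that sub by auto
        then show ?thesis using cosets[OF that(2)] gc Lsub
          by (auto simp: coset_mult_assoc inv_mult_group m_assoc)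
      qed
      obtain n where n: "g [^] (p ^ n) \<in> K i" using pe[OF gc(2)] i by (auto simp: p_elt_def)
      let ?k = "g [^] (p ^ n)"
      have "c #> inv ?k = c" if c: "c \<in> rcosets ?L" for c
      proof -
        obtain x where x: "x \<in> carrier G" "c = ?L #> x" using cosets[OF c] by blast
        have "inv ?k \<in> K i" using n K_subgroup[OF i] subgroup.m_inv_closed by metis
        then have "x \<otimes> inv ?k \<otimes> inv x \<in> ?L" using K_normal[OF i] x KL[OF i] normal_invE by blast
        then show ?thesis using rcos_eq_iff[OF L[OF i], of "x \<otimes> inv ?k" x] x gc Lsub
          by (simp add: coset_mult_assoc)
      qed
      then show "\<exists>n. \<forall>x\<in>rcosets ?L. x #> inv (g [^]\<^bsub>G\<lparr>carrier := H\<rparr>\<^esub> p ^ n) = x"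
        by (auto simp: nat_pow_consistent[symmetric])
    next
      fix c assume "c \<in> rcosets ?L"
      from cosets[OF this] show "c #> inv \<one>\<^bsub>G\<lparr>carrier := H\<rparr>\<^esub> = c"
        using Lsub by (auto simp: coset_mult_assoc)
    qed
    obtain c where c: "c \<in> rcosets ?L" "\<forall>h\<in>H. c #> inv h = c"
      using a.exists_fixed_point[OF index[OF i]] by auto
    then obtain x where x: "x \<in> carrier G" "c = ?L #> x" using cosets by blast
    have "x \<otimes> h \<otimes> inv x \<in> ?L" if h: "h \<in> H" for h
    proof -
      have hc: "h \<in> carrier G" using h sub by blast
      have "?L #> (x \<otimes> h) = ?L #> x"
        using c(2) x subgroup.m_inv_closed[OF H h] hc Lsub by (metis coset_mult_assoc inv_inv)
      then show ?thesis using rcos_eq_iff[OF L[OF i], of "x \<otimes> h" x] hc x by simp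
    qed
    then show ?thesis using x by (auto simp: C_def)
  qed
  have C_mono: "C k \<subseteq> C i" if "K k \<subseteq> K i" for i k
    using that mono_set_mult[of S S "K k" "K i" G] by (auto simp: C_def)
  have C_closed: "closedin \<tau> (C i)" if i: "i \<in> I" for i
    unfolding closedin_base
  proof (intro conjI ballI impI)
    show "C i \<subseteq> carrier G" by (auto simp: C_def)
    fix x assume x: "x \<in> carrier G" "\<forall>j\<in>I. (K j #> x) \<inter> C i \<noteq> {}"
    then obtain k where k: "k \<in> K i" "k \<otimes> x \<in> C i" using i by (auto simp: r_coset_def)
    have kc: "k \<in> carrier G" using k K_subgroup[OF i] subgroup.mem_carrier by metis
    have kL: "k \<in> S <#> K i" "inv k \<in> S <#> K i"
      using k KL[OF i] subgroup.m_inv_closed[OF L[OF i]] by auto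
    have "x \<otimes> h \<otimes> inv x \<in> S <#> K i" if h: "h \<in> H" for h
    proof -
      have hc: "h \<in> carrier G" using h sub by blast
      have "k \<otimes> (x \<otimes> h \<otimes> inv x) \<otimes> inv k \<in> S <#> K i"
        using k(2) h conj_conj[OF kc x(1) hc] by (auto simp: C_def)
      then have "inv k \<otimes> (k \<otimes> (x \<otimes> h \<otimes> inv x) \<otimes> inv k) \<otimes> k \<in> S <#> K i"
        using kL L[OF i] by (meson subgroup.m_closed)
      then show ?thesis using conj_cancel(1)[OF kc, of "x \<otimes> h \<otimes> inv x"] x hc by simp
    qed
    then show "x \<in> C i" using x by (auto simp: C_def)
  qed
  have "\<Inter>(C ` I) \<noteq> {}"
  proof (rule compact_space_fip[THEN iffD1, OF compact, rule_format], intro conjI ballI allI impI)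
    fix c assume "c \<in> C ` I" then show "closedin \<tau> c" using C_closed by auto
  next
    fix F assume "finite F \<and> F \<subseteq> C ` I"
    then obtain J where J: "finite J" "J \<subseteq> I" "F = C ` J"
      by (meson finite_subset_image)
    obtain k where k: "k \<in> I" "\<forall>j\<in>J. K k \<subseteq> K j" using finite_common_K J by blast
    then have "C k \<subseteq> \<Inter>F" unfolding J(3) using C_mono by blast
    then show "\<Inter>F \<noteq> {}" using C_nonempty[OF k(1)] by auto
  qed
  then obtain g where g: "\<And>i. i \<in> I \<Longrightarrow> g \<in> C i" by blast
  have gc: "g \<in> carrier G" using g I_nonempty by (auto simp: C_def)
  \<comment> \<open>Membership in S K_i for every i puts the conjugate into the closure of
    \<open>S\<close>, which is \<open>S\<close>.\<close>
  have "g \<otimes> h \<otimes> inv g \<in> S" if h: "h \<in> H" for h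
  proof -
    let ?x = "g \<otimes> h \<otimes> inv g"
    have xc: "?x \<in> carrier G" using gc h sub by auto
    have "(K i #> ?x) \<inter> S \<noteq> {}" if i: "i \<in> I" for i
    proof -
      have "?x \<in> K i <#> S" using g[OF i] h commut_normal[OF S(1) K_normal[OF i]] by (auto simp: C_def)
      then obtain k s where ks: "k \<in> K i" "s \<in> S" "?x = k \<otimes> s" by (auto simp: set_mult_def)
      have kc: "k \<in> carrier G" using ks K_subgroup[OF i] subgroup.mem_carrier by metis
      then have "inv k \<otimes> ?x = s" using ks(2) sub unfolding ks(3) by (auto simp: inv_mult_cancel)
      moreover have "inv k \<in> K i" using ks K_subgroup[OF i] subgroup.m_inv_closed by metis
      ultimately show ?thesis using ks(2) by (force simp: r_coset_def)
    qed
    then show ?thesis using S(2) xc closedin_base by blast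
  qed
  then show ?thesis using gc by blast
qed

text \<open>The preimage in \<open>H\<close> of an open normal subgroup M of H/N contains the
  intersection of \<open>H\<close> with some K_i. Hence the quotient by M is finite, and each of its
  elements is killed by a p-power, so \<open>order_prime_power\<close> applies.\<close>

lemma quotient_image_pro_p:
  assumes p: "Factorial_Ring.prime p"
    and N: "N \<lhd> G" and H: "subgroup H G" "closedin \<tau> H" and NH: "N \<subseteq> H"
    and pe: "\<And>h. h \<in> H \<Longrightarrow> p_elt p h"
  shows "pro_p_subgroup p (G Mod N) (quotient_top G \<tau> N) ((\<lambda>h. N #> h) ` H)"
proof -
  let ?q = "\<lambda>h. N #> h" and ?Q = "G Mod N" and ?t = "quotient_top G \<tau> N"
  let ?U = "?q ` H"
  let ?R = "?Q\<lparr>carrier := ?U\<rparr>"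
  interpret N: normal N G by (rule N)
  interpret Q: group ?Q by (rule N.factorgroup_is_group)
  interpret q: group_hom G ?Q ?q
    using N.r_coset_hom_Mod by unfold_locales
  have sub: "H \<subseteq> carrier G" using H subgroup.subset by auto
  have U: "subgroup ?U ?Q" using q.subgroup_img_is_subgroup H by blast
  interpret R: group ?R using Q.subgroup_imp_group[OF U] .
  note pre = rcos_mem_image_iff[OF N.subgroup_axioms H(1) NH]
  have top: "topspace ?t = carrier ?Q"
  proof
    show "topspace ?t \<subseteq> carrier ?Q"
      using openin_quotient_top[of G \<tau> N "topspace ?t"] openin_topspace by blast
    have "{x \<in> topspace \<tau>. N #> x \<in> carrier ?Q} = topspace \<tau>"
      by (auto simp: topspace_base carrier_FactGroup)
    then have "openin ?t (carrier ?Q)" by (simp add: openin_quotient_top)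
    then show "carrier ?Q \<subseteq> topspace ?t" by (rule openin_subset)
  qed
  have "closedin ?t ?U"
  proof -
    have "{x \<in> topspace \<tau>. N #> x \<in> carrier ?Q - ?U} = topspace \<tau> - H"
      using pre sub by (auto simp: topspace_base carrier_FactGroup)
    then have "openin ?t (carrier ?Q - ?U)"
      using H(2) by (simp add: openin_quotient_top closedin_def)
    then show ?thesis using subgroup.subset[OF U] by (simp add: closedin_def top)
  qed
  moreover have "\<exists>n. card (rcosets\<^bsub>?R\<^esub> M) = p ^ n"
    if M: "M \<lhd> ?R" and Mo: "openin (subtopology ?t ?U) M" for M
  proof -
    interpret M: normal M ?R by (rule M)
    obtain V where V: "openin ?t V" "M = V \<inter> ?U" using Mo by (auto simp: openin_subtopology)
    have "N \<in> M" using M.one_closed by simp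
    then have "\<one> \<in> {x \<in> topspace \<tau>. N #> x \<in> V}" using V N.subset by (simp add: topspace_base)
    moreover have "openin \<tau> {x \<in> topspace \<tau>. N #> x \<in> V}" using V openin_quotient_top by blast
    ultimately obtain i where i: "i \<in> I" "K i #> \<one> \<subseteq> {x \<in> topspace \<tau>. N #> x \<in> V}"
      using openin_base by blast
    then have iV: "K i \<subseteq> {x. N #> x \<in> V}" using subgroup.subset[OF K_subgroup[OF i(1)]] by auto
    have iM: "N #> h \<in> M" if "h \<in> H" "h \<in> K i" for h using that iV V by auto
    interpret m: group "?R Mod M" by (rule M.factorgroup_is_group)
    let ?f = "\<lambda>h. M #>\<^bsub>?R\<^esub> (N #> h)"
    have car: "carrier (?R Mod M) = ?f ` H" by (simp add: carrier_FactGroup image_image)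
    have "finite (?f ` H)"
    proof (rule finite_image_factor)
      show "finite ((\<lambda>x. K i #> x) ` H)"
        by (rule finite_subset[OF _ K_finite[OF i(1)]]) (use sub in \<open>auto simp: rcosets_image\<close>)
      fix x y assume xy: "x \<in> H" "y \<in> H" "K i #> x = K i #> y"
      have c: "x \<in> carrier G" "y \<in> carrier G" using xy sub by auto
      have "x \<otimes> inv y \<in> K i" using xy c rcos_eq_iff[OF K_subgroup[OF i(1)]] by blast
      moreover have "x \<otimes> inv y \<in> H" using xy H(1) by (meson subgroup.m_closed subgroup.m_inv_closed)
      ultimately have "N #> (x \<otimes> inv y) \<in> M" using iM by blast
      moreover have "N #> (x \<otimes> inv y) = (N #> x) \<otimes>\<^bsub>?R\<^esub> inv\<^bsub>?R\<^esub> (N #> y)"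
        using c q.hom_mult[of x "inv y"] q.hom_inv[of y] Q.m_inv_consistent[OF U] xy by simp
      ultimately show "?f x = ?f y"
        using R.rcos_eq_iff[OF M.subgroup_axioms, of "N #> x" "N #> y"] xy by simp
    qed
    then have fin: "finite (carrier (?R Mod M))" by (simp add: car)
    have "\<exists>n. order (?R Mod M) = p ^ n"
    proof (rule m.order_prime_power[OF fin p])
      fix c assume "c \<in> carrier (?R Mod M)"
      then obtain h where h: "h \<in> H" "c = ?f h" using car by auto
      have hc: "h \<in> carrier G" using h sub by blast
      obtain n where n: "h [^] (p ^ n) \<in> K i" using pe[OF h(1)] i by (auto simp: p_elt_def)
      have "c [^]\<^bsub>?R Mod M\<^esub> (p ^ n) = M #>\<^bsub>?R\<^esub> ((N #> h) [^]\<^bsub>?R\<^esub> (p ^ n))"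
        using h M.FactGroup_pow[of "N #> h" "p ^ n"] by simp
      also have "(N #> h) [^]\<^bsub>?R\<^esub> (p ^ n) = N #> (h [^] (p ^ n))"
        using N.FactGroup_pow[OF hc] by (simp add: Q.nat_pow_consistent[symmetric])
      also have "M #>\<^bsub>?R\<^esub> (N #> (h [^] (p ^ n))) = M"
      proof (rule R.coset_join2[OF _ M.subgroup_axioms])
        have "h [^] (p ^ n) \<in> H" using subgroup_nat_pow_closed[OF H(1) h(1)] .
        then show "N #> (h [^] (p ^ n)) \<in> M" using iM n by blast
        then show "N #> (h [^] (p ^ n)) \<in> carrier ?R" using M.subset by blast
      qed
      finally show "\<exists>n. c [^]\<^bsub>?R Mod M\<^esub> (p ^ n) = \<one>\<^bsub>?R Mod M\<^esub>" by auto
    qed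
    then show ?thesis by (simp add: order_def FactGroup_def)
  qed
  ultimately show ?thesis unfolding pro_p_subgroup_def using U by blast
qed

text \<open>For b in the preimage, the pro-p condition is applied to the open normal subgroup
  \<open>M\<close>, the part of N K_i / N inside \<open>U\<close>: it gives b^(p^n) in N K_i. The
  factor from \<open>N\<close> is a p-element, so by \<open>p_elt_mult_K\<close> a further p-power
  lies in K_i.\<close>

lemma pro_p_preimage:
  assumes N: "N \<lhd> G" and peN: "\<And>n. n \<in> N \<Longrightarrow> p_elt p n"
    and U: "pro_p_subgroup p (G Mod N) (quotient_top G \<tau> N) U"
  defines "B \<equiv> {b \<in> carrier G. N #> b \<in> U}"
  shows "subgroup B G" "\<And>b. b \<in> B \<Longrightarrow> p_elt p b"
proof -
  let ?q = "\<lambda>h. N #> h" and ?Q = "G Mod N" and ?t = "quotient_top G \<tau> N"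
  let ?R = "?Q\<lparr>carrier := U\<rparr>"
  interpret N: normal N G by (rule N)
  interpret Q: group ?Q by (rule N.factorgroup_is_group)
  interpret q: group_hom G ?Q ?q
    using N.r_coset_hom_Mod by unfold_locales
  have Us: "subgroup U ?Q" using U by (simp add: pro_p_subgroup_def)
  interpret R: group ?R using Q.subgroup_imp_group[OF Us] .
  show "subgroup B G"
  proof (rule subgroupI)
    show "B \<subseteq> carrier G" by (auto simp: B_def)
    have "\<one> \<in> B" using subgroup.one_closed[OF Us] q.hom_one by (simp add: B_def)
    then show "B \<noteq> {}" by auto
    show "inv a \<in> B" if "a \<in> B" for a
      using that q.hom_inv[of a] subgroup.m_inv_closed[OF Us] by (auto simp: B_def)
    show "a \<otimes> b \<in> B" if "a \<in> B" "b \<in> B" for a b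
      using that q.hom_mult[of a b] subgroup.m_closed[OF Us] by (auto simp: B_def)
  qed
  fix b assume b: "b \<in> B"
  have bc: "b \<in> carrier G" "N #> b \<in> U" using b by (auto simp: B_def)
  show "p_elt p b" unfolding p_elt_def
  proof
    fix i assume i: "i \<in> I"
    have Ksub: "K i \<subseteq> carrier G" using K_subgroup[OF i] subgroup.subset by blast
    define V where "V = ?q ` K i"
    define M where "M = V \<inter> U"
    have "V \<lhd> ?Q" unfolding V_def
      by (rule normal.surj_hom_normal_subgroup[OF K_normal[OF i]])
        (auto simp: q.group_hom_axioms carrier_FactGroup)
    then have M: "M \<lhd> ?R" unfolding M_def using Q.normal_Int_subgroup[OF Us] by blast
    interpret M: normal M ?R by (rule M)
    have "openin ?t V"
    proof -
      let ?W = "{x \<in> topspace \<tau>. N #> x \<in> V}"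
      have "\<exists>i\<in>I. K i #> x \<subseteq> ?W" if x: "x \<in> ?W" for x
      proof (rule bexI[OF _ i], rule subsetI)
        fix y assume "y \<in> K i #> x"
        then obtain k where k: "k \<in> K i" "y = k \<otimes> x" by (auto simp: r_coset_def)
        have xc: "x \<in> carrier G" using x topspace_base by auto
        have kc: "k \<in> carrier G" using k Ksub by blast
        obtain k' where k': "k' \<in> K i" "N #> x = N #> k'" using x by (auto simp: V_def)
        have "N #> y = (N #> k) <#> (N #> x)" using q.hom_mult[OF kc xc] k by simp
        also have "\<dots> = N #> (k \<otimes> k')" using q.hom_mult[OF kc, of k'] k' Ksub by auto
        finally have "N #> y \<in> V"
          using subgroup.m_closed[OF K_subgroup[OF i] k(1) k'(1)] by (simp add: V_def)
        then show "y \<in> ?W" using k xc kc by (simp add: topspace_base)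
      qed
      then have "openin \<tau> ?W" unfolding openin_base by (auto simp: topspace_base)
      moreover have "V \<subseteq> carrier ?Q" using Ksub by (auto simp: V_def carrier_FactGroup)
      ultimately show ?thesis by (simp add: openin_quotient_top)
    qed
    then have "openin (subtopology ?t U) M" unfolding M_def openin_subtopology by blast
    then obtain n where n: "card (rcosets\<^bsub>?R\<^esub> M) = p ^ n"
      using U M by (auto simp: pro_p_subgroup_def)
    interpret m: group "?R Mod M" by (rule M.factorgroup_is_group)
    have "order (?R Mod M) = p ^ n" using n by (simp add: order_def FactGroup_def)
    moreover have "M #>\<^bsub>?R\<^esub> (N #> b) \<in> carrier (?R Mod M)" using bc by (auto simp: carrier_FactGroup)
    ultimately have "(M #>\<^bsub>?R\<^esub> (N #> b)) [^]\<^bsub>?R Mod M\<^esub> (p ^ n) = M"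
      using m.pow_order_eq_1 by (metis one_FactGroup)
    then have "M #>\<^bsub>?R\<^esub> ((N #> b) [^]\<^bsub>?R\<^esub> (p ^ n)) = M"
      using M.FactGroup_pow[of "N #> b" "p ^ n"] bc by simp
    moreover have "(N #> b) [^]\<^bsub>?R\<^esub> (p ^ n) = N #> (b [^] (p ^ n))"
      using N.FactGroup_pow[OF bc(1)] by (simp add: Q.nat_pow_consistent[symmetric])
    moreover have "(N #> b) [^]\<^bsub>?R\<^esub> (p ^ n) \<in> carrier ?R" using bc R.nat_pow_closed by simp
    ultimately have "N #> (b [^] (p ^ n)) \<in> M"
      using R.coset_join1[OF _ _ M.subgroup_axioms] by metis
    then obtain k where k: "k \<in> K i" "N #> (b [^] (p ^ n)) = N #> k" by (auto simp: M_def V_def)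
    have kc: "k \<in> carrier G" using k Ksub by blast
    let ?n = "b [^] (p ^ n) \<otimes> inv k"
    have nN: "?n \<in> N" using rcos_eq_iff[OF N.subgroup_axioms _ kc] bc k by simp
    obtain m where m: "(?n \<otimes> k) [^] (p ^ m) \<in> K i"
      using p_elt_mult_K[OF i peN[OF nN] _ k(1)] nN by auto
    moreover have "?n \<otimes> k = b [^] (p ^ n)" using bc kc by (simp add: m_assoc)
    ultimately have "b [^] (p ^ (n + m)) \<in> K i" using bc by (simp add: nat_pow_pow power_add)
    then show "\<exists>n. b [^] (p ^ n) \<in> K i" by blast
  qed
qed

lemma conj_closed_subgroup:
  assumes S: "subgroup S G" "closedin \<tau> S" and a: "a \<in> carrier G"
  defines "S' \<equiv> {x \<in> carrier G. a \<otimes> x \<otimes> inv a \<in> S}"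
  shows "subgroup S' G" "closedin \<tau> S'"
proof -
  show "subgroup S' G"
  proof (rule subgroupI)
    show "S' \<subseteq> carrier G" by (auto simp: S'_def)
    have "\<one> \<in> S'" using a subgroup.one_closed[OF S(1)] by (simp add: S'_def)
    then show "S' \<noteq> {}" by auto
    show "inv x \<in> S'" if "x \<in> S'" for x
    proof -
      have "a \<otimes> inv x \<otimes> inv a = inv (a \<otimes> x \<otimes> inv a)"
        using that a by (simp add: S'_def inv_mult_group m_assoc)
      then show ?thesis using that subgroup.m_inv_closed[OF S(1)] by (simp add: S'_def)
    qed
    show "x \<otimes> y \<in> S'" if "x \<in> S'" "y \<in> S'" for x y
      using that a subgroup.m_closed[OF S(1)] by (simp add: S'_def conj_mult)
  qed
  show "closedin \<tau> S'"
    unfolding closedin_base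
  proof (intro conjI ballI impI)
    show "S' \<subseteq> carrier G" by (auto simp: S'_def)
    fix x assume x: "x \<in> carrier G" "\<forall>i\<in>I. (K i #> x) \<inter> S' \<noteq> {}"
    have "(K i #> (a \<otimes> x \<otimes> inv a)) \<inter> S \<noteq> {}" if i: "i \<in> I" for i
    proof -
      obtain k where k: "k \<in> K i" "k \<otimes> x \<in> S'" using x i by (auto simp: r_coset_def)
      have kc: "k \<in> carrier G" using k K_subgroup[OF i] subgroup.mem_carrier by metis
      have "a \<otimes> k \<otimes> inv a \<in> K i" using normal_invE(2)[OF K_normal[OF i] a k(1)] .
      then have "a \<otimes> (k \<otimes> x) \<otimes> inv a \<in> K i #> (a \<otimes> x \<otimes> inv a)"
        using conj_mult[OF a kc x(1)] by (auto simp: r_coset_def)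
      then show ?thesis using k(2) by (auto simp: S'_def)
    qed
    moreover have "a \<otimes> x \<otimes> inv a \<in> carrier G" using a x by simp
    ultimately show "x \<in> S'" using S(2) x(1) unfolding closedin_base S'_def by blast
  qed
qed

text \<open>
  Each member \<open>V\<close> of a path starting at \<open>S/N\<close> is conjugate into \<open>S/N\<close>. If \<open>g\<close> and \<open>h\<close> conjugate two comparable
  members into \<open>S/N\<close>, then \<open>g h\<^sup>-\<^sup>1\<close> conjugates an element of \<open>S - N\<close> into \<open>S\<close>.
\<close>

lemma poset_connected_generates:
  assumes p: "Factorial_Ring.prime p" and compact: "compact_space \<tau>"
    and N: "N \<lhd> G" and S: "subgroup S G" "closedin \<tau> S" and NS: "N \<subset> S"
    and pe: "\<And>x. x \<in> S \<Longrightarrow> p_elt p x"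
    and index: "\<And>i. i \<in> I \<Longrightarrow> \<not> p dvd card (rcosets (S <#> K i))"
    and conn: "poset_connected (pro_p_poset p (G Mod N) (quotient_top G \<tau> N))"
    and good: "\<And>g b. g \<in> carrier G \<Longrightarrow> b \<in> S - N \<Longrightarrow> g \<otimes> b \<otimes> inv g \<in> S \<Longrightarrow> g \<in> Y"
    and mult: "\<And>x y. x \<in> Y \<Longrightarrow> y \<in> Y \<Longrightarrow> x \<otimes> y \<in> Y"
    and a: "a \<in> carrier G"
  shows "a \<in> Y"
proof -
  interpret N: normal N G by (rule N)
  let ?A = "pro_p_poset p (G Mod N) (quotient_top G \<tau> N)"
  let ?q = "\<lambda>h. N #> h"
  have Ssub: "S \<subseteq> carrier G" using S subgroup.subset by blast
  obtain b0 where b0: "b0 \<in> S" "b0 \<notin> N" using NS by blast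
  \<comment> \<open>\<open>S'\<close> is the conjugate a^-1 S a, so that a itself conjugates the
    preimage of the end of the path into \<open>S\<close>.\<close>
  define S' where "S' = {x \<in> carrier G. a \<otimes> x \<otimes> inv a \<in> S}"
  note S' = conj_closed_subgroup[OF S a, folded S'_def]
  have NS': "N \<subseteq> S'"
    using N.inv_op_closed2[OF a] NS N.subset by (auto simp: S'_def)
  have peS': "p_elt p x" if "x \<in> S'" for x
  proof -
    have x: "x \<in> carrier G" "p_elt p (a \<otimes> x \<otimes> inv a)" using that pe by (auto simp: S'_def)
    have "p_elt p (inv a \<otimes> (a \<otimes> x \<otimes> inv a) \<otimes> inv (inv a))"
      by (rule p_elt_conj[OF x(2)]) (use x(1) a in auto)
    moreover have "inv a \<otimes> (a \<otimes> x \<otimes> inv a) \<otimes> inv (inv a) = x"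
      unfolding inv_inv[OF a] by (rule conj_cancel(1)[OF a x(1)])
    ultimately show ?thesis by metis
  qed
  have peN: "p_elt p n" if "n \<in> N" for n using pe NS that by blast
  have U0: "?q ` S \<in> ?A"
  proof -
    have "?q b0 \<noteq> N" using coset_join1[OF _ _ N.subgroup_axioms] b0 Ssub by blast
    then show ?thesis using quotient_image_pro_p[OF p N S _ pe] NS b0 by (auto simp: pro_p_poset_def)
  qed
  have U1: "?q ` S' \<in> ?A"
  proof -
    let ?b = "inv a \<otimes> b0 \<otimes> a"
    have bc: "b0 \<in> carrier G" using b0 Ssub by blast
    have "a \<otimes> ?b \<otimes> inv a = b0" using conj_cancel(2)[OF a bc] .
    then have b: "?b \<in> S'" "?b \<notin> N" using a bc b0 N.inv_op_closed2[OF a, of ?b] by (auto simp: S'_def)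
    have "?q ?b \<noteq> N" using coset_join1[OF _ _ N.subgroup_axioms, of ?b] b a bc by blast
    then show ?thesis using quotient_image_pro_p[OF p N S' NS' peS'] b by (auto simp: pro_p_poset_def)
  qed
  \<comment> \<open>The invariant must hold for every g that conjugates the preimage of V into
    \<open>S\<close>: the step compares such a g for the new member with the conjugator that Sylow
    gives for the old one, and at the end g is a.\<close>
  have "\<forall>g\<in>carrier G. (\<forall>b\<in>carrier G. ?q b \<in> V \<longrightarrow> g \<otimes> b \<otimes> inv g \<in> S) \<longrightarrow> g \<in> Y"
    if "(\<lambda>U V. U \<in> ?A \<and> V \<in> ?A \<and> (U \<subseteq> V \<or> V \<subseteq> U))\<^sup>*\<^sup>* (?q ` S) V" for V
    using that
  proof (induction rule: rtranclp_induct)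
    case base
    show ?case using good b0 Ssub by blast
  next
    case (step V W)
    show ?case
    proof (intro ballI impI)
      fix g assume g: "g \<in> carrier G" and gW: "\<forall>b\<in>carrier G. ?q b \<in> W \<longrightarrow> g \<otimes> b \<otimes> inv g \<in> S"
      have VW: "V \<in> ?A" "W \<in> ?A" "V \<subseteq> W \<or> W \<subseteq> V" using step.hyps(2) by auto
      have ppV: "pro_p_subgroup p (G Mod N) (quotient_top G \<tau> N) V"
        using VW(1) by (simp add: pro_p_poset_def)
      obtain h where h: "h \<in> carrier G"
        "\<forall>b\<in>{b \<in> carrier G. ?q b \<in> V}. h \<otimes> b \<otimes> inv h \<in> S"
        using sylow_conjugation[OF p compact S index pro_p_preimage[OF N peN ppV]] by blast
      have hY: "h \<in> Y" using step.IH h by blast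
      \<comment> \<open>\<open>Z\<close> is the smaller of the two members. A nontrivial coset in it
        has a representative b, and g h^-1 carries the conjugate of b by h, which lies in S - N, to
        the conjugate of b by g, which lies in \<open>S\<close>.\<close>
      obtain Z where Z: "Z \<in> ?A" "Z \<subseteq> V" "Z \<subseteq> W" using VW by blast
      have "subgroup Z (G Mod N)" "Z \<noteq> {N}" using Z(1) by (auto simp: pro_p_poset_def pro_p_subgroup_def)
      then obtain c where c: "c \<in> Z" "c \<noteq> N" "c \<in> carrier (G Mod N)"
        using subgroup.one_closed[of Z "G Mod N"] subgroup.subset[of Z "G Mod N"] by auto
      then obtain b where b: "b \<in> carrier G" "c = ?q b" by (auto simp: carrier_FactGroup)
      have bN: "b \<notin> N" using c(2) b coset_join2[OF b(1) N.subgroup_axioms] by blast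
      let ?b = "h \<otimes> b \<otimes> inv h"
      have hb: "?b \<in> S" using h b c Z by blast
      have hbN: "?b \<notin> N"
      proof
        assume "?b \<in> N"
        then have "inv h \<otimes> ?b \<otimes> h \<in> N" using N.inv_op_closed1[OF h(1)] by blast
        then show False using conj_cancel(1)[OF h(1) b(1)] bN by simp
      qed
      have "(g \<otimes> inv h) \<otimes> ?b \<otimes> inv (g \<otimes> inv h) = g \<otimes> b \<otimes> inv g"
        using conj_conj[OF g, of "inv h" ?b] conj_cancel(1)[OF h(1) b(1)] h(1) b(1) by simp
      then have "g \<otimes> inv h \<in> Y" using good[of "g \<otimes> inv h" ?b] hb hbN gW b c Z g h(1) by auto
      then have "(g \<otimes> inv h) \<otimes> h \<in> Y" using mult hY by blast
      then show "g \<in> Y" using g h(1) by (simp add: m_assoc)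
    qed
  qed
  moreover have "(\<lambda>U V. U \<in> ?A \<and> V \<in> ?A \<and> (U \<subseteq> V \<or> V \<subseteq> U))\<^sup>*\<^sup>* (?q ` S) (?q ` S')"
    using conn U0 U1 unfolding poset_connected_def by blast
  moreover have "a \<otimes> b \<otimes> inv a \<in> S" if "b \<in> carrier G" "?q b \<in> ?q ` S'" for b
    using rcos_mem_image_iff[OF N.subgroup_axioms S'(1) NS' that(1)] that(2) by (simp add: S'_def)
  ultimately show "a \<in> Y" using a by blast
qed

end

section \<open>Topologies on inverse limits of finite sets\<close>

text \<open>A basic open set of the product restricts finitely many coordinates. By directedness a
  single coordinate determines all of them on \<open>L\<close>, so the sets of points sharing one
  coordinate form a base.\<close>

lemma openin_directed_product:
  assumes LA: "L \<subseteq> (\<Pi>\<^sub>E i\<in>I. A i)" and "I \<noteq> {}"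
    and dir: "\<And>i j. i \<in> I \<Longrightarrow> j \<in> I \<Longrightarrow>
      \<exists>k\<in>I. \<forall>x\<in>L. \<forall>y\<in>L. x k = y k \<longrightarrow> x i = y i \<and> x j = y j"
  shows "openin (subtopology (product_topology (\<lambda>i. discrete_topology (A i)) I) L) U \<longleftrightarrow>
    U \<subseteq> L \<and> (\<forall>x\<in>U. \<exists>i\<in>I. {y\<in>L. y i = x i} \<subseteq> U)" (is "openin (subtopology ?T L) U \<longleftrightarrow> ?rhs")
proof
  assume "openin (subtopology ?T L) U"
  then obtain V where V: "openin ?T V" "U = V \<inter> L" by (auto simp: openin_subtopology)
  have "\<exists>i\<in>I. {y\<in>L. y i = x i} \<subseteq> U" if x: "x \<in> U" for x
  proof -
    have xV: "x \<in> V" "x \<in> L" using x V by auto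
    obtain W where W: "finite {i \<in> I. W i \<noteq> A i}" "x \<in> Pi\<^sub>E I W" "Pi\<^sub>E I W \<subseteq> V"
      using V(1) xV(1) unfolding openin_product_topology_alt by auto
    have "\<exists>k\<in>I. \<forall>y\<in>L. y k = x k \<longrightarrow> (\<forall>j\<in>J. y j = x j)" if "finite J" "J \<subseteq> I" for J
      using that
    proof (induction J)
      case empty
      then show ?case using \<open>I \<noteq> {}\<close> by auto
    next
      case (insert j J)
      then obtain k where k: "k \<in> I" "\<forall>y\<in>L. y k = x k \<longrightarrow> (\<forall>j\<in>J. y j = x j)" by auto
      obtain l where l: "l \<in> I" "\<forall>x\<in>L. \<forall>y\<in>L. x l = y l \<longrightarrow> x k = y k \<and> x j = y j"
        using dir[of k j] k(1) insert.prems by auto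
      have "\<forall>i\<in>insert j J. y i = x i" if "y \<in> L" "y l = x l" for y
        using l(2)[rule_format, OF that(1) xV(2) that(2)] k(2) that(1) by blast
      then show ?case using l(1) by blast
    qed
    from this[OF W(1)] obtain k where
      k: "k \<in> I" "\<forall>y\<in>L. y k = x k \<longrightarrow> (\<forall>j\<in>{i \<in> I. W i \<noteq> A i}. y j = x j)" by auto
    have "y \<in> U" if y: "y \<in> L" "y k = x k" for y
    proof -
      have "y \<in> Pi\<^sub>E I W"
      proof (rule PiE_I)
        fix i assume i: "i \<in> I"
        show "y i \<in> W i"
        proof (cases "W i = A i")
          case True
          then show ?thesis using y(1) LA i by auto
        next
          case False
          then have "y i = x i" using k(2) y i by blast
          then show ?thesis using W(2) i by auto
        qed
      qed (use y(1) LA in auto)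
      then show ?thesis using W(3) V(2) y(1) by blast
    qed
    then show ?thesis using k(1) by blast
  qed
  then show ?rhs using V(2) by blast
next
  assume rhs: ?rhs
  define B where "B = {(x, i). x \<in> U \<and> i \<in> I \<and> {y\<in>L. y i = x i} \<subseteq> U}"
  define V where "V = (\<Union>(x, i)\<in>B. {y \<in> topspace ?T. y i \<in> {x i}})"
  have "openin ?T V"
    unfolding V_def
  proof (rule openin_Union)
    fix W assume "W \<in> (\<lambda>(x, i). {y \<in> topspace ?T. y i \<in> {x i}}) ` B"
    then obtain x i where xi: "x \<in> U" "i \<in> I" "W = {y \<in> topspace ?T. y i \<in> {x i}}"
      by (auto simp: B_def)
    have "x i \<in> A i" using xi rhs LA by auto
    then show "openin ?T W" unfolding xi(3)
      by (intro openin_continuous_map_preimage[OF continuous_map_product_projection[OF xi(2)]]) auto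
  qed
  moreover have "U = V \<inter> L"
  proof
    show "U \<subseteq> V \<inter> L"
    proof
      fix x assume x: "x \<in> U"
      then obtain i where "i \<in> I" "{y\<in>L. y i = x i} \<subseteq> U" using rhs by blast
      then have "(x, i) \<in> B" using x by (simp add: B_def)
      moreover have "x \<in> topspace ?T" "x \<in> L" using x rhs LA by auto
      ultimately show "x \<in> V \<inter> L" unfolding V_def by blast
    qed
    show "V \<inter> L \<subseteq> U" unfolding V_def B_def by auto
  qed
  ultimately show "openin (subtopology ?T L) U" by (auto simp: openin_subtopology)
qed

text \<open>By Tychonoff the product is compact. A violated relation between coordinates i and j
  depends on these two only, so the violations form an open set.\<close>

lemma compactin_relational_product:
  assumes fin: "\<And>i. i \<in> I \<Longrightarrow> finite (A i)"
  shows "compactin (product_topology (\<lambda>i. discrete_topology (A i)) I)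
    {x \<in> (\<Pi>\<^sub>E i\<in>I. A i). \<forall>i\<in>I. \<forall>j\<in>I. R i j (x i) (x j)}" (is "compactin ?T ?L")
proof (rule closedin_compact_space)
  show "compact_space ?T"
    using fin by (auto simp: compact_space_product_topology compact_space_discrete_topology)
  have op: "openin ?T {x \<in> topspace ?T. x i = a}" if "i \<in> I" "a \<in> A i" for i a
    using that openin_continuous_map_preimage[OF continuous_map_product_projection[OF that(1)],
        of "\<lambda>i. discrete_topology (A i)" "{a}"] by simp
  have "topspace ?T - ?L = \<Union>{{x \<in> topspace ?T. x i = a} \<inter> {x \<in> topspace ?T. x j = b} |i j a b.
      i \<in> I \<and> j \<in> I \<and> a \<in> A i \<and> b \<in> A j \<and> \<not> R i j a b}" (is "_ = \<Union>?F")
  proof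
    show "topspace ?T - ?L \<subseteq> \<Union>?F"
    proof
      fix x assume x: "x \<in> topspace ?T - ?L"
      then obtain i j where ij: "i \<in> I" "j \<in> I" "\<not> R i j (x i) (x j)" by auto
      then have "x i \<in> A i" "x j \<in> A j" using x by auto
      then show "x \<in> \<Union>?F" using ij x by blast
    qed
  qed auto
  moreover have "openin ?T (\<Union>?F)"
    by (rule openin_Union) (use openin_Int op in blast)
  ultimately show "closedin ?T ?L" by (auto simp: closedin_def)
qed

text \<open>\<open>r i x y\<close> stands for agreement of x and y at level i. An open set of the
  subspace is thickened to the points of the large space that agree with one of its points at a
  suitable level; transitivity makes this thickening open.\<close>

lemma openin_subtopology_levels:
  assumes op: "\<And>U. openin \<tau> U \<longleftrightarrow> U \<subseteq> X' \<and> (\<forall>x\<in>U. \<exists>i\<in>I. {y\<in>X'. r i x y} \<subseteq> U)"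
    and "Y \<subseteq> X'" and refl: "\<And>i x. r i x x"
    and trans: "\<And>i x y z. r i x y \<Longrightarrow> r i y z \<Longrightarrow> r i x z"
  shows "openin (subtopology \<tau> Y) U \<longleftrightarrow> U \<subseteq> Y \<and> (\<forall>x\<in>U. \<exists>i\<in>I. {y\<in>Y. r i x y} \<subseteq> U)"
proof
  assume "openin (subtopology \<tau> Y) U"
  then obtain V where V: "openin \<tau> V" "U = V \<inter> Y" by (auto simp: openin_subtopology)
  have "\<exists>i\<in>I. {y\<in>Y. r i x y} \<subseteq> U" if x: "x \<in> U" for x
  proof -
    have "x \<in> V" using x V(2) by blast
    then obtain i where "i \<in> I" "{y\<in>X'. r i x y} \<subseteq> V" using V(1) op by blast
    then show ?thesis using V(2) assms(2) by blast
  qed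
  then show "U \<subseteq> Y \<and> (\<forall>x\<in>U. \<exists>i\<in>I. {y\<in>Y. r i x y} \<subseteq> U)" using V(2) by blast
next
  assume U: "U \<subseteq> Y \<and> (\<forall>x\<in>U. \<exists>i\<in>I. {y\<in>Y. r i x y} \<subseteq> U)"
  define V where "V = {z\<in>X'. \<exists>x\<in>U. \<exists>i\<in>I. {y\<in>Y. r i x y} \<subseteq> U \<and> r i x z}"
  have "\<exists>i\<in>I. {y\<in>X'. r i z y} \<subseteq> V" if z: "z \<in> V" for z
  proof -
    obtain x i where xi: "x \<in> U" "i \<in> I" "{y\<in>Y. r i x y} \<subseteq> U" "r i x z" using z by (auto simp: V_def)
    have "{y\<in>X'. r i z y} \<subseteq> V" unfolding V_def using xi trans by blast
    then show ?thesis using xi(2) by blast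
  qed
  then have "openin \<tau> V" unfolding op by (auto simp: V_def)
  moreover have "U = V \<inter> Y"
  proof
    show "U \<subseteq> V \<inter> Y"
    proof
      fix x assume x: "x \<in> U"
      then obtain i where "i \<in> I" "{y\<in>Y. r i x y} \<subseteq> U" using U by blast
      then show "x \<in> V \<inter> Y" using x U assms(2) refl unfolding V_def by blast
    qed
    show "V \<inter> Y \<subseteq> U" unfolding V_def by blast
  qed
  ultimately show "openin (subtopology \<tau> Y) U" by (auto simp: openin_subtopology)
qed

section \<open>Pro-fusion systems\<close>

locale inverse_limit =
  fixes p :: nat and D :: "('i, 'a) fusion_diagram"
  assumes prime: "Factorial_Ring.prime p" and system: "inverse_system p D"
begin

abbreviation "S \<equiv> lim_grp D"
abbreviation "cs \<equiv> closed_subgroup D"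

lemma fus: "i \<in> idx D \<Longrightarrow> fusion_system p (grp D i) (fus D i)"
  using system unfolding inverse_system_def by blast

lemma grp: "i \<in> idx D \<Longrightarrow> Group.group (grp D i)"
  and grp_finite: "i \<in> idx D \<Longrightarrow> finite (carrier (grp D i))"
  and grp_order: "i \<in> idx D \<Longrightarrow> \<exists>n. order (grp D i) = p ^ n"
  using fus[of i] unfolding fusion_system_def finite_p_group_def by blast+

sublocale group S by (rule group_lim_grp[OF system])

lemma carrier_ext: "carrier S \<subseteq> (\<Pi>\<^sub>E i\<in>idx D. carrier (grp D i))"
  by (auto simp: lim_grp_def)

lemma carrier_nth: "x \<in> carrier S \<Longrightarrow> i \<in> idx D \<Longrightarrow> x i \<in> carrier (grp D i)"
  by (auto simp: lim_grp_def PiE_iff)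

lemma lim_eqI: "x \<in> carrier S \<Longrightarrow> y \<in> carrier S \<Longrightarrow> (\<And>i. i \<in> idx D \<Longrightarrow> x i = y i) \<Longrightarrow> x = y"
  by (rule PiE_ext[OF subsetD[OF carrier_ext] subsetD[OF carrier_ext]])

lemma tr_nth: "x \<in> carrier S \<Longrightarrow> i \<in> idx D \<Longrightarrow> j \<in> idx D \<Longrightarrow> le D i j \<Longrightarrow> tr D i j (x j) = x i"
  by (auto simp: lim_grp_def)

lemma directed_idx: "directed_set (idx D) (le D)"
  using system unfolding inverse_system_def by blast

lemma idx_nonempty: "idx D \<noteq> {}"
  and idx_directed: "i \<in> idx D \<Longrightarrow> j \<in> idx D \<Longrightarrow> \<exists>k\<in>idx D. le D i k \<and> le D j k"
  using directed_idx unfolding directed_set_def by blast+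

lemma nth_mono:
  "x \<in> carrier S \<Longrightarrow> y \<in> carrier S \<Longrightarrow> i \<in> idx D \<Longrightarrow> j \<in> idx D \<Longrightarrow> le D i j \<Longrightarrow> x j = y j \<Longrightarrow> x i = y i"
  using tr_nth[of x i j] tr_nth[of y i j] by simp

lemma nth_hom: assumes i: "i \<in> idx D" shows "group_hom S (grp D i) (\<lambda>x. x i)"
proof -
  have "(\<lambda>x. x i) \<in> hom S (grp D i)" using i by (auto simp: hom_def lim_grp_def)
  then show ?thesis by (simp add: group_hom_def group_hom_axioms_def grp i is_group)
qed

lemma nth_mult: "i \<in> idx D \<Longrightarrow> x \<in> carrier S \<Longrightarrow> y \<in> carrier S \<Longrightarrow> (x \<otimes>\<^bsub>S\<^esub> y) i = x i \<otimes>\<^bsub>grp D i\<^esub> y i"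
  by (rule group_hom.hom_mult[OF nth_hom])

lemma nth_inv: "i \<in> idx D \<Longrightarrow> x \<in> carrier S \<Longrightarrow> (inv\<^bsub>S\<^esub> x) i = inv\<^bsub>grp D i\<^esub> (x i)"
  by (rule group_hom.hom_inv[OF nth_hom])

lemma nth_one: "i \<in> idx D \<Longrightarrow> \<one>\<^bsub>S\<^esub> i = \<one>\<^bsub>grp D i\<^esub>"
  by (rule group_hom.hom_one[OF nth_hom])

definition level_kernel :: "'i \<Rightarrow> ('i \<Rightarrow> 'a) set" where
  "level_kernel i = kernel S (grp D i) (\<lambda>x. x i)"

lemma mult_inv_in_level_kernel:
  assumes i: "i \<in> idx D" and x: "x \<in> carrier S" and y: "y \<in> carrier S"
  shows "x \<otimes>\<^bsub>S\<^esub> inv\<^bsub>S\<^esub> y \<in> level_kernel i \<longleftrightarrow> x i = y i"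
proof -
  interpret Gi: group "grp D i" by (rule grp[OF i])
  have c: "x i \<in> carrier (grp D i)" "y i \<in> carrier (grp D i)" using carrier_nth assms by auto
  have "x i \<otimes>\<^bsub>grp D i\<^esub> inv\<^bsub>grp D i\<^esub> y i = \<one>\<^bsub>grp D i\<^esub> \<longleftrightarrow> x i = y i"
    using c by (metis Gi.inv_closed Gi.inv_equality Gi.inv_inv Gi.r_inv)
  then show ?thesis using assms by (simp add: level_kernel_def kernel_def nth_mult nth_inv)
qed

lemma level_kernel_coset:
  assumes i: "i \<in> idx D" and x: "x \<in> carrier S"
  shows "level_kernel i #>\<^bsub>S\<^esub> x = {y \<in> carrier S. y i = x i}"
proof -
  have sub: "subgroup (level_kernel i) S"
    unfolding level_kernel_def by (rule group_hom.subgroup_kernel[OF nth_hom[OF i]])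
  have "y \<in> level_kernel i #>\<^bsub>S\<^esub> x \<longleftrightarrow> y i = x i" if "y \<in> carrier S" for y
    using subgroup.rcos_module[OF sub is_group x that] mult_inv_in_level_kernel[OF i that x] by simp
  then show ?thesis using subgroup.elemrcos_carrier[OF sub is_group x] by blast
qed

sublocale profinite_base S "lim_top D" "idx D" level_kernel
proof (intro profinite_base.intro profinite_base_axioms.intro)
  show "Group.group S" by (rule is_group)
  show "idx D \<noteq> {}" by (rule idx_nonempty)
next
  fix i j assume ij: "i \<in> idx D" "j \<in> idx D"
  then obtain k where k: "k \<in> idx D" "le D i k" "le D j k" using idx_directed by blast
  have "x i = \<one>\<^bsub>grp D i\<^esub>" if "x \<in> carrier S" "x k = \<one>\<^bsub>grp D k\<^esub>" "le D i k" "i \<in> idx D" for x i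
    using nth_mono[OF that(1) one_closed that(4) k(1) that(3)] that nth_one k(1) by simp
  then show "\<exists>k\<in>idx D. level_kernel k \<subseteq> level_kernel i \<and> level_kernel k \<subseteq> level_kernel j"
    using k ij by (intro bexI[of _ k]) (auto simp: level_kernel_def kernel_def)
next
  fix i assume i: "i \<in> idx D"
  show "level_kernel i \<lhd> S"
    unfolding level_kernel_def by (rule group_hom.normal_kernel[OF nth_hom[OF i]])
  have "finite ((\<lambda>x. level_kernel i #>\<^bsub>S\<^esub> x) ` carrier S)"
  proof (rule finite_image_factor)
    show "finite ((\<lambda>x. x i) ` carrier S)"
      by (rule finite_subset[OF _ grp_finite[OF i]]) (use carrier_nth i in auto)
  qed (simp add: level_kernel_coset[OF i])
  then show "finite (rcosets\<^bsub>S\<^esub> level_kernel i)" by (simp add: rcosets_image)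
next
  fix U
  have dir: "\<exists>k\<in>idx D. \<forall>x\<in>carrier S. \<forall>y\<in>carrier S. x k = y k \<longrightarrow> x i = y i \<and> x j = y j"
    if ij: "i \<in> idx D" "j \<in> idx D" for i j
  proof -
    obtain k where k: "k \<in> idx D" "le D i k" "le D j k" using idx_directed ij by blast
    then show ?thesis using nth_mono ij by (intro bexI[of _ k]) blast+
  qed
  show "openin (lim_top D) U \<longleftrightarrow> U \<subseteq> carrier S \<and> (\<forall>x\<in>U. \<exists>i\<in>idx D. level_kernel i #>\<^bsub>S\<^esub> x \<subseteq> U)"
  proof -
    have "openin (lim_top D) U \<longleftrightarrow> U \<subseteq> carrier S \<and> (\<forall>x\<in>U. \<exists>i\<in>idx D. {y \<in> carrier S. y i = x i} \<subseteq> U)"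
      unfolding lim_top_def by (rule openin_directed_product[OF carrier_ext idx_nonempty dir])
    also have "\<dots> \<longleftrightarrow> U \<subseteq> carrier S \<and> (\<forall>x\<in>U. \<exists>i\<in>idx D. level_kernel i #>\<^bsub>S\<^esub> x \<subseteq> U)"
    proof (rule conj_cong[OF refl], rule ball_cong[OF refl], rule bex_cong[OF refl])
      fix x i assume "U \<subseteq> carrier S" "x \<in> U" "i \<in> idx D"
      then have "level_kernel i #>\<^bsub>S\<^esub> x = {y \<in> carrier S. y i = x i}"
        using level_kernel_coset by blast
      then show "{y \<in> carrier S. y i = x i} \<subseteq> U \<longleftrightarrow> level_kernel i #>\<^bsub>S\<^esub> x \<subseteq> U" by simp
    qed
    finally show ?thesis .
  qed
qed

lemma p_elt_lim: assumes "x \<in> carrier S" shows "p_elt p x"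
  unfolding p_elt_def
proof
  fix i assume i: "i \<in> idx D"
  interpret Gi: group "grp D i" by (rule grp[OF i])
  interpret h: group_hom S "grp D i" "\<lambda>x. x i" by (rule nth_hom[OF i])
  obtain n where "order (grp D i) = p ^ n" using grp_order i by blast
  then have "(x [^]\<^bsub>S\<^esub> (p ^ n)) i = \<one>\<^bsub>grp D i\<^esub>"
    using h.hom_nat_pow[OF assms, of "p ^ n"] Gi.pow_order_eq_1[OF carrier_nth[OF assms i]] by simp
  then show "\<exists>n. x [^]\<^bsub>S\<^esub> (p ^ n) \<in> level_kernel i"
    using assms by (auto simp: level_kernel_def kernel_def)
qed

section \<open>Closed subgroups of the limit and their index\<close>

lemma closed_subgroupD: "cs P \<Longrightarrow> subgroup P S" "cs P \<Longrightarrow> closedin (lim_top D) P"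
  "cs P \<Longrightarrow> P \<subseteq> carrier S"
  by (auto simp: closed_subgroup_def subgroup.subset)

lemma open_subgroupD: "open_subgroup D P \<Longrightarrow> subgroup P S" "open_subgroup D P \<Longrightarrow> openin (lim_top D) P"
  by (auto simp: open_subgroup_def)

lemma open_closed_subgroup: "open_subgroup D P \<Longrightarrow> cs P"
  using open_subgroup_closed by (auto simp: closed_subgroup_def open_subgroup_def)

lemma closed_subgroup_carrier: "cs (carrier S)"
  using topspace_base closedin_topspace[of "lim_top D"] subgroup_self by (simp add: closed_subgroup_def)

text \<open>Agreement with some element of \<open>P\<close> at every level puts x into the closure
  of \<open>P\<close>.\<close>

lemma closed_subgroup_memI:
  assumes P: "cs P" and x: "x \<in> carrier S" and "\<And>i. i \<in> idx D \<Longrightarrow> x i \<in> proj i P"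
  shows "x \<in> P"
proof -
  have "(level_kernel i #>\<^bsub>S\<^esub> x) \<inter> P \<noteq> {}" if i: "i \<in> idx D" for i
    using assms(3)[OF i] closed_subgroupD(3)[OF P] by (auto simp: level_kernel_coset[OF i x])
  then show ?thesis using closedin_base closed_subgroupD(2)[OF P] x by blast
qed

lemma finite_proj: "P \<subseteq> carrier S \<Longrightarrow> i \<in> idx D \<Longrightarrow> finite (proj i P)"
  by (rule finite_subset[OF _ grp_finite]) (use carrier_nth in auto)

text \<open>The projection of the whole group is covered by the projections of the cosets of
  \<open>P\<close>, and each of these is a translate of the projection of \<open>P\<close>.\<close>

lemma card_proj_le:
  assumes P: "subgroup P S" and fin: "finite (rcosets\<^bsub>S\<^esub> P)" and i: "i \<in> idx D"
  shows "card (proj i (carrier S)) \<le> card (rcosets\<^bsub>S\<^esub> P) * card (proj i P)"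
proof -
  have sub: "P \<subseteq> carrier S" using P subgroup.subset by blast
  have "proj i (carrier S) = (\<Union>c\<in>rcosets\<^bsub>S\<^esub> P. proj i c)"
    using rcosets_part_G[OF P] by blast
  then have "card (proj i (carrier S)) \<le> (\<Sum>c\<in>rcosets\<^bsub>S\<^esub> P. card (proj i c))"
    using card_UN_le[OF fin] by simp
  also have "\<dots> \<le> (\<Sum>c\<in>rcosets\<^bsub>S\<^esub> P. card (proj i P))"
  proof (rule sum_mono)
    fix c assume "c \<in> rcosets\<^bsub>S\<^esub> P"
    then obtain x where x: "x \<in> carrier S" "c = P #>\<^bsub>S\<^esub> x" by (auto simp: rcosets_image)
    have "proj i c = (\<lambda>y. y \<otimes>\<^bsub>grp D i\<^esub> x i) ` proj i P"
      using x sub i by (auto simp: r_coset_def nth_mult image_iff subset_iff)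
    then show "card (proj i c) \<le> card (proj i P)" using card_image_le[OF finite_proj[OF sub i]] by simp
  qed
  finally show ?thesis by simp
qed

text \<open>
  The index of a closed subgroup is determined by the cardinalities of its projections, which are
  preserved by isomorphisms in a pro-fusion system.
\<close>

lemma card_rcosets_le:
  assumes P: "cs P"
    and le: "\<And>i. i \<in> idx D \<Longrightarrow> card (proj i (carrier S)) \<le> n * card (proj i P)"
  shows "finite (rcosets\<^bsub>S\<^esub> P) \<and> card (rcosets\<^bsub>S\<^esub> P) \<le> n"
proof (rule ccontr)
  assume neg: "\<not> ?thesis"
  have sub: "subgroup P S" "P \<subseteq> carrier S" using closed_subgroupD[OF P] by auto
  obtain C where C: "C \<subseteq> rcosets\<^bsub>S\<^esub> P" "card C = Suc n" "finite C"
  proof (cases "finite (rcosets\<^bsub>S\<^esub> P)")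
    case True
    then show ?thesis using neg obtain_subset_with_card_n[of "Suc n" "rcosets\<^bsub>S\<^esub> P"] that
      by (metis not_less_eq_eq)
  next
    case False
    then show ?thesis using infinite_arbitrarily_large that by metis
  qed
  then have "C \<subseteq> (\<lambda>x. P #>\<^bsub>S\<^esub> x) ` carrier S" by (simp add: rcosets_image)
  then obtain R where R: "R \<subseteq> carrier S" "inj_on (\<lambda>x. P #>\<^bsub>S\<^esub> x) R" "C = (\<lambda>x. P #>\<^bsub>S\<^esub> x) ` R"
    by (meson subset_image_inj)
  have cR: "card R = Suc n" using C(2) R by (simp add: card_image)
  then have finR: "finite R" by (metis card.infinite nat.distinct(1))
  have "\<exists>i\<in>idx D. \<forall>c\<in>P. (x \<otimes>\<^bsub>S\<^esub> inv\<^bsub>S\<^esub> y) \<otimes>\<^bsub>S\<^esub> inv\<^bsub>S\<^esub> c \<notin> level_kernel i"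
    if xy: "x \<in> R" "y \<in> R" "x \<noteq> y" for x y
  proof (rule closed_subgroup_separate[OF closed_subgroupD(2)[OF P] sub(1)])
    have c: "x \<in> carrier S" "y \<in> carrier S" using xy R(1) by auto
    then show "x \<otimes>\<^bsub>S\<^esub> inv\<^bsub>S\<^esub> y \<in> carrier S" by simp
    have "P #>\<^bsub>S\<^esub> x \<noteq> P #>\<^bsub>S\<^esub> y" using xy R(2) by (auto simp: inj_on_def)
    then show "x \<otimes>\<^bsub>S\<^esub> inv\<^bsub>S\<^esub> y \<notin> P" using rcos_eq_iff[OF sub(1) c] by blast
  qed
  then obtain f where f: "\<And>x y. x \<in> R \<Longrightarrow> y \<in> R \<Longrightarrow> x \<noteq> y \<Longrightarrow> f x y \<in> idx D \<and>
      (\<forall>c\<in>P. (x \<otimes>\<^bsub>S\<^esub> inv\<^bsub>S\<^esub> y) \<otimes>\<^bsub>S\<^esub> inv\<^bsub>S\<^esub> c \<notin> level_kernel (f x y))" by metis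
  define J where "J = (\<lambda>(x, y). f x y) ` {(x, y). (x, y) \<in> R \<times> R \<and> x \<noteq> y}"
  have "finite J" unfolding J_def
    by (rule finite_imageI, rule finite_subset[of _ "R \<times> R"]) (use finR in auto)
  moreover have "J \<subseteq> idx D" using f by (auto simp: J_def)
  ultimately obtain k where k: "k \<in> idx D" "\<forall>j\<in>J. level_kernel k \<subseteq> level_kernel j"
    using finite_common_K by blast
  interpret Gk: group "grp D k" by (rule grp[OF k(1)])
  \<comment> \<open>At level k the n + 1 chosen cosets have disjoint projections, each as large as
    that of \<open>P\<close>; the injectivity of \<open>?m\<close> expresses this and contradicts
    \<open>le\<close>.\<close>
  let ?m = "\<lambda>(x, c). c \<otimes>\<^bsub>grp D k\<^esub> x k"
  have "inj_on ?m (R \<times> proj k P)"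
  proof (rule inj_onI, clarsimp)
    fix x y a b assume xy: "x \<in> R" "y \<in> R" and ab: "a \<in> P" "b \<in> P"
      and eq: "a k \<otimes>\<^bsub>grp D k\<^esub> x k = b k \<otimes>\<^bsub>grp D k\<^esub> y k"
    have c: "x \<in> carrier S" "y \<in> carrier S" "a \<in> carrier S" "b \<in> carrier S"
      using xy ab R(1) sub by auto
    note ck = carrier_nth[OF c(1) k(1)] carrier_nth[OF c(2) k(1)]
      carrier_nth[OF c(3) k(1)] carrier_nth[OF c(4) k(1)]
    have "x = y"
    proof (rule ccontr)
      assume ne: "x \<noteq> y"
      have kJ: "level_kernel k \<subseteq> level_kernel (f x y)" using k(2) xy ne by (force simp: J_def)
      let ?c = "inv\<^bsub>S\<^esub> a \<otimes>\<^bsub>S\<^esub> b"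
      have cP: "?c \<in> P" using ab sub(1) by (simp add: subgroup.m_closed subgroup.m_inv_closed)
      have "x k \<otimes>\<^bsub>grp D k\<^esub> inv\<^bsub>grp D k\<^esub> y k = inv\<^bsub>grp D k\<^esub> a k \<otimes>\<^bsub>grp D k\<^esub> b k"
        using eq ck by (metis Gk.inv_closed Gk.inv_solve_left Gk.inv_solve_right Gk.m_assoc Gk.m_closed)
      then have "(x \<otimes>\<^bsub>S\<^esub> inv\<^bsub>S\<^esub> y) k = ?c k" using c k(1) by (simp add: nth_mult nth_inv)
      then have "(x \<otimes>\<^bsub>S\<^esub> inv\<^bsub>S\<^esub> y) \<otimes>\<^bsub>S\<^esub> inv\<^bsub>S\<^esub> ?c \<in> level_kernel k"
        using mult_inv_in_level_kernel[OF k(1)] c by simp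
      then show False using f[OF xy ne] cP kJ by blast
    qed
    then show "x = y \<and> a k = b k" using eq ck by simp
  qed
  moreover have "?m ` (R \<times> proj k P) \<subseteq> proj k (carrier S)"
  proof clarsimp
    fix x c assume "x \<in> R" "c \<in> P"
    then have "x \<in> carrier S" "c \<in> carrier S" using R(1) sub by auto
    then show "c k \<otimes>\<^bsub>grp D k\<^esub> x k \<in> proj k (carrier S)"
      using k(1) by (metis image_eqI m_closed nth_mult)
  qed
  ultimately have "card (R \<times> proj k P) \<le> card (proj k (carrier S))"
    using finite_proj[OF _ k(1)] card_inj_on_le by blast
  then have "Suc n * card (proj k P) \<le> n * card (proj k P)"
    using le[OF k(1)] by (simp add: cR card_cartesian_product)
  moreover have "card (proj k P) > 0"
    using finite_proj[OF sub(2) k(1)] subgroup.one_closed[OF sub(1)] by (auto simp: card_gt_0_iff)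
  ultimately show False by simp
qed

lemma index_le_of_card_proj:
  assumes P: "cs P" and Q: "cs Q" and fin: "finite (rcosets\<^bsub>S\<^esub> P)"
    and eq: "\<And>i. i \<in> idx D \<Longrightarrow> card (proj i P) = card (proj i Q)"
  shows "finite (rcosets\<^bsub>S\<^esub> Q) \<and> card (rcosets\<^bsub>S\<^esub> Q) \<le> card (rcosets\<^bsub>S\<^esub> P)"
proof (rule card_rcosets_le[OF Q])
  fix i assume i: "i \<in> idx D"
  show "card (proj i (carrier S)) \<le> card (rcosets\<^bsub>S\<^esub> P) * card (proj i Q)"
    using card_proj_le[OF closed_subgroupD(1)[OF P] fin i] unfolding eq[OF i] .
qed

section \<open>Morphisms of the pro-fusion system, read off level by level\<close>

lemma pro_fusion_level:
  assumes \<phi>: "\<phi> \<in> pro_fusion D P Q" and P: "cs P" and Q: "cs Q" and i: "i \<in> idx D"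
  shows "\<exists>f. f \<in> hom ((grp D i)\<lparr>carrier := proj i P\<rparr>) ((grp D i)\<lparr>carrier := proj i Q\<rparr>) \<and>
    inj_on f (proj i P) \<and> (\<forall>x\<in>P. \<phi> x i = f (x i))"
proof -
  obtain \<Phi> where \<Phi>: "\<phi> = lim_map D P \<Phi>" "\<Phi> \<in> lim_homs D P Q"
    using \<phi> unfolding pro_fusion_def by (rule imageE)
  have "\<Phi> \<in> (\<Pi>\<^sub>E i\<in>idx D. fus D i (proj i P) (proj i Q))" using \<Phi>(2) by (simp add: lim_homs_def)
  from PiE_mem[OF this i] have "\<Phi> i \<in> fus D i (proj i P) (proj i Q)" .
  moreover note fus[OF i]
  moreover note subgroup_proj[OF system i closed_subgroupD(1)[OF P]]
    subgroup_proj[OF system i closed_subgroupD(1)[OF Q]]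
  ultimately have "\<Phi> i \<in> hom ((grp D i)\<lparr>carrier := proj i P\<rparr>) ((grp D i)\<lparr>carrier := proj i Q\<rparr>)"
    "inj_on (\<Phi> i) (proj i P)"
    unfolding fusion_system_def by blast+
  moreover have "\<forall>x\<in>P. \<phi> x i = \<Phi> i (x i)" using \<Phi>(1) i by (simp add: lim_map_def)
  ultimately show ?thesis by blast
qed

text \<open>Right to left, the component at level i is a function; left to right, it is injective.
  Through \<open>E_level\<close> this is the source of the normality of
  \<open>aut_kernel\<close>.\<close>

lemma pro_fusion_level_eq:
  assumes "\<phi> \<in> pro_fusion D P Q" "cs P" "cs Q" "i \<in> idx D"
    "x \<in> P" "y \<in> P"
  shows "\<phi> x i = \<phi> y i \<longleftrightarrow> x i = y i"
  using pro_fusion_level[OF assms(1-4)] assms(5,6) by (metis imageI inj_on_contraD)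

lemma card_proj_image:
  assumes "\<phi> \<in> pro_fusion D P Q" "cs P" "cs Q" "i \<in> idx D"
  shows "card (proj i (\<phi> ` P)) = card (proj i P)"
proof -
  obtain f where f: "inj_on f (proj i P)" "\<forall>x\<in>P. \<phi> x i = f (x i)"
    using pro_fusion_level[OF assms] by blast
  then have "proj i (\<phi> ` P) = f ` proj i P" by (force simp: image_image)
  then show ?thesis using f(1) by (simp add: card_image)
qed

lemma pro_fusion_mult:
  assumes \<phi>: "\<phi> \<in> pro_fusion D P Q" and "\<phi> ` P \<subseteq> Q" and P: "cs P" and Q: "cs Q"
    and xy: "x \<in> P" "y \<in> P"
  shows "\<phi> (x \<otimes>\<^bsub>S\<^esub> y) = \<phi> x \<otimes>\<^bsub>S\<^esub> \<phi> y"
proof (rule lim_eqI)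
  have xyP: "x \<otimes>\<^bsub>S\<^esub> y \<in> P" using xy closed_subgroupD(1)[OF P] subgroup.m_closed by metis
  have c: "x \<in> carrier S" "y \<in> carrier S" "\<phi> x \<in> carrier S" "\<phi> y \<in> carrier S"
    using xy assms(2) closed_subgroupD(3)[OF P] closed_subgroupD(3)[OF Q] by auto
  show "\<phi> (x \<otimes>\<^bsub>S\<^esub> y) \<in> carrier S" using assms(2) xyP closed_subgroupD(3)[OF Q] by auto
  show "\<phi> x \<otimes>\<^bsub>S\<^esub> \<phi> y \<in> carrier S" using c by simp
  fix i assume i: "i \<in> idx D"
  obtain f where f: "f \<in> hom ((grp D i)\<lparr>carrier := proj i P\<rparr>) ((grp D i)\<lparr>carrier := proj i Q\<rparr>)"
    "\<forall>x\<in>P. \<phi> x i = f (x i)" using pro_fusion_level[OF \<phi> P Q i] by blast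
  show "\<phi> (x \<otimes>\<^bsub>S\<^esub> y) i = (\<phi> x \<otimes>\<^bsub>S\<^esub> \<phi> y) i"
    using f(2) xy xyP c i hom_mult[OF f(1), of "x i" "y i"] by (simp add: nth_mult)
qed

text \<open>The components are the conjugations by the coordinates of s. With it, strong closure of
  \<open>T\<close> implies that \<open>T\<close> is normal in the limit.\<close>

lemma conj_pro_fusion:
  assumes s: "s \<in> carrier S" and P: "cs P"
  shows "conj_map S s P \<in> pro_fusion D P (carrier S)"
proof -
  let ?\<Phi> = "\<lambda>i\<in>idx D. conj_map (grp D i) (s i) (proj i P)"
  have sub: "P \<subseteq> carrier S" using closed_subgroupD(3)[OF P] .
  have conj: "(s \<otimes>\<^bsub>S\<^esub> x \<otimes>\<^bsub>S\<^esub> inv\<^bsub>S\<^esub> s) i = conj_map (grp D i) (s i) (proj i P) (x i)"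
    if "x \<in> P" "i \<in> idx D" for x i
    using that s sub by (auto simp: conj_map_def nth_mult nth_inv subset_iff)
  have \<Phi>: "?\<Phi> \<in> lim_homs D P (carrier S)"
    unfolding lim_homs_def
  proof (intro CollectI conjI ballI impI PiE_I)
    fix i assume i: "i \<in> idx D"
    have "contains_conj (grp D i) {P. subgroup P (grp D i)} (carrier (grp D i)) (fus D i)"
      using fus[OF i] unfolding fusion_system_def by blast
    moreover have "conj_map (grp D i) (s i) (proj i P) ` proj i P \<subseteq> proj i (carrier S)"
    proof clarify
      fix x assume x: "x \<in> P"
      then have "s \<otimes>\<^bsub>S\<^esub> x \<otimes>\<^bsub>S\<^esub> inv\<^bsub>S\<^esub> s \<in> carrier S" using s sub by auto
      then show "conj_map (grp D i) (s i) (proj i P) (x i) \<in> proj i (carrier S)"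
        using conj[OF x i] by (metis image_eqI)
    qed
    ultimately show "?\<Phi> i \<in> fus D i (proj i P) (proj i (carrier S))"
      using i subgroup_proj[OF system i closed_subgroupD(1)[OF P]] carrier_nth[OF s i]
        subgroup_proj[OF system i subgroup_self]
      by (simp add: contains_conj_def)
  next
    fix i j y assume ij: "i \<in> idx D" "j \<in> idx D" "le D i j" and "y \<in> proj j P"
    then obtain x where x: "x \<in> P" "y = x j" by auto
    have xc: "x \<in> carrier S" using x sub by auto
    let ?c = "s \<otimes>\<^bsub>S\<^esub> x \<otimes>\<^bsub>S\<^esub> inv\<^bsub>S\<^esub> s"
    have "tr D i j (?c j) = ?c i" using tr_nth ij s xc by simp
    then show "tr D i j (?\<Phi> j y) = ?\<Phi> i (tr D i j y)"
      using conj[OF x(1)] ij x(2) tr_nth[OF xc ij] by simp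
  qed auto
  have "conj_map S s P = lim_map D P ?\<Phi>"
  proof
    fix x
    show "conj_map S s P x = lim_map D P ?\<Phi> x"
    proof (cases "x \<in> P")
      case True
      then have xc: "x \<in> carrier S" using sub by auto
      have "s \<otimes>\<^bsub>S\<^esub> x \<otimes>\<^bsub>S\<^esub> inv\<^bsub>S\<^esub> s \<in> extensional (idx D)" using carrier_ext s xc by (auto simp: PiE_def)
      then have "s \<otimes>\<^bsub>S\<^esub> x \<otimes>\<^bsub>S\<^esub> inv\<^bsub>S\<^esub> s = (\<lambda>i\<in>idx D. ?\<Phi> i (x i))"
        using conj[OF True] by (auto simp: extensional_def fun_eq_iff)
      then show ?thesis using True by (simp add: conj_map_def lim_map_def)
    qed (simp add: conj_map_def lim_map_def)
  qed
  then show ?thesis using \<Phi> by (auto simp: pro_fusion_def)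
qed

section \<open>The profinite topology on the morphism sets\<close>

lemma lim_homsD:
  assumes "\<Phi> \<in> lim_homs D P Q"
  shows "i \<in> idx D \<Longrightarrow> \<Phi> i \<in> fus D i (proj i P) (proj i Q)"
    "i \<in> idx D \<Longrightarrow> j \<in> idx D \<Longrightarrow> le D i j \<Longrightarrow> x \<in> proj j P \<Longrightarrow> tr D i j (\<Phi> j x) = \<Phi> i (tr D i j x)"
proof -
  have *: "\<Phi> \<in> (\<Pi>\<^sub>E i\<in>idx D. fus D i (proj i P) (proj i Q))" using assms by (simp add: lim_homs_def)
  show "i \<in> idx D \<Longrightarrow> \<Phi> i \<in> fus D i (proj i P) (proj i Q)" by (rule PiE_mem[OF *])
  show "i \<in> idx D \<Longrightarrow> j \<in> idx D \<Longrightarrow> le D i j \<Longrightarrow> x \<in> proj j P \<Longrightarrow> tr D i j (\<Phi> j x) = \<Phi> i (tr D i j x)"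
    using assms unfolding lim_homs_def by blast
qed

lemma fus_PiE:
  assumes "cs P" "cs Q" "i \<in> idx D"
  shows "fus D i (proj i P) (proj i Q) \<subseteq> proj i P \<rightarrow>\<^sub>E proj i Q"
proof -
  have "map_category {P. subgroup P (grp D i)} (fus D i)"
    using fus[OF assms(3)] unfolding fusion_system_def by (elim conjE)
  then have "\<forall>P\<in>{P. subgroup P (grp D i)}. \<forall>Q\<in>{P. subgroup P (grp D i)}. fus D i P Q \<subseteq> P \<rightarrow>\<^sub>E Q"
    unfolding map_category_def by (elim conjE)
  then show ?thesis
    using subgroup_proj[OF system assms(3) closed_subgroupD(1)[OF assms(1)]]
      subgroup_proj[OF system assms(3) closed_subgroupD(1)[OF assms(2)]] by simp
qed

lemma lim_homs_level_eq:
  assumes P: "cs P" and Q: "cs Q"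
    and \<Phi>: "\<Phi> \<in> lim_homs D P Q" and \<Psi>: "\<Psi> \<in> lim_homs D P Q" and i: "i \<in> idx D"
  shows "\<Psi> i = \<Phi> i \<longleftrightarrow> (\<forall>x\<in>P. lim_map D P \<Psi> x i = lim_map D P \<Phi> x i)"
proof
  assume *: "\<forall>x\<in>P. lim_map D P \<Psi> x i = lim_map D P \<Phi> x i"
  show "\<Psi> i = \<Phi> i"
  proof (rule PiE_ext)
    show "\<Psi> i \<in> proj i P \<rightarrow>\<^sub>E proj i Q" "\<Phi> i \<in> proj i P \<rightarrow>\<^sub>E proj i Q"
      using fus_PiE[OF P Q i] lim_homsD(1)[OF \<Phi> i] lim_homsD(1)[OF \<Psi> i] by auto
    fix y assume "y \<in> proj i P"
    then obtain x where "x \<in> P" "y = x i" by blast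
    then show "\<Psi> i y = \<Phi> i y" using * i by (simp add: lim_map_def)
  qed
qed (simp add: lim_map_def i)

lemma openin_lim_homs_top:
  assumes P: "cs P" and Q: "cs Q"
  shows "openin (lim_homs_top D P Q) V \<longleftrightarrow>
    V \<subseteq> lim_homs D P Q \<and> (\<forall>\<Phi>\<in>V. \<exists>i\<in>idx D. {\<Psi>\<in>lim_homs D P Q. \<Psi> i = \<Phi> i} \<subseteq> V)"
  unfolding lim_homs_top_def
proof (rule openin_directed_product[OF _ idx_nonempty])
  show "lim_homs D P Q \<subseteq> (\<Pi>\<^sub>E i\<in>idx D. fus D i (proj i P) (proj i Q))"
    by (auto simp: lim_homs_def)
  fix i j assume ij: "i \<in> idx D" "j \<in> idx D"
  then obtain k where k: "k \<in> idx D" "le D i k" "le D j k" using idx_directed by blast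
  \<comment> \<open>The transition maps compute the component at i from the one at k.\<close>
  have mono: "\<Phi> i = \<Psi> i"
    if \<Phi>: "\<Phi> \<in> lim_homs D P Q" and \<Psi>: "\<Psi> \<in> lim_homs D P Q" and eq: "\<Phi> k = \<Psi> k"
      and i: "i \<in> idx D" "le D i k" for \<Phi> \<Psi> i
  proof -
    have "\<forall>x\<in>P. \<Phi> i (x i) = \<Psi> i (x i)"
    proof
      fix x assume x: "x \<in> P"
      then have "tr D i k (x k) = x i" using tr_nth i k(1) closed_subgroupD(3)[OF P] by blast
      then show "\<Phi> i (x i) = \<Psi> i (x i)"
        using lim_homsD(2)[OF \<Phi> i(1) k(1) i(2), of "x k"] lim_homsD(2)[OF \<Psi> i(1) k(1) i(2), of "x k"]
          x eq by auto
    qed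
    then show ?thesis using lim_homs_level_eq[OF P Q \<Psi> \<Phi> i(1)] i(1) by (simp add: lim_map_def)
  qed
  show "\<exists>k\<in>idx D. \<forall>x\<in>lim_homs D P Q. \<forall>y\<in>lim_homs D P Q. x k = y k \<longrightarrow> x i = y i \<and> x j = y j"
    using mono ij k by (intro bexI[OF _ k(1)]) blast
qed

text \<open>Injectivity of \<open>lim_map\<close> translates equality of components at level i into
  agreement of values there. In this form the topology can be compared with the kernels
  \<open>aut_kernel\<close>.\<close>

lemma openin_hom_top:
  assumes P: "cs P" and Q: "cs Q"
  shows "openin (hom_top D P Q) U \<longleftrightarrow> U \<subseteq> pro_fusion D P Q \<and>
    (\<forall>\<phi>\<in>U. \<exists>i\<in>idx D. {\<psi>\<in>pro_fusion D P Q. \<forall>x\<in>P. \<psi> x i = \<phi> x i} \<subseteq> U)"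
proof -
  let ?L = "lim_homs D P Q" and ?m = "lim_map D P"
  let ?n = "inv_into ?L ?m"
  note inj = inj_on_lim_map[OF system P Q]
  have pf: "pro_fusion D P Q = ?m ` ?L" by (simp add: pro_fusion_def)
  have n: "?n (?m \<Phi>) = \<Phi>" if "\<Phi> \<in> ?L" for \<Phi> using inv_into_f_f[OF inj that] .
  have level: "{\<psi>\<in>pro_fusion D P Q. \<forall>x\<in>P. \<psi> x i = ?m \<Phi> x i} = ?m ` {\<Psi>\<in>?L. \<Psi> i = \<Phi> i}"
    if "\<Phi> \<in> ?L" "i \<in> idx D" for \<Phi> i
    unfolding pf using lim_homs_level_eq[OF P Q that(1) _ that(2)] by auto
  show ?thesis
  proof
    assume "openin (hom_top D P Q) U"
    then obtain V where V: "openin (lim_homs_top D P Q) V" "U = ?n -` V \<inter> pro_fusion D P Q"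
      unfolding hom_top_def openin_pullback_topology by blast
    have "\<exists>i\<in>idx D. {\<psi>\<in>pro_fusion D P Q. \<forall>x\<in>P. \<psi> x i = \<phi> x i} \<subseteq> U" if \<phi>: "\<phi> \<in> U" for \<phi>
    proof -
      obtain \<Phi> where \<Phi>: "\<Phi> \<in> ?L" "\<phi> = ?m \<Phi>" using \<phi> V(2) pf by blast
      then have "\<Phi> \<in> V" using \<phi> V(2) n by auto
      then obtain i where i: "i \<in> idx D" "{\<Psi>\<in>?L. \<Psi> i = \<Phi> i} \<subseteq> V"
        using V(1) openin_lim_homs_top[OF P Q] by blast
      have "?m ` {\<Psi>\<in>?L. \<Psi> i = \<Phi> i} \<subseteq> U" using i(2) n V(2) pf by auto
      then show ?thesis using level[OF \<Phi>(1) i(1)] i(1) \<Phi>(2) by blast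
    qed
    then show "U \<subseteq> pro_fusion D P Q \<and>
        (\<forall>\<phi>\<in>U. \<exists>i\<in>idx D. {\<psi>\<in>pro_fusion D P Q. \<forall>x\<in>P. \<psi> x i = \<phi> x i} \<subseteq> U)"
      using V(2) by blast
  next
    assume U: "U \<subseteq> pro_fusion D P Q \<and>
        (\<forall>\<phi>\<in>U. \<exists>i\<in>idx D. {\<psi>\<in>pro_fusion D P Q. \<forall>x\<in>P. \<psi> x i = \<phi> x i} \<subseteq> U)"
    define V where "V = {\<Phi>\<in>?L. ?m \<Phi> \<in> U}"
    have "\<exists>i\<in>idx D. {\<Psi>\<in>?L. \<Psi> i = \<Phi> i} \<subseteq> V" if \<Phi>: "\<Phi> \<in> V" for \<Phi>
    proof -
      have \<Phi>': "\<Phi> \<in> ?L" "?m \<Phi> \<in> U" using \<Phi> by (auto simp: V_def)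
      obtain i where i: "i \<in> idx D" "{\<psi>\<in>pro_fusion D P Q. \<forall>x\<in>P. \<psi> x i = ?m \<Phi> x i} \<subseteq> U"
        using U \<Phi>'(2) by blast
      then have "?m ` {\<Psi>\<in>?L. \<Psi> i = \<Phi> i} \<subseteq> U" using level[OF \<Phi>'(1) i(1)] by simp
      then show ?thesis using i(1) unfolding V_def by blast
    qed
    then have "openin (lim_homs_top D P Q) V"
      using openin_lim_homs_top[OF P Q] by (auto simp: V_def)
    moreover have "U = ?n -` V \<inter> pro_fusion D P Q" using U n pf by (auto simp: V_def)
    ultimately show "openin (hom_top D P Q) U"
      unfolding hom_top_def openin_pullback_topology by blast
  qed
qed

text \<open>The compatible families form a compact subset of a product of finite sets, and
  \<open>lim_map\<close> is continuous for the transported topology.\<close>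

lemma compactin_pro_fusion:
  assumes P: "cs P" and Q: "cs Q"
  shows "compactin (hom_top D P Q) (pro_fusion D P Q)"
proof -
  let ?L = "lim_homs D P Q" and ?m = "lim_map D P"
  let ?T = "product_topology (\<lambda>i. discrete_topology (fus D i (proj i P) (proj i Q))) (idx D)"
  have "finite (fus D i (proj i P) (proj i Q))" if i: "i \<in> idx D" for i
    by (rule finite_subset[OF fus_PiE[OF P Q i]])
      (use finite_proj[OF _ i] closed_subgroupD(3)[OF P] closed_subgroupD(3)[OF Q] in \<open>auto intro!: finite_PiE\<close>)
  from compactin_relational_product[OF this, where R = "\<lambda>i j f g. le D i j \<longrightarrow>
      (\<forall>x\<in>proj j P. tr D i j (g x) = f (tr D i j x))"]
  have "compactin ?T ?L" by (simp add: lim_homs_def)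
  then have c: "compactin (lim_homs_top D P Q) ?L"
    by (simp add: lim_homs_top_def compactin_subtopology)
  have top: "topspace (lim_homs_top D P Q) = ?L"
    unfolding lim_homs_top_def topspace_subtopology
    by (auto simp: lim_homs_def)
  have "continuous_map (lim_homs_top D P Q) (hom_top D P Q) ?m"
    unfolding hom_top_def
  proof (rule continuous_map_pullback')
    show "continuous_map (lim_homs_top D P Q) (lim_homs_top D P Q) (inv_into ?L ?m \<circ> ?m)"
      by (rule continuous_map_eq[OF continuous_map_id])
        (simp add: top inv_into_f_f[OF inj_on_lim_map[OF system P Q]])
    show "topspace (lim_homs_top D P Q) \<subseteq> ?m -` pro_fusion D P Q"
      by (auto simp: top pro_fusion_def)
  qed
  from image_compactin[OF c this] show ?thesis by (simp add: pro_fusion_def)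
qed

end

section \<open>Subsystems\<close>

locale pro_fusion_subsystem = inverse_limit p D for p and D :: "('i, 'a) fusion_diagram" +
  fixes T :: "('i \<Rightarrow> 'a) set" and E :: "('i \<Rightarrow> 'a) homs"
  assumes strongly_closed: "strongly_closed D T" and subsystem: "subsystem D T E"
begin

section \<open>Consequences of the axioms of a T-subsystem\<close>

lemma T_closed: "cs T"
  using strongly_closed by (simp add: strongly_closed_def)

lemma T_subgroup: "subgroup T S" and T_carrier: "T \<subseteq> carrier S"
  using closed_subgroupD[OF T_closed] by auto

lemma T_normal:
  assumes s: "s \<in> carrier S" and t: "t \<in> T" shows "s \<otimes>\<^bsub>S\<^esub> t \<otimes>\<^bsub>S\<^esub> inv\<^bsub>S\<^esub> s \<in> T"
proof -
  have "conj_map S s T ` T \<subseteq> T"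
    using strongly_closed conj_pro_fusion[OF s T_closed] T_closed
    unfolding strongly_closed_def by blast
  then show ?thesis using t by (auto simp: conj_map_def)
qed

lemma E_category: "map_category {P. cs P} E"
  using subsystem unfolding subsystem_def by (elim conjE)

lemma E_contains_conj: "contains_conj S {P. cs P} T E"
  using subsystem unfolding subsystem_def by (elim conjE)

lemma E_factors: "factors_iso_incl {P. cs P} E"
  using subsystem unfolding subsystem_def by (elim conjE)

lemma E_closedin:
  assumes "cs P" "cs Q"
  shows "closedin (hom_top D P Q) (E P Q)" "E P Q \<subseteq> pro_fusion D P Q"
proof -
  have "\<forall>P Q. cs P \<longrightarrow> cs Q \<longrightarrow> E P Q \<subseteq> pro_fusion D P Q \<and> closedin (hom_top D P Q) (E P Q)"
    using subsystem unfolding subsystem_def by (elim conjE)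
  then show "closedin (hom_top D P Q) (E P Q)" "E P Q \<subseteq> pro_fusion D P Q" using assms by auto
qed

lemma E_pro_fusion: "cs P \<Longrightarrow> cs Q \<Longrightarrow> \<phi> \<in> E P Q \<Longrightarrow> \<phi> \<in> pro_fusion D P Q"
  by (rule subsetD[OF E_closedin(2)])

lemma E_PiE: assumes "cs P" "cs Q" "\<phi> \<in> E P Q" shows "\<phi> \<in> P \<rightarrow>\<^sub>E Q"
proof -
  have "\<forall>P\<in>{P. cs P}. \<forall>Q\<in>{P. cs P}. E P Q \<subseteq> P \<rightarrow>\<^sub>E Q"
    using E_category unfolding map_category_def by (elim conjE)
  then show ?thesis using assms by simp blast
qed

lemma E_id: assumes "cs P" shows "(\<lambda>x\<in>P. x) \<in> E P P"
proof -
  have "\<forall>P\<in>{P. cs P}. (\<lambda>x\<in>P. x) \<in> E P P"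
    using E_category unfolding map_category_def by (elim conjE)
  then show ?thesis using assms by simp
qed

lemma E_compose:
  assumes "cs P" "cs Q" "cs R" "\<phi> \<in> E P Q" "\<psi> \<in> E Q R"
  shows "compose P \<psi> \<phi> \<in> E P R"
proof -
  have "\<forall>P\<in>{P. cs P}. \<forall>Q\<in>{P. cs P}. \<forall>R\<in>{P. cs P}. \<forall>\<phi>\<in>E P Q. \<forall>\<psi>\<in>E Q R. compose P \<psi> \<phi> \<in> E P R"
    using E_category unfolding map_category_def by (elim conjE)
  then show ?thesis using assms by simp
qed

lemma E_mem: "cs P \<Longrightarrow> cs Q \<Longrightarrow> \<phi> \<in> E P Q \<Longrightarrow> x \<in> P \<Longrightarrow> \<phi> x \<in> Q"
  by (rule PiE_mem[OF E_PiE])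

lemma E_ext: "cs P \<Longrightarrow> cs Q \<Longrightarrow> \<phi> \<in> E P Q \<Longrightarrow> \<phi> \<in> extensional P"
  using E_PiE[of P Q \<phi>] by (simp add: PiE_def)

lemma E_level:
  "cs P \<Longrightarrow> cs Q \<Longrightarrow> \<phi> \<in> E P Q \<Longrightarrow> i \<in> idx D \<Longrightarrow> x \<in> P \<Longrightarrow> y \<in> P \<Longrightarrow> \<phi> x i = \<phi> y i \<longleftrightarrow> x i = y i"
  by (rule pro_fusion_level_eq[OF E_pro_fusion])

lemma E_mult:
  assumes "cs P" "cs Q" "\<phi> \<in> E P Q" "x \<in> P" "y \<in> P"
  shows "\<phi> (x \<otimes>\<^bsub>S\<^esub> y) = \<phi> x \<otimes>\<^bsub>S\<^esub> \<phi> y"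
  by (rule pro_fusion_mult[OF E_pro_fusion[OF assms(1-3)] _ assms(1,2,4,5)])
    (use E_mem[OF assms(1-3)] in blast)

lemma E_inj: assumes "cs P" "cs Q" "\<phi> \<in> E P Q" shows "inj_on \<phi> P"
proof (rule inj_onI)
  fix x y assume xy: "x \<in> P" "y \<in> P" "\<phi> x = \<phi> y"
  show "x = y"
  proof (rule lim_eqI)
    show "x \<in> carrier S" "y \<in> carrier S" using xy closed_subgroupD(3)[OF assms(1)] by auto
    show "x i = y i" if "i \<in> idx D" for i using E_level[OF assms that xy(1,2)] xy(3) by simp
  qed
qed

lemma E_one: assumes "cs P" "cs Q" "\<phi> \<in> E P Q" shows "\<phi> \<one>\<^bsub>S\<^esub> = \<one>\<^bsub>S\<^esub>"
proof -
  have o: "\<one>\<^bsub>S\<^esub> \<in> P" using closed_subgroupD(1)[OF assms(1)] subgroup.one_closed by blast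
  have "\<phi> \<one>\<^bsub>S\<^esub> \<in> carrier S" using E_mem[OF assms o] closed_subgroupD(3)[OF assms(2)] by blast
  then show ?thesis using E_mult[OF assms o o] by (simp add: r_cancel_one')
qed

lemma E_inv: assumes "cs P" "cs Q" "\<phi> \<in> E P Q" "x \<in> P" shows "\<phi> (inv\<^bsub>S\<^esub> x) = inv\<^bsub>S\<^esub> (\<phi> x)"
proof -
  have ix: "inv\<^bsub>S\<^esub> x \<in> P" using closed_subgroupD(1)[OF assms(1)] assms(4) subgroup.m_inv_closed by metis
  have c: "x \<in> carrier S" "\<phi> x \<in> carrier S" "\<phi> (inv\<^bsub>S\<^esub> x) \<in> carrier S"
    using E_mem[OF assms] E_mem[OF assms(1-3) ix] assms(4) closed_subgroupD(3)[OF assms(1)]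
      closed_subgroupD(3)[OF assms(2)] by auto
  have "\<phi> (inv\<^bsub>S\<^esub> x) \<otimes>\<^bsub>S\<^esub> \<phi> x = \<one>\<^bsub>S\<^esub>"
    using E_mult[OF assms(1-3) ix assms(4)] E_one[OF assms(1-3)] c by simp
  then show ?thesis using c inv_equality by metis
qed

lemma conj_map_one: "P \<subseteq> carrier S \<Longrightarrow> conj_map S \<one>\<^bsub>S\<^esub> P = (\<lambda>x\<in>P. x)"
  unfolding conj_map_def by (rule restrict_ext) (simp add: subset_iff)

lemma E_conj: "cs P \<Longrightarrow> cs Q \<Longrightarrow> g \<in> T \<Longrightarrow> conj_map S g P ` P \<subseteq> Q \<Longrightarrow> conj_map S g P \<in> E P Q"
  using E_contains_conj[unfolded contains_conj_def, THEN bspec, THEN bspec, THEN bspec, of P Q g]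
  by simp

lemma E_inclusion: assumes "cs P" "cs Q" "P \<subseteq> Q" shows "(\<lambda>x\<in>P. x) \<in> E P Q"
  using E_conj[OF assms(1,2) subgroup.one_closed[OF T_subgroup]] assms(3)
    conj_map_one[OF closed_subgroupD(3)[OF assms(1)]] by auto

lemma E_restrict:
  assumes "cs P" "cs Q" "cs R" "R \<subseteq> P" "\<phi> \<in> E P Q"
  shows "restrict \<phi> R \<in> E R Q"
proof -
  have "compose R \<phi> (\<lambda>x\<in>R. x) \<in> E R Q" using E_compose[OF assms(3,1,2) E_inclusion] assms by blast
  then show ?thesis by (simp add: compose_def restrict_def cong: if_cong)
qed

lemma E_codomain:
  assumes "cs P" "cs Q" "cs R" "Q \<subseteq> R" "\<phi> \<in> E P Q"
  shows "\<phi> \<in> E P R"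
proof -
  have "compose P (\<lambda>x\<in>Q. x) \<phi> \<in> E P R" using E_compose[OF assms(1,2,3) assms(5) E_inclusion] assms by blast
  moreover have "compose P (\<lambda>x\<in>Q. x) \<phi> = \<phi>"
    using E_PiE[OF assms(1,2,5)] by (auto simp: compose_def fun_eq_iff PiE_iff extensional_def)
  ultimately show ?thesis by simp
qed

lemma Iso_E: "\<phi> \<in> Iso E P Q \<Longrightarrow> \<phi> \<in> E P Q"
  by (simp add: Iso_def)

lemma Iso_image: assumes "cs P" "cs Q" "\<phi> \<in> Iso E P Q" shows "\<phi> ` P = Q"
proof
  show "\<phi> ` P \<subseteq> Q" using E_mem[OF assms(1,2) Iso_E[OF assms(3)]] by blast
  obtain \<psi> where \<psi>: "\<psi> \<in> E Q P" "compose Q \<phi> \<psi> = (\<lambda>x\<in>Q. x)" using assms(3) by (auto simp: Iso_def)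
  show "Q \<subseteq> \<phi> ` P"
  proof
    fix y assume y: "y \<in> Q"
    then have "\<phi> (\<psi> y) = y" using fun_cong[OF \<psi>(2), of y] by (simp add: compose_def)
    then show "y \<in> \<phi> ` P" using E_mem[OF assms(2,1) \<psi>(1) y] by (metis image_eqI)
  qed
qed

text \<open>Morphisms are extensional functions on their domain, so \<phi> and the isomorphism
  through which it factors are the same function, and the intermediate object is the image.\<close>

lemma E_image:
  assumes "cs P" "cs Q" "\<phi> \<in> E P Q"
  shows "cs (\<phi> ` P)" "\<phi> \<in> Iso E P (\<phi> ` P)"
proof -
  obtain R \<theta> where R: "cs R" "R \<subseteq> Q" "\<theta> \<in> Iso E P R" "\<phi> = compose P (\<lambda>x\<in>R. x) \<theta>"
    using E_factors assms unfolding factors_iso_incl_def by blast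
  have "\<phi> = \<theta>"
    unfolding R(4) using E_PiE[OF assms(1) R(1) Iso_E[OF R(3)]]
    by (auto simp: compose_def fun_eq_iff PiE_iff extensional_def)
  then show "cs (\<phi> ` P)" "\<phi> \<in> Iso E P (\<phi> ` P)" using Iso_image[OF assms(1) R(1,3)] R by auto
qed

lemma Iso_iff: "cs P \<Longrightarrow> cs Q \<Longrightarrow> \<phi> \<in> Iso E P Q \<longleftrightarrow> \<phi> \<in> E P Q \<and> \<phi> ` P = Q"
  using Iso_image[of P Q \<phi>] Iso_E[of \<phi> P Q] E_image(2)[of P Q \<phi>] by metis

lemma Iso_inverse:
  assumes "cs P" "cs Q" "\<phi> \<in> Iso E P Q"
  shows "restrict (inv_into P \<phi>) Q \<in> Iso E Q P"
proof -
  obtain \<psi> where \<psi>: "\<psi> \<in> E Q P" "compose Q \<phi> \<psi> = (\<lambda>x\<in>Q. x)" "compose P \<psi> \<phi> = (\<lambda>x\<in>P. x)"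
    using assms(3) by (auto simp: Iso_def)
  have "\<psi> = restrict (inv_into P \<phi>) Q"
  proof
    fix y
    show "\<psi> y = restrict (inv_into P \<phi>) Q y"
    proof (cases "y \<in> Q")
      case True
      then have "\<phi> (\<psi> y) = y" using fun_cong[OF \<psi>(2), of y] by (simp add: compose_def)
      then have "inv_into P \<phi> y = \<psi> y"
        using inv_into_f_f[OF E_inj[OF assms(1,2) Iso_E[OF assms(3)]] E_mem[OF assms(2,1) \<psi>(1) True]]
        by simp
      then show ?thesis using True by simp
    next
      case False
      then show ?thesis using E_ext[OF assms(2,1) \<psi>(1)] by (simp add: extensional_def)
    qed
  qed
  moreover have "\<psi> \<in> Iso E Q P" using \<psi> assms(3) by (auto simp: Iso_def)
  ultimately show ?thesis by simp
qed

lemma Iso_compose: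
  assumes "cs P" "cs Q" "cs R" "\<phi> \<in> Iso E P Q" "\<psi> \<in> Iso E Q R"
  shows "compose P \<psi> \<phi> \<in> Iso E P R"
proof -
  have "compose P \<psi> \<phi> ` P = \<psi> ` \<phi> ` P" by (auto simp: compose_def)
  then show ?thesis
    using E_compose[OF assms(1-3) Iso_E[OF assms(4)] Iso_E[OF assms(5)]]
      Iso_image[OF assms(1,2,4)] Iso_image[OF assms(2,3,5)] Iso_iff[OF assms(1,3)] by simp
qed

lemma E_moves_by_T:
  assumes "cs P" "cs Q" "\<phi> \<in> E P Q" "x \<in> P"
  shows "\<phi> x \<otimes>\<^bsub>S\<^esub> inv\<^bsub>S\<^esub> x \<in> T"
proof -
  have "\<forall>Q. cs Q \<longrightarrow> (\<forall>\<psi>\<in>E Q (carrier S). \<forall>u\<in>Q. \<psi> u \<otimes>\<^bsub>S\<^esub> inv\<^bsub>S\<^esub> u \<in> T)"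
    using subsystem unfolding subsystem_def by (elim conjE)
  moreover have "\<phi> \<in> E P (carrier S)"
    using E_codomain[OF assms(1,2) closed_subgroup_carrier closed_subgroupD(3)[OF assms(2)] assms(3)] .
  ultimately show ?thesis using assms(1,4) by blast
qed

text \<open>By the last axiom of a subsystem, x and its image lie in the same coset of
  \<open>T\<close>.\<close>

lemma E_mem_T:
  assumes "cs P" "cs Q" "\<phi> \<in> E P Q" "x \<in> P"
  shows "\<phi> x \<in> T \<longleftrightarrow> x \<in> T"
proof -
  have c: "x \<in> carrier S" "\<phi> x \<in> carrier S"
    using assms(4) E_mem[OF assms] closed_subgroupD(3)[OF assms(1)] closed_subgroupD(3)[OF assms(2)] by auto
  let ?t = "\<phi> x \<otimes>\<^bsub>S\<^esub> inv\<^bsub>S\<^esub> x"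
  have t: "?t \<in> T" using E_moves_by_T[OF assms] .
  have "\<phi> x = ?t \<otimes>\<^bsub>S\<^esub> x" "x = inv\<^bsub>S\<^esub> ?t \<otimes>\<^bsub>S\<^esub> \<phi> x"
    using c by (simp_all add: m_assoc inv_mult_group)
  then show ?thesis using t subgroup.m_closed[OF T_subgroup] subgroup.m_inv_closed[OF T_subgroup] by metis
qed

text \<open>The projections of isomorphic subgroups have equal size at each level, and comparing the
  indices in both directions gives equality. This keeps the induction parameter constant along an
  isomorphism class.\<close>

lemma Iso_index:
  assumes P: "open_subgroup D P" and Q: "cs Q" and \<phi>: "\<phi> \<in> Iso E P Q"
  shows "open_subgroup D Q" "card (rcosets\<^bsub>S\<^esub> Q) = card (rcosets\<^bsub>S\<^esub> P)"
proof -
  have cP: "cs P" using open_closed_subgroup[OF P] .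
  have fin: "finite (rcosets\<^bsub>S\<^esub> P)" using open_subgroup_finite_index open_subgroupD[OF P] by blast
  have eq: "card (proj i P) = card (proj i Q)" if "i \<in> idx D" for i
    using card_proj_image[OF E_pro_fusion[OF cP Q Iso_E[OF \<phi>]] cP Q that] Iso_image[OF cP Q \<phi>] by simp
  note Q' = index_le_of_card_proj[OF cP Q fin eq]
  show "open_subgroup D Q"
    using closed_finite_index_open closed_subgroupD[OF Q] Q' by (simp add: open_subgroup_def)
  show "card (rcosets\<^bsub>S\<^esub> Q) = card (rcosets\<^bsub>S\<^esub> P)"
    using Q' index_le_of_card_proj[OF Q cP conjunct1[OF Q'] eq[symmetric]] by simp
qed

text \<open>At each level an injective self-map of the finite projection is onto; the image of
  \<open>Q\<close> is closed, hence determined by its projections.\<close>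

lemma E_endo_surj: assumes "cs Q" "\<alpha> \<in> E Q Q" shows "\<alpha> ` Q = Q"
proof
  show "\<alpha> ` Q \<subseteq> Q" using E_mem[OF assms(1,1,2)] by blast
  show "Q \<subseteq> \<alpha> ` Q"
  proof
    fix x assume x: "x \<in> Q"
    show "x \<in> \<alpha> ` Q"
    proof (rule closed_subgroup_memI[OF E_image(1)[OF assms(1,1,2)]])
      show "x \<in> carrier S" using x closed_subgroupD(3)[OF assms(1)] by blast
      fix i assume i: "i \<in> idx D"
      have "proj i (\<alpha> ` Q) = proj i Q"
      proof (rule card_subset_eq)
        show "finite (proj i Q)" using finite_proj[OF closed_subgroupD(3)[OF assms(1)] i] .
        show "proj i (\<alpha> ` Q) \<subseteq> proj i Q" using \<open>\<alpha> ` Q \<subseteq> Q\<close> by blast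
        show "card (proj i (\<alpha> ` Q)) = card (proj i Q)"
          using card_proj_image[OF E_pro_fusion[OF assms(1,1,2)] assms(1,1) i] .
      qed
      then show "x i \<in> proj i (\<alpha> ` Q)" using x by blast
    qed
  qed
qed

lemma Aut_eq: "cs Q \<Longrightarrow> Aut E Q = E Q Q"
  using Iso_iff[of Q Q] E_endo_surj[of Q] by auto

subsection \<open>The profinite group of automorphisms\<close>

abbreviation "A Q \<equiv> aut_grp E Q"

text \<open>The kernel of the action on the projection of \<open>Q\<close> at level i.\<close>

definition aut_kernel :: "('i \<Rightarrow> 'a) set \<Rightarrow> 'i \<Rightarrow> (('i \<Rightarrow> 'a) \<Rightarrow> 'i \<Rightarrow> 'a) set" where
  "aut_kernel Q i = {\<alpha> \<in> Aut E Q. \<forall>x\<in>Q. \<alpha> x i = x i}"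

lemma carrier_aut [simp]: "carrier (A Q) = Aut E Q"
  by (simp add: aut_grp_def)

lemma Aut_Bij: assumes "cs Q" shows "Aut E Q \<subseteq> Bij Q"
proof
  fix \<alpha> assume \<alpha>: "\<alpha> \<in> Aut E Q"
  then show "\<alpha> \<in> Bij Q"
    using E_ext[OF assms assms Iso_E] E_inj[OF assms assms Iso_E] Iso_image[OF assms assms]
    by (simp add: Bij_def bij_betw_def)
qed

lemma aut_subgroup: assumes Q: "cs Q" shows "subgroup (Aut E Q) (BijGroup Q)"
proof (rule group.subgroupI[OF group_BijGroup])
  show "Aut E Q \<subseteq> carrier (BijGroup Q)" using Aut_Bij[OF Q] by (simp add: BijGroup_def)
  show "Aut E Q \<noteq> {}" using E_id[OF Q] Aut_eq[OF Q] by blast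
  fix \<alpha> assume \<alpha>: "\<alpha> \<in> Aut E Q"
  then show "inv\<^bsub>BijGroup Q\<^esub> \<alpha> \<in> Aut E Q"
    using Iso_inverse[OF Q Q \<alpha>] inv_BijGroup[OF subsetD[OF Aut_Bij[OF Q] \<alpha>]] by simp
  fix \<beta> assume \<beta>: "\<beta> \<in> Aut E Q"
  then show "\<alpha> \<otimes>\<^bsub>BijGroup Q\<^esub> \<beta> \<in> Aut E Q"
    using Iso_compose[OF Q Q Q \<beta> \<alpha>] subsetD[OF Aut_Bij[OF Q] \<alpha>] subsetD[OF Aut_Bij[OF Q] \<beta>]
    by (simp add: BijGroup_def)
qed

lemma aut_group: "cs Q \<Longrightarrow> Group.group (A Q)"
  unfolding aut_grp_def by (rule group.subgroup_imp_group[OF group_BijGroup aut_subgroup])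

lemma aut_mult:
  assumes "cs Q" "\<alpha> \<in> Aut E Q" "\<beta> \<in> Aut E Q"
  shows "\<alpha> \<otimes>\<^bsub>A Q\<^esub> \<beta> = compose Q \<alpha> \<beta>"
  using subsetD[OF Aut_Bij[OF assms(1)] assms(2)] subsetD[OF Aut_Bij[OF assms(1)] assms(3)]
  by (simp add: aut_grp_def BijGroup_def)

lemma aut_mult_apply:
  assumes "cs Q" "\<alpha> \<in> Aut E Q" "\<beta> \<in> Aut E Q" "x \<in> Q"
  shows "(\<alpha> \<otimes>\<^bsub>A Q\<^esub> \<beta>) x = \<alpha> (\<beta> x)"
  using aut_mult[OF assms(1-3)] assms(4) by (simp add: compose_eq)

lemma aut_one: "\<one>\<^bsub>A Q\<^esub> = (\<lambda>x\<in>Q. x)"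
  by (simp add: aut_grp_def BijGroup_def)

lemma aut_inv_apply:
  assumes Q: "cs Q" and \<alpha>: "\<alpha> \<in> Aut E Q" and x: "x \<in> Q"
  shows "(inv\<^bsub>A Q\<^esub> \<alpha>) (\<alpha> x) = x" "\<alpha> ((inv\<^bsub>A Q\<^esub> \<alpha>) x) = x"
proof -
  interpret A: group "A Q" using aut_group[OF Q] .
  have i: "inv\<^bsub>A Q\<^esub> \<alpha> \<in> Aut E Q" using A.inv_closed \<alpha> by simp
  have "compose Q (inv\<^bsub>A Q\<^esub> \<alpha>) \<alpha> = (\<lambda>x\<in>Q. x)" "compose Q \<alpha> (inv\<^bsub>A Q\<^esub> \<alpha>) = (\<lambda>x\<in>Q. x)"
    using A.l_inv[of \<alpha>] A.r_inv[of \<alpha>] \<alpha> i by (simp_all add: aut_mult[OF Q] aut_one)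
  from fun_cong[OF this(1), of x] fun_cong[OF this(2), of x]
  show "(inv\<^bsub>A Q\<^esub> \<alpha>) (\<alpha> x) = x" "\<alpha> ((inv\<^bsub>A Q\<^esub> \<alpha>) x) = x"
    using x by (simp_all add: compose_def)
qed

lemma Aut_mem: "cs Q \<Longrightarrow> \<alpha> \<in> Aut E Q \<Longrightarrow> x \<in> Q \<Longrightarrow> \<alpha> x \<in> Q"
  by (rule E_mem[OF _ _ Iso_E])

lemma Aut_eqI:
  assumes "cs Q" "\<alpha> \<in> Aut E Q" "\<beta> \<in> Aut E Q" "\<And>x. x \<in> Q \<Longrightarrow> \<alpha> x = \<beta> x"
  shows "\<alpha> = \<beta>"
  using E_ext[OF assms(1,1) Iso_E[OF assms(2)]] E_ext[OF assms(1,1) Iso_E[OF assms(3)]] assms(4)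
  by (rule extensionalityI)

lemma mult_inv_in_aut_kernel:
  assumes Q: "cs Q" and i: "i \<in> idx D" and \<alpha>: "\<alpha> \<in> Aut E Q" and \<beta>: "\<beta> \<in> Aut E Q"
  shows "\<alpha> \<otimes>\<^bsub>A Q\<^esub> inv\<^bsub>A Q\<^esub> \<beta> \<in> aut_kernel Q i \<longleftrightarrow> (\<forall>x\<in>Q. \<alpha> x i = \<beta> x i)"
proof -
  interpret A: group "A Q" using aut_group[OF Q] .
  have ib: "inv\<^bsub>A Q\<^esub> \<beta> \<in> Aut E Q" using A.inv_closed \<beta> by simp
  have m: "\<alpha> \<otimes>\<^bsub>A Q\<^esub> inv\<^bsub>A Q\<^esub> \<beta> \<in> Aut E Q" using A.m_closed \<alpha> ib by simp
  have ap: "(\<alpha> \<otimes>\<^bsub>A Q\<^esub> inv\<^bsub>A Q\<^esub> \<beta>) x = \<alpha> ((inv\<^bsub>A Q\<^esub> \<beta>) x)" if "x \<in> Q" for x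
    using that by (simp add: aut_mult[OF Q \<alpha> ib] compose_def)
  have "(\<forall>x\<in>Q. \<alpha> ((inv\<^bsub>A Q\<^esub> \<beta>) x) i = x i) \<longleftrightarrow> (\<forall>x\<in>Q. \<alpha> x i = \<beta> x i)"
  proof safe
    fix x assume a: "\<forall>x\<in>Q. \<alpha> ((inv\<^bsub>A Q\<^esub> \<beta>) x) i = x i" and x: "x \<in> Q"
    show "\<alpha> x i = \<beta> x i"
      using a[rule_format, OF Aut_mem[OF Q \<beta> x]] aut_inv_apply(1)[OF Q \<beta> x] by simp
  next
    fix x assume a: "\<forall>x\<in>Q. \<alpha> x i = \<beta> x i" and x: "x \<in> Q"
    show "\<alpha> ((inv\<^bsub>A Q\<^esub> \<beta>) x) i = x i"
      using a[rule_format, OF Aut_mem[OF Q ib x]] aut_inv_apply(2)[OF Q \<beta> x] by simp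
  qed
  then show ?thesis using m ap by (simp add: aut_kernel_def)
qed

lemma aut_kernel_normal: assumes Q: "cs Q" and i: "i \<in> idx D" shows "aut_kernel Q i \<lhd> A Q"
proof -
  interpret A: group "A Q" using aut_group[OF Q] .
  have inE: "\<alpha> \<in> Aut E Q" if "\<alpha> \<in> aut_kernel Q i" for \<alpha> using that by (simp add: aut_kernel_def)
  have ker: "\<alpha> x i = x i" if "\<alpha> \<in> aut_kernel Q i" "x \<in> Q" for \<alpha> x using that by (simp add: aut_kernel_def)
  show ?thesis
  proof (rule A.normal_invI)
    show "subgroup (aut_kernel Q i) (A Q)"
    proof (rule A.subgroupI)
      show "aut_kernel Q i \<subseteq> carrier (A Q)" using inE by auto
      have "\<one>\<^bsub>A Q\<^esub> \<in> Aut E Q" using A.one_closed by simp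
      then have "\<one>\<^bsub>A Q\<^esub> \<in> aut_kernel Q i" by (simp add: aut_kernel_def aut_one)
      then show "aut_kernel Q i \<noteq> {}" by blast
      fix \<alpha> assume \<alpha>: "\<alpha> \<in> aut_kernel Q i"
      have ia: "inv\<^bsub>A Q\<^esub> \<alpha> \<in> Aut E Q" using A.inv_closed inE[OF \<alpha>] by simp
      then show "inv\<^bsub>A Q\<^esub> \<alpha> \<in> aut_kernel Q i"
        using ker[OF \<alpha> Aut_mem[OF Q ia]] aut_inv_apply(2)[OF Q inE[OF \<alpha>]] by (simp add: aut_kernel_def)
      fix \<beta> assume \<beta>: "\<beta> \<in> aut_kernel Q i"
      have "\<alpha> \<otimes>\<^bsub>A Q\<^esub> \<beta> \<in> Aut E Q" using A.m_closed inE[OF \<alpha>] inE[OF \<beta>] by simp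
      then show "\<alpha> \<otimes>\<^bsub>A Q\<^esub> \<beta> \<in> aut_kernel Q i"
        using ker[OF \<beta>] ker[OF \<alpha> Aut_mem[OF Q inE[OF \<beta>]]]
        by (simp add: aut_kernel_def aut_mult[OF Q inE[OF \<alpha>] inE[OF \<beta>]] compose_def)
    qed
    fix \<beta> \<alpha> assume "\<beta> \<in> carrier (A Q)" and \<alpha>: "\<alpha> \<in> aut_kernel Q i"
    then have \<beta>: "\<beta> \<in> Aut E Q" by simp
    have ba: "\<beta> \<otimes>\<^bsub>A Q\<^esub> \<alpha> \<in> Aut E Q" using A.m_closed \<beta> inE[OF \<alpha>] by simp
    \<comment> \<open>\<alpha> x and x agree at level i, and \<beta> respects agreement at that
      level.\<close>
    have "(\<beta> \<otimes>\<^bsub>A Q\<^esub> \<alpha>) x i = \<beta> x i" if x: "x \<in> Q" for x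
      using x E_level[OF Q Q Iso_E[OF \<beta>] i Aut_mem[OF Q inE[OF \<alpha>] x] x] ker[OF \<alpha> x]
      by (simp add: aut_mult[OF Q \<beta> inE[OF \<alpha>]] compose_def)
    then show "\<beta> \<otimes>\<^bsub>A Q\<^esub> \<alpha> \<otimes>\<^bsub>A Q\<^esub> inv\<^bsub>A Q\<^esub> \<beta> \<in> aut_kernel Q i"
      using mult_inv_in_aut_kernel[OF Q i ba \<beta>] by blast
  qed
qed

lemma aut_kernel_coset:
  assumes Q: "cs Q" and i: "i \<in> idx D" and \<alpha>: "\<alpha> \<in> Aut E Q"
  shows "aut_kernel Q i #>\<^bsub>A Q\<^esub> \<alpha> = {\<beta> \<in> Aut E Q. \<forall>x\<in>Q. \<beta> x i = \<alpha> x i}"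
proof -
  have sub: "subgroup (aut_kernel Q i) (A Q)" using normal_imp_subgroup[OF aut_kernel_normal[OF Q i]] .
  note ag = aut_group[OF Q]
  have "\<beta> \<in> aut_kernel Q i #>\<^bsub>A Q\<^esub> \<alpha> \<longleftrightarrow> (\<forall>x\<in>Q. \<beta> x i = \<alpha> x i)" if "\<beta> \<in> Aut E Q" for \<beta>
    using subgroup.rcos_module[OF sub ag, of \<alpha> \<beta>] mult_inv_in_aut_kernel[OF Q i that \<alpha>] \<alpha> that by simp
  moreover have "\<beta> \<in> Aut E Q" if "\<beta> \<in> aut_kernel Q i #>\<^bsub>A Q\<^esub> \<alpha>" for \<beta>
    using subgroup.elemrcos_carrier[OF sub ag, of \<alpha> \<beta>] \<alpha> that by simp
  ultimately show ?thesis by blast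
qed

lemma aut_kernel_finite_index:
  assumes Q: "cs Q" and i: "i \<in> idx D"
  shows "finite (rcosets\<^bsub>A Q\<^esub> aut_kernel Q i)"
proof -
  have "finite ((\<lambda>\<alpha>. aut_kernel Q i #>\<^bsub>A Q\<^esub> \<alpha>) ` Aut E Q)"
  proof (rule finite_image_factor)
    \<comment> \<open>\<open>?f\<close> is the graph of the map that \<alpha> induces on the
      projection of \<open>Q\<close>; only finitely many graphs are possible.\<close>
    let ?f = "\<lambda>\<alpha>. (\<lambda>x. (x i, \<alpha> x i)) ` Q"
    have "?f ` Aut E Q \<subseteq> Pow (proj i Q \<times> proj i Q)" using Aut_mem[OF Q] by auto
    moreover have "finite (Pow (proj i Q \<times> proj i Q))"
      using finite_proj[OF closed_subgroupD(3)[OF Q] i] by simp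
    ultimately show "finite (?f ` Aut E Q)" by (rule finite_subset)
    fix \<alpha> \<beta> assume ab: "\<alpha> \<in> Aut E Q" "\<beta> \<in> Aut E Q" and eq: "?f \<alpha> = ?f \<beta>"
    have "\<alpha> x i = \<beta> x i" if x: "x \<in> Q" for x
    proof -
      have "(x i, \<alpha> x i) \<in> ?f \<beta>" using x eq by blast
      then obtain y where y: "y \<in> Q" "x i = y i" "\<alpha> x i = \<beta> y i" by auto
      then show ?thesis using E_level[OF Q Q Iso_E[OF ab(2)] i x y(1)] by simp
    qed
    then show "aut_kernel Q i #>\<^bsub>A Q\<^esub> \<alpha> = aut_kernel Q i #>\<^bsub>A Q\<^esub> \<beta>"
      unfolding aut_kernel_coset[OF Q i ab(1)] aut_kernel_coset[OF Q i ab(2)] by auto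
  qed
  then show ?thesis by (simp add: RCOSETS_def UNION_singleton_eq_range)
qed

lemma openin_aut_top:
  assumes Q: "cs Q"
  shows "openin (aut_top D E Q) U \<longleftrightarrow> U \<subseteq> Aut E Q \<and>
    (\<forall>\<alpha>\<in>U. \<exists>i\<in>idx D. {\<beta>\<in>Aut E Q. \<forall>x\<in>Q. \<beta> x i = \<alpha> x i} \<subseteq> U)"
  unfolding aut_top_def
proof (rule openin_subtopology_levels[where r = "\<lambda>i \<alpha> \<beta>. \<forall>x\<in>Q. \<beta> x i = \<alpha> x i"])
  show "Aut E Q \<subseteq> pro_fusion D Q Q" using E_pro_fusion[OF Q Q Iso_E] by blast
qed (use openin_hom_top[OF Q Q] in simp_all)

lemma profinite_aut:
  assumes Q: "cs Q"
  shows "profinite_base (A Q) (aut_top D E Q) (idx D) (aut_kernel Q)"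
proof (intro profinite_base.intro profinite_base_axioms.intro)
  show "Group.group (A Q)" by (rule aut_group[OF Q])
  show "idx D \<noteq> {}" by (rule idx_nonempty)
  fix i j assume ij: "i \<in> idx D" "j \<in> idx D"
  then obtain k where k: "k \<in> idx D" "le D i k" "le D j k" using idx_directed by blast
  have "aut_kernel Q k \<subseteq> aut_kernel Q i" if i: "i \<in> idx D" "le D i k" for i
  proof
    fix \<alpha> assume a: "\<alpha> \<in> aut_kernel Q k"
    then have \<alpha>: "\<alpha> \<in> Aut E Q" by (simp add: aut_kernel_def)
    have "\<alpha> x i = x i" if x: "x \<in> Q" for x
    proof (rule nth_mono[OF _ _ i(1) k(1) i(2)])
      show "\<alpha> x \<in> carrier S" "x \<in> carrier S" using Aut_mem[OF Q \<alpha> x] x closed_subgroupD(3)[OF Q] by auto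
      show "\<alpha> x k = x k" using a x by (simp add: aut_kernel_def)
    qed
    then show "\<alpha> \<in> aut_kernel Q i" using \<alpha> by (simp add: aut_kernel_def)
  qed
  then show "\<exists>k\<in>idx D. aut_kernel Q k \<subseteq> aut_kernel Q i \<and> aut_kernel Q k \<subseteq> aut_kernel Q j"
    using k ij by blast
next
  fix i assume i: "i \<in> idx D"
  show "aut_kernel Q i \<lhd> A Q" by (rule aut_kernel_normal[OF Q i])
  show "finite (rcosets\<^bsub>A Q\<^esub> aut_kernel Q i)" by (rule aut_kernel_finite_index[OF Q i])
next
  fix U
  show "openin (aut_top D E Q) U \<longleftrightarrow>
      U \<subseteq> carrier (A Q) \<and> (\<forall>\<alpha>\<in>U. \<exists>i\<in>idx D. aut_kernel Q i #>\<^bsub>A Q\<^esub> \<alpha> \<subseteq> U)"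
    unfolding openin_aut_top[OF Q] carrier_aut
  proof (rule conj_cong[OF refl], rule ball_cong[OF refl], rule bex_cong[OF refl])
    fix \<alpha> i assume "U \<subseteq> Aut E Q" "\<alpha> \<in> U" "i \<in> idx D"
    then have "aut_kernel Q i #>\<^bsub>A Q\<^esub> \<alpha> = {\<beta> \<in> Aut E Q. \<forall>x\<in>Q. \<beta> x i = \<alpha> x i}"
      using aut_kernel_coset[OF Q] by blast
    then show "{\<beta> \<in> Aut E Q. \<forall>x\<in>Q. \<beta> x i = \<alpha> x i} \<subseteq> U \<longleftrightarrow> aut_kernel Q i #>\<^bsub>A Q\<^esub> \<alpha> \<subseteq> U" by simp
  qed
qed

text \<open>The axiom that the morphism sets of \<open>E\<close> are closed enters here; this
  compactness is what Sylow conjugation in \<open>A Q\<close> relies on.\<close>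

lemma compact_aut: assumes Q: "cs Q" shows "compact_space (aut_top D E Q)"
proof -
  have "compactin (hom_top D Q Q) (pro_fusion D Q Q \<inter> E Q Q)"
    by (rule compact_Int_closedin[OF compactin_pro_fusion[OF Q Q] E_closedin(1)[OF Q Q]])
  moreover have "pro_fusion D Q Q \<inter> E Q Q = Aut E Q"
    using E_pro_fusion[OF Q Q] Aut_eq[OF Q] by blast
  ultimately show ?thesis by (simp add: aut_top_def compact_space_subtopology)
qed

subsection \<open>Normalizers and extension of isomorphisms\<close>

lemma norm_in_iff:
  assumes "cs Q"
  shows "g \<in> norm_in D T Q \<longleftrightarrow>
    g \<in> T \<and> (\<forall>x\<in>Q. g \<otimes>\<^bsub>S\<^esub> x \<otimes>\<^bsub>S\<^esub> inv\<^bsub>S\<^esub> g \<in> Q \<and> inv\<^bsub>S\<^esub> g \<otimes>\<^bsub>S\<^esub> x \<otimes>\<^bsub>S\<^esub> g \<in> Q)"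
  using mem_normalizer_iff[OF closed_subgroupD(1)[OF assms]] T_carrier by (auto simp: norm_in_def)

lemma norm_in_subgroup: assumes "cs Q" shows "subgroup (norm_in D T Q) S"
  unfolding norm_in_def
  by (rule subgroups_Inter_pair[OF T_subgroup normalizer_imp_subgroup[OF closed_subgroupD(3)[OF assms]]])

lemma norm_in_T: "g \<in> norm_in D T Q \<Longrightarrow> g \<in> T"
  by (simp add: norm_in_def)

lemma norm_in_carrier: "g \<in> norm_in D T Q \<Longrightarrow> g \<in> carrier S"
  using norm_in_T T_carrier by blast

lemma norm_in_conj: "cs Q \<Longrightarrow> g \<in> norm_in D T Q \<Longrightarrow> x \<in> Q \<Longrightarrow> g \<otimes>\<^bsub>S\<^esub> x \<otimes>\<^bsub>S\<^esub> inv\<^bsub>S\<^esub> g \<in> Q"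
  using norm_in_iff by blast

lemma conj_Aut:
  assumes Q: "cs Q" and g: "g \<in> norm_in D T Q"
  shows "conj_map S g Q \<in> Aut E Q"
  unfolding Aut_eq[OF Q]
  by (rule E_conj[OF Q Q norm_in_T[OF g]]) (use norm_in_conj[OF Q g] in \<open>auto simp: conj_map_def\<close>)

text \<open>For an isomorphism \<open>\<psi>\<close> from \<open>P\<close> to \<open>Q\<close> in \<open>E\<close>, the map \<open>g \<mapsto> \<psi> c\<^sub>g \<psi>\<^sup>-\<^sup>1\<close>; for \<open>\<psi>\<close> the identity of
  \<open>Q\<close> it is \<open>g \<mapsto> c\<^sub>g\<close>.\<close>

definition transport :: "('i \<Rightarrow> 'a) set \<Rightarrow> ('i \<Rightarrow> 'a) set \<Rightarrow> (('i \<Rightarrow> 'a) \<Rightarrow> 'i \<Rightarrow> 'a) \<Rightarrow> ('i \<Rightarrow> 'a) \<Rightarrow> (('i \<Rightarrow> 'a) \<Rightarrow> 'i \<Rightarrow> 'a)" where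
  "transport P Q \<psi> g = compose Q (compose P \<psi> (conj_map S g P)) (restrict (inv_into P \<psi>) Q)"

context
  fixes P Q \<psi>
  assumes P: "cs P" and Q: "cs Q" and \<psi>: "\<psi> \<in> Iso E P Q"
begin

lemma transport_Aut: "g \<in> norm_in D T P \<Longrightarrow> transport P Q \<psi> g \<in> Aut E Q"
  unfolding transport_def
  by (rule Iso_compose[OF Q P Q Iso_inverse[OF P Q \<psi>] Iso_compose[OF P P Q conj_Aut[OF P] \<psi>]])

lemma transport_apply:
  assumes "x \<in> P"
  shows "transport P Q \<psi> g (\<psi> x) = \<psi> (g \<otimes>\<^bsub>S\<^esub> x \<otimes>\<^bsub>S\<^esub> inv\<^bsub>S\<^esub> g)"
proof -
  have "inv_into P \<psi> (\<psi> x) = x" by (rule inv_into_f_f[OF E_inj[OF P Q Iso_E[OF \<psi>]] assms])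
  then show ?thesis using E_mem[OF P Q Iso_E[OF \<psi>] assms] assms
    by (simp add: transport_def compose_def conj_map_def)
qed

lemma Iso_surj: "y \<in> Q \<Longrightarrow> \<exists>x\<in>P. y = \<psi> x"
  using Iso_image[OF P Q \<psi>] by blast

lemma transport_hom: "group_hom (S\<lparr>carrier := norm_in D T P\<rparr>) (A Q) (transport P Q \<psi>)"
proof -
  interpret N: group "S\<lparr>carrier := norm_in D T P\<rparr>" using subgroup_imp_group[OF norm_in_subgroup[OF P]] .
  interpret A: group "A Q" using aut_group[OF Q] .
  have "transport P Q \<psi> (g \<otimes>\<^bsub>S\<^esub> h) = transport P Q \<psi> g \<otimes>\<^bsub>A Q\<^esub> transport P Q \<psi> h"
    if g: "g \<in> norm_in D T P" and h: "h \<in> norm_in D T P" for g h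
  proof (rule Aut_eqI[OF Q])
    have gh: "g \<otimes>\<^bsub>S\<^esub> h \<in> norm_in D T P" using subgroup.m_closed[OF norm_in_subgroup[OF P] g h] .
    show "transport P Q \<psi> (g \<otimes>\<^bsub>S\<^esub> h) \<in> Aut E Q" by (rule transport_Aut[OF gh])
    show "transport P Q \<psi> g \<otimes>\<^bsub>A Q\<^esub> transport P Q \<psi> h \<in> Aut E Q"
      using A.m_closed transport_Aut[OF g] transport_Aut[OF h] by simp
    fix y assume y: "y \<in> Q"
    then obtain x where x: "x \<in> P" "y = \<psi> x" using Iso_surj by blast
    have xc: "x \<in> carrier S" using x closed_subgroupD(3)[OF P] by blast
    show "transport P Q \<psi> (g \<otimes>\<^bsub>S\<^esub> h) y = (transport P Q \<psi> g \<otimes>\<^bsub>A Q\<^esub> transport P Q \<psi> h) y"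
      using y x transport_apply[OF x(1)] transport_apply[OF norm_in_conj[OF P h x(1)]]
        conj_conj[OF norm_in_carrier[OF g] norm_in_carrier[OF h] xc]
      by (simp add: aut_mult[OF Q transport_Aut[OF g] transport_Aut[OF h]] compose_def)
  qed
  then have "transport P Q \<psi> \<in> hom (S\<lparr>carrier := norm_in D T P\<rparr>) (A Q)"
    using transport_Aut by (simp add: hom_def)
  then show ?thesis by unfold_locales
qed

text \<open>For a suitable n the power g^(p^n) is trivial at level i, so conjugation by it is
  trivial there, and \<psi> respects agreement at level i.\<close>

lemma transport_p_elt:
  assumes g: "g \<in> norm_in D T P"
  shows "profinite_base.p_elt (A Q) (idx D) (aut_kernel Q) p (transport P Q \<psi> g)"
proof -
  interpret A: profinite_base "A Q" "aut_top D E Q" "idx D" "aut_kernel Q" by (rule profinite_aut[OF Q])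
  interpret h: group_hom "S\<lparr>carrier := norm_in D T P\<rparr>" "A Q" "transport P Q \<psi>" by (rule transport_hom)
  show ?thesis unfolding A.p_elt_def
  proof
    fix i assume i: "i \<in> idx D"
    have gc: "g \<in> carrier S" using norm_in_carrier[OF g] .
    obtain n where n: "g [^]\<^bsub>S\<^esub> (p ^ n) \<in> level_kernel i"
      using p_elt_lim[OF gc] i unfolding p_elt_def by blast
    let ?k = "g [^]\<^bsub>S\<^esub> (p ^ n)"
    have kN: "?k \<in> norm_in D T P" using subgroup_nat_pow_closed[OF norm_in_subgroup[OF P] g] .
    have eq: "transport P Q \<psi> g [^]\<^bsub>A Q\<^esub> (p ^ n) = transport P Q \<psi> ?k"
      using h.hom_nat_pow[of g "p ^ n"] g by (simp add: nat_pow_consistent[symmetric])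
    have "transport P Q \<psi> ?k y i = y i" if y: "y \<in> Q" for y
    proof -
      obtain x where x: "x \<in> P" "y = \<psi> x" using Iso_surj y by blast
      have xc: "x \<in> carrier S" using x closed_subgroupD(3)[OF P] by blast
      have kc: "?k \<in> carrier S" using gc by simp
      have "?k i = \<one>\<^bsub>S\<^esub> i" using mult_inv_in_level_kernel[OF i kc one_closed] n kc by simp
      then have "(?k \<otimes>\<^bsub>S\<^esub> x \<otimes>\<^bsub>S\<^esub> inv\<^bsub>S\<^esub> ?k) i = (\<one>\<^bsub>S\<^esub> \<otimes>\<^bsub>S\<^esub> x \<otimes>\<^bsub>S\<^esub> inv\<^bsub>S\<^esub> \<one>\<^bsub>S\<^esub>) i"
        using kc xc i by (simp only: nth_mult nth_inv inv_closed m_closed one_closed)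
      then have "(?k \<otimes>\<^bsub>S\<^esub> x \<otimes>\<^bsub>S\<^esub> inv\<^bsub>S\<^esub> ?k) i = x i" using xc by simp
      then show ?thesis
        using transport_apply[OF x(1), of ?k] x(2)
          E_level[OF P Q Iso_E[OF \<psi>] i norm_in_conj[OF P kN x(1)] x(1)] by simp
    qed
    then have "transport P Q \<psi> ?k \<in> aut_kernel Q i" using transport_Aut[OF kN] by (simp add: aut_kernel_def)
    then have "transport P Q \<psi> g [^]\<^bsub>A Q\<^esub> (p ^ n) \<in> aut_kernel Q i" by (simp only: eq)
    then show "\<exists>n::nat. transport P Q \<psi> g [^]\<^bsub>A Q\<^esub> (p ^ n) \<in> aut_kernel Q i" by (rule exI)
  qed
qed

end

lemma id_Iso: "cs Q \<Longrightarrow> (\<lambda>x\<in>Q. x) \<in> Iso E Q Q"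
  using E_id Aut_eq by blast

lemma transport_id:
  assumes Q: "cs Q" and g: "g \<in> norm_in D T Q"
  shows "transport Q Q (\<lambda>x\<in>Q. x) g = conj_map S g Q"
proof (rule Aut_eqI[OF Q transport_Aut[OF Q Q id_Iso[OF Q] g] conj_Aut[OF Q g]])
  fix x assume x: "x \<in> Q"
  show "transport Q Q (\<lambda>x\<in>Q. x) g x = conj_map S g Q x"
    using transport_apply[OF Q Q id_Iso[OF Q] x, of g] x norm_in_conj[OF Q g x] by (simp add: conj_map_def)
qed

lemma conj_p_elt:
  assumes "cs Q" "g \<in> norm_in D T Q"
  shows "profinite_base.p_elt (A Q) (idx D) (aut_kernel Q) p (conj_map S g Q)"
  using transport_p_elt[OF assms(1,1) id_Iso[OF assms(1)] assms(2)] transport_id[OF assms] by simp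

lemma conj_hom:
  assumes Q: "cs Q"
  shows "group_hom (S\<lparr>carrier := norm_in D T Q\<rparr>) (A Q) (\<lambda>g. conj_map S g Q)"
proof -
  interpret h: group_hom "S\<lparr>carrier := norm_in D T Q\<rparr>" "A Q" "transport Q Q (\<lambda>x\<in>Q. x)"
    by (rule transport_hom[OF Q Q id_Iso[OF Q]])
  have "(\<lambda>g. conj_map S g Q) \<in> hom (S\<lparr>carrier := norm_in D T Q\<rparr>) (A Q)"
  proof (rule homI)
    fix g h assume g: "g \<in> carrier (S\<lparr>carrier := norm_in D T Q\<rparr>)" and h: "h \<in> carrier (S\<lparr>carrier := norm_in D T Q\<rparr>)"
    then have "g \<otimes>\<^bsub>S\<^esub> h \<in> norm_in D T Q" using subgroup.m_closed[OF norm_in_subgroup[OF Q]] by simp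
    then show "conj_map S (g \<otimes>\<^bsub>S\<lparr>carrier := norm_in D T Q\<rparr>\<^esub> h) Q = conj_map S g Q \<otimes>\<^bsub>A Q\<^esub> conj_map S h Q"
      using h.hom_mult[OF g h] transport_id[OF Q] g h by simp
  qed (use conj_Aut[OF Q] in simp)
  then show ?thesis using h.group_hom_axioms by (simp add: group_hom_def group_hom_axioms_def)
qed

lemma subset_normalizer: "cs Q \<Longrightarrow> T \<inter> Q \<subseteq> norm_in D T Q"
  unfolding norm_in_iff subset_iff using closed_subgroupD(1)[of Q]
  by (simp add: norm_in_iff subgroup.m_closed subgroup.m_inv_closed)

lemma norm_in_Int: assumes Q: "cs Q" shows "norm_in D (T \<inter> Q) Q = T \<inter> Q"
  using subset_normalizer[OF Q] by (auto simp: norm_in_def)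

text \<open>\<alpha> c_t \<alpha>^-1 is conjugation by \<alpha>(t), and \<alpha> maps T \<inter> Q
  into itself by \<open>E_mem_T\<close>.\<close>

lemma Aut_by_Int_normal: assumes Q: "cs Q" shows "Aut_by D (T \<inter> Q) Q \<lhd> A Q"
proof -
  interpret A: group "A Q" using aut_group[OF Q] .
  interpret h: group_hom "S\<lparr>carrier := norm_in D T Q\<rparr>" "A Q" "\<lambda>g. conj_map S g Q" by (rule conj_hom[OF Q])
  have TQ: "subgroup (T \<inter> Q) S" by (rule subgroups_Inter_pair[OF T_subgroup closed_subgroupD(1)[OF Q]])
  have eq: "Aut_by D (T \<inter> Q) Q = (\<lambda>g. conj_map S g Q) ` (T \<inter> Q)"
    by (simp add: Aut_by_def norm_in_Int[OF Q])
  show ?thesis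
  proof (rule A.normal_invI)
    show "subgroup (Aut_by D (T \<inter> Q) Q) (A Q)"
      unfolding eq
      by (rule h.subgroup_img_is_subgroup[OF subgroup_incl[OF TQ norm_in_subgroup[OF Q] subset_normalizer[OF Q]]])
    fix \<alpha> \<beta> assume "\<alpha> \<in> carrier (A Q)" and \<beta>: "\<beta> \<in> Aut_by D (T \<inter> Q) Q"
    then have \<alpha>: "\<alpha> \<in> Aut E Q" by simp
    obtain t where t: "t \<in> T" "t \<in> Q" "\<beta> = conj_map S t Q" using \<beta> eq by auto
    have tN: "t \<in> norm_in D T Q" using t subset_normalizer[OF Q] by blast
    have \<alpha>t: "\<alpha> t \<in> T" "\<alpha> t \<in> Q" using E_mem_T[OF Q Q Iso_E[OF \<alpha>] t(2)] t Aut_mem[OF Q \<alpha>] by auto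
    have \<alpha>tN: "\<alpha> t \<in> norm_in D T Q" using \<alpha>t subset_normalizer[OF Q] by blast
    have ia: "inv\<^bsub>A Q\<^esub> \<alpha> \<in> Aut E Q" using A.inv_closed \<alpha> by simp
    have \<beta>A: "\<beta> \<in> Aut E Q" using conj_Aut[OF Q tN] t(3) by simp
    have ab: "\<alpha> \<otimes>\<^bsub>A Q\<^esub> \<beta> \<in> Aut E Q" using A.m_closed \<alpha> \<beta>A by simp
    have "\<alpha> \<otimes>\<^bsub>A Q\<^esub> \<beta> \<otimes>\<^bsub>A Q\<^esub> inv\<^bsub>A Q\<^esub> \<alpha> = conj_map S (\<alpha> t) Q"
    proof (rule Aut_eqI[OF Q _ conj_Aut[OF Q \<alpha>tN]])
      show "\<alpha> \<otimes>\<^bsub>A Q\<^esub> \<beta> \<otimes>\<^bsub>A Q\<^esub> inv\<^bsub>A Q\<^esub> \<alpha> \<in> Aut E Q" using A.m_closed ab ia by simp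
      fix x assume x: "x \<in> Q"
      let ?y = "(inv\<^bsub>A Q\<^esub> \<alpha>) x"
      have y: "?y \<in> Q" using Aut_mem[OF Q ia x] .
      have Qs: "subgroup Q S" using closed_subgroupD(1)[OF Q] .
      have ty: "t \<otimes>\<^bsub>S\<^esub> ?y \<in> Q" "inv\<^bsub>S\<^esub> t \<in> Q" using t(2) y Qs by (auto intro: subgroup.m_closed subgroup.m_inv_closed)
      have "(\<alpha> \<otimes>\<^bsub>A Q\<^esub> \<beta> \<otimes>\<^bsub>A Q\<^esub> inv\<^bsub>A Q\<^esub> \<alpha>) x = \<alpha> (\<beta> ?y)"
        unfolding aut_mult_apply[OF Q ab ia x] aut_mult_apply[OF Q \<alpha> \<beta>A y] ..
      also have "\<beta> ?y = t \<otimes>\<^bsub>S\<^esub> ?y \<otimes>\<^bsub>S\<^esub> inv\<^bsub>S\<^esub> t" using y by (simp add: t(3) conj_map_def)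
      also have "\<alpha> (t \<otimes>\<^bsub>S\<^esub> ?y \<otimes>\<^bsub>S\<^esub> inv\<^bsub>S\<^esub> t) = \<alpha> t \<otimes>\<^bsub>S\<^esub> \<alpha> ?y \<otimes>\<^bsub>S\<^esub> inv\<^bsub>S\<^esub> (\<alpha> t)"
        using E_mult[OF Q Q Iso_E[OF \<alpha>] ty] E_mult[OF Q Q Iso_E[OF \<alpha>] t(2) y] E_inv[OF Q Q Iso_E[OF \<alpha>] t(2)] by simp
      also have "\<alpha> ?y = x" by (rule aut_inv_apply(2)[OF Q \<alpha> x])
      finally show "(\<alpha> \<otimes>\<^bsub>A Q\<^esub> \<beta> \<otimes>\<^bsub>A Q\<^esub> inv\<^bsub>A Q\<^esub> \<alpha>) x = conj_map S (\<alpha> t) Q x"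
        using x by (simp add: conj_map_def)
    qed
    then show "\<alpha> \<otimes>\<^bsub>A Q\<^esub> \<beta> \<otimes>\<^bsub>A Q\<^esub> inv\<^bsub>A Q\<^esub> \<alpha> \<in> Aut_by D (T \<inter> Q) Q" using \<alpha>t eq by blast
  qed
qed

section \<open>The subgroup N_T(Q)Q and the domains of extensions\<close>

lemma norm_mult_subgroup:
  assumes Q: "cs Q"
  shows "subgroup (norm_mult D T Q) S" "Q \<subseteq> norm_mult D T Q" "norm_in D T Q \<subseteq> norm_mult D T Q"
proof -
  have Qs: "subgroup Q S" and Qc: "Q \<subseteq> carrier S" using closed_subgroupD[OF Q] by auto
  note N = norm_in_subgroup[OF Q]
  let ?M = "S\<lparr>carrier := normalizer S Q\<rparr>"
  have M: "subgroup (normalizer S Q) S" using normalizer_imp_subgroup[OF Qc] .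
  interpret M: group ?M using subgroup_imp_group[OF M] .
  have QM: "Q \<lhd> ?M" using subgroup_in_normalizer[OF Qs] .
  have NM: "subgroup (norm_in D T Q) ?M"
    by (rule subgroup_incl[OF N M]) (simp add: norm_in_def)
  have "subgroup (Q <#>\<^bsub>?M\<^esub> norm_in D T Q) ?M" using M.mult_norm_subgroup[OF QM NM] .
  then have "subgroup (norm_mult D T Q) ?M"
    using M.commut_normal[OF NM QM] by (simp add: norm_mult_def)
  then show "subgroup (norm_mult D T Q) S" using incl_subgroup[OF M] by blast
  show "Q \<subseteq> norm_mult D T Q"
  proof
    fix x assume x: "x \<in> Q"
    then have "\<one>\<^bsub>S\<^esub> \<otimes>\<^bsub>S\<^esub> x \<in> norm_mult D T Q"
      using subgroup.one_closed[OF N] unfolding norm_mult_def set_mult_def by blast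
    then show "x \<in> norm_mult D T Q" using x Qc by auto
  qed
  show "norm_in D T Q \<subseteq> norm_mult D T Q"
  proof
    fix x assume x: "x \<in> norm_in D T Q"
    then have "x \<otimes>\<^bsub>S\<^esub> \<one>\<^bsub>S\<^esub> \<in> norm_mult D T Q"
      using subgroup.one_closed[OF Qs] unfolding norm_mult_def set_mult_def by blast
    then show "x \<in> norm_mult D T Q" using norm_in_carrier[OF x] by simp
  qed
qed

lemma norm_mult_normalizes:
  assumes Q: "cs Q" and x: "x \<in> norm_mult D T Q"
  shows "x \<in> carrier S" "u \<in> Q \<Longrightarrow> x \<otimes>\<^bsub>S\<^esub> u \<otimes>\<^bsub>S\<^esub> inv\<^bsub>S\<^esub> x \<in> Q" "u \<in> Q \<Longrightarrow> inv\<^bsub>S\<^esub> x \<otimes>\<^bsub>S\<^esub> u \<otimes>\<^bsub>S\<^esub> x \<in> Q"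
proof -
  show xc: "x \<in> carrier S" using norm_mult_subgroup(1)[OF Q] x subgroup.mem_carrier by metis
  have conj: "x \<otimes>\<^bsub>S\<^esub> u \<otimes>\<^bsub>S\<^esub> inv\<^bsub>S\<^esub> x \<in> Q" if x: "x \<in> norm_mult D T Q" and u: "u \<in> Q" for x u
  proof -
    obtain g q where g: "g \<in> norm_in D T Q" and q: "q \<in> Q" and xg: "x = g \<otimes>\<^bsub>S\<^esub> q"
      using x unfolding norm_mult_def set_mult_def by blast
    have Qs: "subgroup Q S" using closed_subgroupD(1)[OF Q] .
    have "q \<otimes>\<^bsub>S\<^esub> u \<otimes>\<^bsub>S\<^esub> inv\<^bsub>S\<^esub> q \<in> Q" using q u Qs by (auto intro: subgroup.m_closed subgroup.m_inv_closed)
    then show ?thesis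
      using norm_in_conj[OF Q g] conj_conj[OF norm_in_carrier[OF g], of q u] q u subgroup.mem_carrier[OF Qs]
      unfolding xg by simp
  qed
  show "u \<in> Q \<Longrightarrow> x \<otimes>\<^bsub>S\<^esub> u \<otimes>\<^bsub>S\<^esub> inv\<^bsub>S\<^esub> x \<in> Q" using conj[OF x] .
  have "inv\<^bsub>S\<^esub> x \<in> norm_mult D T Q" using subgroup.m_inv_closed[OF norm_mult_subgroup(1)[OF Q] x] .
  then show "u \<in> Q \<Longrightarrow> inv\<^bsub>S\<^esub> x \<otimes>\<^bsub>S\<^esub> u \<otimes>\<^bsub>S\<^esub> x \<in> Q" using conj[of "inv\<^bsub>S\<^esub> x" u] xc by simp
qed

text \<open>The witnesses y multiply and invert along with x, and \<phi> x is a witness for x in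
  \<open>R\<close>.\<close>

lemma ext_domain_subgroup:
  assumes R: "cs R" and Q: "cs Q" and \<phi>: "\<phi> \<in> Iso E R Q"
  shows "subgroup (ext_domain D T R Q \<phi>) S" "R \<subseteq> ext_domain D T R Q \<phi>"
proof -
  let ?X = "ext_domain D T R Q \<phi>"
  note NR = norm_mult_subgroup[OF R] and NQ = norm_mult_subgroup[OF Q]
  have Rs: "subgroup R S" and Rc: "R \<subseteq> carrier S" using closed_subgroupD[OF R] by auto
  have Qc: "Q \<subseteq> carrier S" using closed_subgroupD(3)[OF Q] .
  note \<phi>Q = E_mem[OF R Q Iso_E[OF \<phi>]]
  show RX: "R \<subseteq> ?X"
  proof
    fix x assume x: "x \<in> R"
    have "\<phi> (x \<otimes>\<^bsub>S\<^esub> u \<otimes>\<^bsub>S\<^esub> inv\<^bsub>S\<^esub> x) = \<phi> x \<otimes>\<^bsub>S\<^esub> \<phi> u \<otimes>\<^bsub>S\<^esub> inv\<^bsub>S\<^esub> (\<phi> x)" if u: "u \<in> R" for u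
      using E_mult[OF R Q Iso_E[OF \<phi>], of "x \<otimes>\<^bsub>S\<^esub> u" "inv\<^bsub>S\<^esub> x"] E_mult[OF R Q Iso_E[OF \<phi>] x u]
        E_inv[OF R Q Iso_E[OF \<phi>] x] x u Rs by (simp add: subgroup.m_closed subgroup.m_inv_closed)
    then show "x \<in> ?X" using x NR(2) NQ(2) \<phi>Q[OF x] unfolding ext_domain_def by blast
  qed
  show "subgroup ?X S"
  proof (rule subgroupI)
    show "?X \<subseteq> carrier S" using norm_mult_normalizes(1)[OF R] unfolding ext_domain_def by blast
    show "?X \<noteq> {}" using RX subgroup.one_closed[OF Rs] by blast
    fix x assume "x \<in> ?X"
    then obtain y where x: "x \<in> norm_mult D T R" and y: "y \<in> norm_mult D T Q"
      and xy: "\<And>u. u \<in> R \<Longrightarrow> \<phi> (x \<otimes>\<^bsub>S\<^esub> u \<otimes>\<^bsub>S\<^esub> inv\<^bsub>S\<^esub> x) = y \<otimes>\<^bsub>S\<^esub> \<phi> u \<otimes>\<^bsub>S\<^esub> inv\<^bsub>S\<^esub> y"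
      unfolding ext_domain_def by blast
    have xc: "x \<in> carrier S" and yc: "y \<in> carrier S"
      using norm_mult_normalizes(1)[OF R x] norm_mult_normalizes(1)[OF Q y] .
    have "\<phi> (inv\<^bsub>S\<^esub> x \<otimes>\<^bsub>S\<^esub> u \<otimes>\<^bsub>S\<^esub> inv\<^bsub>S\<^esub> (inv\<^bsub>S\<^esub> x)) = inv\<^bsub>S\<^esub> y \<otimes>\<^bsub>S\<^esub> \<phi> u \<otimes>\<^bsub>S\<^esub> inv\<^bsub>S\<^esub> (inv\<^bsub>S\<^esub> y)"
      if u: "u \<in> R" for u
    proof -
      let ?v = "inv\<^bsub>S\<^esub> x \<otimes>\<^bsub>S\<^esub> u \<otimes>\<^bsub>S\<^esub> x"
      have uc: "u \<in> carrier S" using u Rc by blast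
      have v: "?v \<in> R" using norm_mult_normalizes(3)[OF R x u] .
      have vc: "\<phi> ?v \<in> carrier S" using \<phi>Q[OF v] Qc by blast
      have "\<phi> u = y \<otimes>\<^bsub>S\<^esub> \<phi> ?v \<otimes>\<^bsub>S\<^esub> inv\<^bsub>S\<^esub> y" using xy[OF v] conj_cancel(2)[OF xc uc] by simp
      then show ?thesis using conj_cancel(1)[OF yc vc] xc yc by simp
    qed
    then show "inv\<^bsub>S\<^esub> x \<in> ?X"
      using subgroup.m_inv_closed[OF NR(1) x] subgroup.m_inv_closed[OF NQ(1) y]
      unfolding ext_domain_def by blast
    fix x' assume "x' \<in> ?X"
    then obtain y' where x': "x' \<in> norm_mult D T R" and y': "y' \<in> norm_mult D T Q"
      and xy': "\<And>u. u \<in> R \<Longrightarrow> \<phi> (x' \<otimes>\<^bsub>S\<^esub> u \<otimes>\<^bsub>S\<^esub> inv\<^bsub>S\<^esub> x') = y' \<otimes>\<^bsub>S\<^esub> \<phi> u \<otimes>\<^bsub>S\<^esub> inv\<^bsub>S\<^esub> y'"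
      unfolding ext_domain_def by blast
    have xc': "x' \<in> carrier S" and yc': "y' \<in> carrier S"
      using norm_mult_normalizes(1)[OF R x'] norm_mult_normalizes(1)[OF Q y'] .
    have "\<phi> ((x \<otimes>\<^bsub>S\<^esub> x') \<otimes>\<^bsub>S\<^esub> u \<otimes>\<^bsub>S\<^esub> inv\<^bsub>S\<^esub> (x \<otimes>\<^bsub>S\<^esub> x')) = (y \<otimes>\<^bsub>S\<^esub> y') \<otimes>\<^bsub>S\<^esub> \<phi> u \<otimes>\<^bsub>S\<^esub> inv\<^bsub>S\<^esub> (y \<otimes>\<^bsub>S\<^esub> y')"
      if u: "u \<in> R" for u
    proof -
      have uc: "u \<in> carrier S" using u Rc by blast
      have uc': "\<phi> u \<in> carrier S" using \<phi>Q[OF u] Qc by blast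
      show ?thesis
        unfolding conj_conj[OF xc xc' uc] conj_conj[OF yc yc' uc']
          xy[OF norm_mult_normalizes(2)[OF R x' u]] xy'[OF u] ..
    qed
    then show "x \<otimes>\<^bsub>S\<^esub> x' \<in> ?X"
      using subgroup.m_closed[OF NR(1) x x'] subgroup.m_closed[OF NQ(1) y y']
      unfolding ext_domain_def by blast
  qed
qed

lemma open_subgroup_superset:
  assumes "open_subgroup D P" "subgroup X' S" "P \<subseteq> X'"
  shows "open_subgroup D X'"
  using open_supergroup[OF open_subgroupD[OF assms(1)] assms(2,3)] assms(2) by (simp add: open_subgroup_def)

text \<open>Receptivity only promises an extension into N_T(Q)Q. Its image is again open, being
  isomorphic to an open subgroup, so the extension becomes an isomorphism to which the induction
  applies.\<close>

lemma receptive_extension: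
  assumes rec: "receptive D T E Q" and R: "open_subgroup D R" and Q: "open_subgroup D Q"
    and \<phi>: "\<phi> \<in> Iso E R Q"
  obtains X' Q' \<phi>' where "X' = ext_domain D T R Q \<phi>" "open_subgroup D X'" "R \<subseteq> X'" "open_subgroup D Q'"
    "\<phi>' \<in> Iso E X' Q'" "restrict \<phi>' R = \<phi>"
proof -
  let ?X = "ext_domain D T R Q \<phi>"
  have cR: "cs R" and cQ: "cs Q" using open_closed_subgroup R Q by auto
  note X = ext_domain_subgroup[OF cR cQ \<phi>]
  have oX: "open_subgroup D ?X" by (rule open_subgroup_superset[OF R X])
  have cX: "cs ?X" using open_closed_subgroup[OF oX] .
  have oN: "open_subgroup D (norm_mult D T Q)"
    by (rule open_subgroup_superset[OF Q norm_mult_subgroup(1,2)[OF cQ]])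
  have cN: "cs (norm_mult D T Q)" using open_closed_subgroup[OF oN] .
  obtain \<phi>' where \<phi>': "\<phi>' \<in> E ?X (norm_mult D T Q)" "restrict \<phi>' R = \<phi>"
    using rec cR \<phi> unfolding receptive_def by blast
  note im = E_image[OF cX cN \<phi>'(1)]
  show thesis by (rule that[OF refl oX X(2) Iso_index(1)[OF oX im] im(2) \<phi>'(2)])
qed

subsection \<open>Decomposable isomorphisms\<close>

text \<open>Chains are nonempty and grow at the target. The predicate hides the sequences, so that
  restriction, composition and reversal become plain inductions;
  \<open>decomposable_sequence\<close> recovers them.\<close>

inductive decomposable :: "('i \<Rightarrow> 'a) set \<Rightarrow> ('i \<Rightarrow> 'a) set \<Rightarrow> (('i \<Rightarrow> 'a) \<Rightarrow> 'i \<Rightarrow> 'a) \<Rightarrow> bool" where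
  base: "open_subgroup D P \<Longrightarrow> open_subgroup D Q \<Longrightarrow> essential p D T E Q \<Longrightarrow> fully_normalized p D T E Q \<Longrightarrow>
    \<alpha> \<in> Aut E Q \<Longrightarrow> P \<subseteq> Q \<Longrightarrow> decomposable P (\<alpha> ` P) (restrict \<alpha> P)"
| step: "decomposable P P' \<phi> \<Longrightarrow> open_subgroup D Q \<Longrightarrow> essential p D T E Q \<Longrightarrow> fully_normalized p D T E Q \<Longrightarrow>
    \<alpha> \<in> Aut E Q \<Longrightarrow> P' \<subseteq> Q \<Longrightarrow> decomposable P (\<alpha> ` P') (compose P \<alpha> \<phi>)"

lemma restrict_Iso:
  assumes "open_subgroup D P" "open_subgroup D Q" "cs R" "P \<subseteq> Q" "\<phi> \<in> E Q R"
  shows "restrict \<phi> P \<in> Iso E P (\<phi> ` P)" "open_subgroup D (\<phi> ` P)"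
proof -
  have c: "cs P" "cs Q" using open_closed_subgroup assms by auto
  have im: "restrict \<phi> P ` P = \<phi> ` P" by auto
  note E_image[OF c(1) assms(3) E_restrict[OF c(2) assms(3) c(1) assms(4,5)], unfolded im]
  then show "restrict \<phi> P \<in> Iso E P (\<phi> ` P)" "open_subgroup D (\<phi> ` P)"
    using Iso_index(1)[OF assms(1)] by auto
qed

lemma decomposable_Iso:
  assumes "decomposable P P' \<phi>"
  shows "open_subgroup D P \<and> open_subgroup D P' \<and> \<phi> \<in> Iso E P P'"
  using assms
proof induction
  case (base P Q \<alpha>)
  show ?case using restrict_Iso[OF base(1,2) open_closed_subgroup[OF base(2)] base(6) Iso_E[OF base(5)]] base(1) by blast
next
  case (step P P' \<phi> Q \<alpha>)
  then have c: "cs P" "cs P'" using open_closed_subgroup by auto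
  have P': "open_subgroup D P'" and \<phi>: "\<phi> \<in> Iso E P P'" using step.IH by auto
  note r = restrict_Iso[OF P' step(2) open_closed_subgroup[OF step(2)] step(6) Iso_E[OF step(5)]]
  have "compose P (restrict \<alpha> P') \<phi> = compose P \<alpha> \<phi>"
    using E_mem[OF c Iso_E[OF \<phi>]] by (auto simp: compose_def fun_eq_iff)
  then show ?case using Iso_compose[OF c open_closed_subgroup[OF r(2)] \<phi> r(1)] r(2) step.IH by simp
qed

lemma decomposable_trans:
  assumes "decomposable P' P'' \<psi>" "decomposable P P' \<phi>"
  shows "decomposable P P'' (compose P \<psi> \<phi>)"
  using assms
proof (induction arbitrary: P \<phi>)
  case (base P' Q \<alpha>)
  have "\<And>x. x \<in> P \<Longrightarrow> \<phi> x \<in> P'"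
    using decomposable_Iso[OF base.prems] open_closed_subgroup E_mem[OF _ _ Iso_E] by blast
  then have eq: "compose P (restrict \<alpha> P') \<phi> = compose P \<alpha> \<phi>" by (auto simp: compose_def fun_eq_iff)
  show ?case unfolding eq by (rule decomposable.step[OF base.prems base(2-6)])
next
  case (step P' P'' \<psi> Q \<alpha>)
  have "\<And>x. x \<in> P \<Longrightarrow> \<phi> x \<in> P'"
    using decomposable_Iso[OF step.prems] open_closed_subgroup E_mem[OF _ _ Iso_E] by blast
  then have eq: "compose P (compose P' \<alpha> \<psi>) \<phi> = compose P \<alpha> (compose P \<psi> \<phi>)"
    by (auto simp: compose_def fun_eq_iff)
  show ?case unfolding eq by (rule decomposable.step[OF step.IH[OF step.prems] step(2-6)])
qed

text \<open>The essential subgroups and automorphisms stay the same and only the chain of subgroups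
  shrinks. This turns a decomposition of an extension into one of the original map.\<close>

lemma decomposable_restrict:
  assumes "decomposable P P' \<phi>" "open_subgroup D R" "R \<subseteq> P"
  shows "decomposable R (\<phi> ` R) (restrict \<phi> R)"
  using assms
proof (induction arbitrary: R)
  case (base P Q \<alpha>)
  have eq: "restrict \<alpha> P ` R = \<alpha> ` R" "restrict (restrict \<alpha> P) R = restrict \<alpha> R"
    using base.prems(2) by (auto simp: fun_eq_iff)
  show ?case unfolding eq
    by (rule decomposable.base[OF base.prems(1) base(2-5) subset_trans[OF base.prems(2) base(6)]])
next
  case (step P P' \<phi> Q \<alpha>)
  have "\<phi> ` P = P'"
    using decomposable_Iso[OF step(1)] open_closed_subgroup Iso_image by blast
  then have sub: "\<phi> ` R \<subseteq> Q" using step.prems(2) step(6) by blast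
  have im: "compose P \<alpha> \<phi> ` R = \<alpha> ` \<phi> ` R" unfolding image_image
    by (rule image_cong[OF refl]) (use step.prems(2) in \<open>auto simp: compose_def\<close>)
  have eq: "restrict (compose P \<alpha> \<phi>) R = compose R \<alpha> (restrict \<phi> R)"
    using step.prems(2) by (auto simp: compose_def fun_eq_iff)
  show ?case unfolding im eq by (rule decomposable.step[OF step.IH[OF step.prems] step(2-5) sub])
qed

text \<open>Since chains grow only at the target, reversing one means putting the inverse of its
  last step in front, by \<open>decomposable_trans\<close>.\<close>

lemma decomposable_inverse:
  assumes "decomposable P P' \<phi>"
  shows "decomposable P' P (restrict (inv_into P \<phi>) P')"
  using assms
proof induction
  case (base P Q \<alpha>)
  have cQ: "cs Q" using open_closed_subgroup[OF base(2)] .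
  let ?\<beta> = "restrict (inv_into Q \<alpha>) Q"
  have \<beta>: "?\<beta> \<in> Aut E Q" using Iso_inverse[OF cQ cQ base(5)] .
  note injQ = E_inj[OF cQ cQ Iso_E[OF base(5)]]
  have injP: "inj_on \<alpha> P" using injQ base(6) inj_on_subset by blast
  have sub: "\<alpha> ` P \<subseteq> Q" using Iso_image[OF cQ cQ base(5)] base(6) by blast
  have o: "open_subgroup D (\<alpha> ` P)"
    using restrict_Iso(2)[OF base(1,2) cQ base(6) Iso_E[OF base(5)]] .
  have b: "?\<beta> (\<alpha> x) = x" if "x \<in> P" for x using that sub base(6) injQ by (auto simp: inv_into_f_f)
  then have im: "?\<beta> ` \<alpha> ` P = P" by (simp add: image_image del: restrict_apply)
  have eq: "restrict ?\<beta> (\<alpha> ` P) = restrict (inv_into P (restrict \<alpha> P)) (\<alpha> ` P)"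
  proof (rule restrict_ext)
    fix y assume "y \<in> \<alpha> ` P"
    then obtain x where x: "x \<in> P" "y = \<alpha> x" by blast
    have "inv_into P (restrict \<alpha> P) (restrict \<alpha> P x) = x"
      using injP x(1) by (intro inv_into_f_f) (auto simp: inj_on_def)
    then show "?\<beta> y = inv_into P (restrict \<alpha> P) y" using b[OF x(1)] x by simp
  qed
  show ?case using decomposable.base[OF o base(2-4) \<beta> sub] unfolding im eq .
next
  case (step P P' \<phi> Q \<alpha>)
  have cQ: "cs Q" using open_closed_subgroup[OF step(2)] .
  have oP': "open_subgroup D P'" and c: "cs P" "cs P'" and \<phi>: "\<phi> \<in> Iso E P P'"
    using decomposable_Iso[OF step(1)] open_closed_subgroup by auto
  let ?\<beta> = "restrict (inv_into Q \<alpha>) Q"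
  have \<beta>: "?\<beta> \<in> Aut E Q" using Iso_inverse[OF cQ cQ step(5)] .
  note injQ = E_inj[OF cQ cQ Iso_E[OF step(5)]]
  note injP = E_inj[OF c Iso_E[OF \<phi>]]
  have im: "\<phi> ` P = P'" using Iso_image[OF c \<phi>] .
  have sub: "\<alpha> ` P' \<subseteq> Q" using Iso_image[OF cQ cQ step(5)] step(6) by blast
  have o: "open_subgroup D (\<alpha> ` P')"
    using restrict_Iso(2)[OF oP' step(2) cQ step(6) Iso_E[OF step(5)]] .
  have b: "?\<beta> (\<alpha> x) = x" if "x \<in> P'" for x using that sub step(6) injQ by (auto simp: inv_into_f_f)
  then have bim: "?\<beta> ` \<alpha> ` P' = P'" by (simp add: image_image del: restrict_apply)
  have first: "decomposable (\<alpha> ` P') P' (restrict ?\<beta> (\<alpha> ` P'))"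
    using decomposable.base[OF o step(2-4) \<beta> sub] unfolding bim .
  have eq: "compose (\<alpha> ` P') (restrict (inv_into P \<phi>) P') (restrict ?\<beta> (\<alpha> ` P')) =
      restrict (inv_into P (compose P \<alpha> \<phi>)) (\<alpha> ` P')"
    unfolding compose_def
  proof (rule restrict_ext)
    fix y assume y: "y \<in> \<alpha> ` P'"
    then obtain x where x: "x \<in> P" "y = \<alpha> (\<phi> x)" using im by blast
    have xP': "\<phi> x \<in> P'" using x(1) im by blast
    have inj: "inj_on (\<lambda>x\<in>P. \<alpha> (\<phi> x)) P"
    proof (rule inj_onI)
      fix u v assume uv: "u \<in> P" "v \<in> P" "(\<lambda>x\<in>P. \<alpha> (\<phi> x)) u = (\<lambda>x\<in>P. \<alpha> (\<phi> x)) v"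
      then have "\<phi> u \<in> P'" "\<phi> v \<in> P'" using im by auto
      then have "\<phi> u = \<phi> v" using uv step(6) inj_onD[OF injQ, of "\<phi> u" "\<phi> v"] by auto
      then show "u = v" using inj_onD[OF injP] uv by blast
    qed
    have "inv_into P (\<lambda>x\<in>P. \<alpha> (\<phi> x)) ((\<lambda>x\<in>P. \<alpha> (\<phi> x)) x) = x" by (rule inv_into_f_f[OF inj x(1)])
    then show "restrict (inv_into P \<phi>) P' (restrict ?\<beta> (\<alpha> ` P') y) = inv_into P (\<lambda>x\<in>P. \<alpha> (\<phi> x)) y"
      using b[OF xP'] xP' x y inv_into_f_f[OF injP x(1)] by simp
  qed
  show ?case using decomposable_trans[OF step.IH first] unfolding eq .
qed

text \<open>\<open>fold\<close> over \<open>[1..<Suc n]\<close> applies the automorphism of index 1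
  first and that of index n last, as in the composite \<phi>_n ... \<phi>_1.\<close>

lemma decomposable_sequence:
  assumes "decomposable P P' \<phi>"
  shows "\<exists>(n :: nat) Ps Qs \<phi>s.
      n \<ge> 1 \<and> Ps 0 = P \<and> Ps n = P' \<and>
      (\<forall>i\<in>{0..n}. open_subgroup D (Ps i)) \<and>
      (\<forall>i\<in>{1..n}. open_subgroup D (Qs i) \<and> \<phi>s i \<in> Aut E (Qs i)) \<and>
      (\<forall>i\<in>{1..n}. essential p D T E (Qs i) \<and> fully_normalized p D T E (Qs i)) \<and>
      (\<forall>i\<in>{1..n}. Ps (i - 1) \<subseteq> Qs i \<and> Ps i \<subseteq> Qs i \<and> \<phi>s i ` Ps (i - 1) = Ps i) \<and>
      (\<forall>u\<in>P. \<phi> u = fold \<phi>s [1..<Suc n] u)"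
  using assms
proof induction
  case (base P Q \<alpha>)
  have cQ: "cs Q" using open_closed_subgroup[OF base(2)] .
  have sub: "\<alpha> ` P \<subseteq> Q" using Iso_image[OF cQ cQ base(5)] base(6) by blast
  have o: "open_subgroup D (\<alpha> ` P)"
    using restrict_Iso(2)[OF base(1,2) cQ base(6) Iso_E[OF base(5)]] .
  show ?case
    by (rule exI[of _ 1], rule exI[of _ "\<lambda>i. if i = 0 then P else \<alpha> ` P"],
        rule exI[of _ "\<lambda>_. Q"], rule exI[of _ "\<lambda>_. \<alpha>"])
      (use base sub o in auto)
next
  case (step P P' \<phi> Q \<alpha>)
  have cQ: "cs Q" using open_closed_subgroup[OF step(2)] .
  have sub: "\<alpha> ` P' \<subseteq> Q" using Iso_image[OF cQ cQ step(5)] step(6) by blast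
  have o: "open_subgroup D (\<alpha> ` P')"
    using restrict_Iso(2)[OF _ step(2) cQ step(6) Iso_E[OF step(5)]] decomposable_Iso[OF step(1)] by blast
  obtain n :: nat and Ps Qs \<phi>s where n: "n \<ge> 1" and P0: "Ps 0 = P" and Pn: "Ps n = P'"
    and oP: "\<forall>i\<in>{0..n}. open_subgroup D (Ps i)"
    and oQ: "\<forall>i\<in>{1..n}. open_subgroup D (Qs i) \<and> \<phi>s i \<in> Aut E (Qs i)"
    and ess: "\<forall>i\<in>{1..n}. essential p D T E (Qs i) \<and> fully_normalized p D T E (Qs i)"
    and inc: "\<forall>i\<in>{1..n}. Ps (i - 1) \<subseteq> Qs i \<and> Ps i \<subseteq> Qs i \<and> \<phi>s i ` Ps (i - 1) = Ps i"
    and fold: "\<forall>u\<in>P. \<phi> u = fold \<phi>s [1..<Suc n] u"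
    using step.IH by (elim exE conjE) (rule that)
  let ?Ps = "Ps(Suc n := \<alpha> ` P')" and ?Qs = "Qs(Suc n := Q)" and ?\<phi>s = "\<phi>s(Suc n := \<alpha>)"
  have cong: "fold ?\<phi>s [1..<Suc n] u = fold \<phi>s [1..<Suc n] u" for u
    by (rule fold_cong) auto
  have "fold ?\<phi>s [1..<Suc (Suc n)] u = \<alpha> (fold \<phi>s [1..<Suc n] u)" for u
    using cong[of u] by simp
  then have "\<forall>u\<in>P. compose P \<alpha> \<phi> u = fold ?\<phi>s [1..<Suc (Suc n)] u"
    using fold by (simp add: compose_def del: upt_Suc)
  moreover have "\<forall>i\<in>{1..Suc n}. ?Ps (i - 1) \<subseteq> ?Qs i \<and> ?Ps i \<subseteq> ?Qs i \<and> ?\<phi>s i ` ?Ps (i - 1) = ?Ps i"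
  proof
    fix i assume i: "i \<in> {1..Suc n}"
    show "?Ps (i - 1) \<subseteq> ?Qs i \<and> ?Ps i \<subseteq> ?Qs i \<and> ?\<phi>s i ` ?Ps (i - 1) = ?Ps i"
      using i inc sub step(6) Pn by (cases "i = Suc n") auto
  qed
  moreover have "\<forall>i\<in>{0..Suc n}. open_subgroup D (?Ps i)"
    using oP o by (auto simp: le_Suc_eq)
  moreover have "\<forall>i\<in>{1..Suc n}. open_subgroup D (?Qs i) \<and> ?\<phi>s i \<in> Aut E (?Qs i)"
    using oQ step(2,5) by (auto simp: le_Suc_eq)
  moreover have "\<forall>i\<in>{1..Suc n}. essential p D T E (?Qs i) \<and> fully_normalized p D T E (?Qs i)"
    using ess step(3,4) by (auto simp: le_Suc_eq)
  moreover have "Suc n \<ge> 1" "?Ps 0 = P" "?Ps (Suc n) = \<alpha> ` P'" using P0 by simp_all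
  ultimately show ?case by blast
qed

text \<open>A point of the extension domain outside \<open>R\<close> makes the domain of the
  extension strictly larger, hence of smaller index. \<open>IH\<close> decomposes the extension, and
  restriction to \<open>R\<close> recovers \<phi>.\<close>

lemma decomposable_of_extension:
  assumes IH: "\<forall>P P' \<phi>. open_subgroup D P \<longrightarrow> open_subgroup D P' \<longrightarrow> card (rcosets\<^bsub>S\<^esub> P) < n \<longrightarrow>
      \<phi> \<in> Iso E P P' \<longrightarrow> decomposable P P' \<phi>"
    and rec: "receptive D T E Q" and R: "open_subgroup D R" and Q: "open_subgroup D Q"
    and n: "card (rcosets\<^bsub>S\<^esub> R) = n" and \<phi>: "\<phi> \<in> Iso E R Q"
    and x: "x \<in> ext_domain D T R Q \<phi>" "x \<notin> R"
  shows "decomposable R Q \<phi>"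
proof -
  obtain X' Q' \<phi>' where X: "X' = ext_domain D T R Q \<phi>" "open_subgroup D X'" "R \<subseteq> X'" "open_subgroup D Q'"
    "\<phi>' \<in> Iso E X' Q'" "restrict \<phi>' R = \<phi>" by (rule receptive_extension[OF rec R Q \<phi>])
  have "R \<subset> X'" using X(1,3) x by blast
  then have "card (rcosets\<^bsub>S\<^esub> X') < n"
    using card_rcosets_less[OF open_subgroupD(1)[OF R] open_subgroupD(1)[OF X(2)]]
      open_subgroup_finite_index[OF open_subgroupD[OF R]] n by blast
  from decomposable_restrict[OF IH[rule_format, OF X(2,4) this X(5)] R X(3)]
  have "decomposable R (\<phi>' ` R) \<phi>" unfolding X(6) .
  moreover have "\<phi>' ` R = Q"
    using Iso_image[OF open_closed_subgroup[OF R] open_closed_subgroup[OF Q] \<phi>] unfolding X(6)[symmetric]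
    by simp
  ultimately show ?thesis by simp
qed

section \<open>Proper extensions over a fully normalized subgroup\<close>

lemma fully_normalizedD:
  assumes "fully_normalized p D T E Q"
  shows "receptive D T E Q" "subgroup (Aut_by D T Q) (A Q)" "closedin (aut_top D E Q) (Aut_by D T Q)"
    "\<And>N. N \<lhd> A Q \<Longrightarrow> openin (aut_top D E Q) N \<Longrightarrow> \<not> p dvd card (rcosets\<^bsub>A Q\<^esub> (Aut_by D T Q <#>\<^bsub>A Q\<^esub> N))"
  using assms unfolding fully_normalized_def sylow_pro_p_def pro_p_subgroup_def by blast+

lemma Aut_by_index:
  assumes Q: "cs Q" and fn: "fully_normalized p D T E Q" and i: "i \<in> idx D"
  shows "\<not> p dvd card (rcosets\<^bsub>A Q\<^esub> (Aut_by D T Q <#>\<^bsub>A Q\<^esub> aut_kernel Q i))"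
proof -
  interpret A: profinite_base "A Q" "aut_top D E Q" "idx D" "aut_kernel Q" by (rule profinite_aut[OF Q])
  show ?thesis
    using fully_normalizedD(4)[OF fn A.K_normal[OF i]] A.open_subgroup_iff[OF A.K_subgroup[OF i]] i by blast
qed

text \<open>For x in \<open>P\<close> the image is t x with t in T \<subseteq> P, so the image of
  \<open>P\<close> lies in \<open>P\<close>; and an endomorphism is onto.\<close>

lemma T_le_iso:
  assumes P: "cs P" and P': "cs P'" and "T \<subseteq> P" and \<phi>: "\<phi> \<in> Iso E P P'"
  shows "P' = P"
proof -
  have "\<phi> x \<in> P" if x: "x \<in> P" for x
  proof -
    have c: "x \<in> carrier S" "\<phi> x \<in> carrier S"
      using x closed_subgroupD(3)[OF P] E_mem[OF P P' Iso_E[OF \<phi>] x] closed_subgroupD(3)[OF P'] by auto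
    have "\<phi> x \<otimes>\<^bsub>S\<^esub> inv\<^bsub>S\<^esub> x \<in> P" using E_moves_by_T[OF P P' Iso_E[OF \<phi>] x] assms(3) by blast
    then have "\<phi> x \<otimes>\<^bsub>S\<^esub> inv\<^bsub>S\<^esub> x \<otimes>\<^bsub>S\<^esub> x \<in> P" using x subgroup.m_closed[OF closed_subgroupD(1)[OF P]] by blast
    then show ?thesis using c by (simp add: m_assoc)
  qed
  then have sub: "P' \<subseteq> P" using Iso_image[OF P P' \<phi>] by blast
  have "\<phi> ` P = P" by (rule E_endo_surj[OF P E_codomain[OF P P' P sub Iso_E[OF \<phi>]]])
  then show ?thesis using Iso_image[OF P P' \<phi>] by simp
qed

lemma exists_normalizing:
  assumes P: "open_subgroup D P" and "\<not> T \<subseteq> P"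
  shows "\<exists>t. t \<in> norm_in D T P \<and> t \<notin> P"
proof -
  have cP: "cs P" using open_closed_subgroup[OF P] .
  have "\<exists>t\<in>T - P. \<forall>h\<in>P. t \<otimes>\<^bsub>S\<^esub> h \<otimes>\<^bsub>S\<^esub> inv\<^bsub>S\<^esub> t \<in> P \<and> inv\<^bsub>S\<^esub> t \<otimes>\<^bsub>S\<^esub> h \<otimes>\<^bsub>S\<^esub> t \<in> P"
    by (rule normalizer_growth[OF prime open_subgroupD[OF P] T_subgroup _ p_elt_lim assms(2)])
      (use T_normal closed_subgroupD(3)[OF cP] in auto)
  then show ?thesis using norm_in_iff[OF cP] by blast
qed

text \<open>Choose \<open>\<alpha>\<close> conjugating the pro-\<open>p\<close> group \<open>\<psi> Aut\<^sub>T(P) \<psi>\<^sup>-\<^sup>1\<close> into the Sylow subgroup \<open>Aut\<^sub>T(Q)\<close>.\<close>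

lemma exists_full_extension:
  assumes P: "cs P" and Q: "cs Q" and fn: "fully_normalized p D T E Q" and \<psi>: "\<psi> \<in> Iso E P Q"
  shows "\<exists>\<alpha>\<in>Aut E Q. norm_in D T P \<subseteq> ext_domain D T P Q (compose P \<alpha> \<psi>)"
proof -
  interpret A: profinite_base "A Q" "aut_top D E Q" "idx D" "aut_kernel Q" by (rule profinite_aut[OF Q])
  interpret h: group_hom "S\<lparr>carrier := norm_in D T P\<rparr>" "A Q" "transport P Q \<psi>" by (rule transport_hom[OF P Q \<psi>])
  note fnD = fully_normalizedD[OF fn]
  let ?H = "transport P Q \<psi> ` norm_in D T P"
  have H: "subgroup ?H (A Q)" using h.img_is_subgroup by simp
  have "\<exists>\<alpha>\<in>carrier (A Q). \<forall>\<beta>\<in>?H. \<alpha> \<otimes>\<^bsub>A Q\<^esub> \<beta> \<otimes>\<^bsub>A Q\<^esub> inv\<^bsub>A Q\<^esub> \<alpha> \<in> Aut_by D T Q"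
    by (rule A.sylow_conjugation[OF prime compact_aut[OF Q] fnD(2,3) Aut_by_index[OF Q fn] H])
      (use transport_p_elt[OF P Q \<psi>] in auto)
  then obtain \<alpha> where \<alpha>: "\<alpha> \<in> Aut E Q"
    and conj: "\<And>g. g \<in> norm_in D T P \<Longrightarrow> \<alpha> \<otimes>\<^bsub>A Q\<^esub> transport P Q \<psi> g \<otimes>\<^bsub>A Q\<^esub> inv\<^bsub>A Q\<^esub> \<alpha> \<in> Aut_by D T Q"
    by auto
  have "g \<in> ext_domain D T P Q (compose P \<alpha> \<psi>)" if g: "g \<in> norm_in D T P" for g
  proof -
    let ?\<beta> = "transport P Q \<psi> g"
    obtain y where y: "y \<in> norm_in D T Q" and eq: "\<alpha> \<otimes>\<^bsub>A Q\<^esub> ?\<beta> \<otimes>\<^bsub>A Q\<^esub> inv\<^bsub>A Q\<^esub> \<alpha> = conj_map S y Q"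
      using conj[OF g] unfolding Aut_by_def by blast
    have \<beta>: "?\<beta> \<in> Aut E Q" by (rule transport_Aut[OF P Q \<psi> g])
    have ia: "inv\<^bsub>A Q\<^esub> \<alpha> \<in> Aut E Q" using A.inv_closed \<alpha> by simp
    have ab: "\<alpha> \<otimes>\<^bsub>A Q\<^esub> ?\<beta> \<in> Aut E Q" using A.m_closed \<alpha> \<beta> by simp
    \<comment> \<open>Here \<alpha> \<psi> c_g \<psi>^-1 \<alpha>^-1 = c_y. Evaluated at
      \<alpha>(\<psi>(u)), this is the condition, with witness y, that places g in the extension
      domain.\<close>
    have "compose P \<alpha> \<psi> (g \<otimes>\<^bsub>S\<^esub> u \<otimes>\<^bsub>S\<^esub> inv\<^bsub>S\<^esub> g) = y \<otimes>\<^bsub>S\<^esub> compose P \<alpha> \<psi> u \<otimes>\<^bsub>S\<^esub> inv\<^bsub>S\<^esub> y"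
      if u: "u \<in> P" for u
    proof -
      have \<psi>u: "\<psi> u \<in> Q" using E_mem[OF P Q Iso_E[OF \<psi>] u] .
      have \<alpha>u: "\<alpha> (\<psi> u) \<in> Q" using Aut_mem[OF Q \<alpha> \<psi>u] .
      have "conj_map S y Q (\<alpha> (\<psi> u)) = \<alpha> (?\<beta> ((inv\<^bsub>A Q\<^esub> \<alpha>) (\<alpha> (\<psi> u))))"
        unfolding eq[symmetric] aut_mult_apply[OF Q ab ia \<alpha>u]
          aut_mult_apply[OF Q \<alpha> \<beta> Aut_mem[OF Q ia \<alpha>u]] ..
      also have "\<dots> = \<alpha> (\<psi> (g \<otimes>\<^bsub>S\<^esub> u \<otimes>\<^bsub>S\<^esub> inv\<^bsub>S\<^esub> g))"
        unfolding aut_inv_apply(1)[OF Q \<alpha> \<psi>u] transport_apply[OF P Q \<psi> u] ..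
      finally show ?thesis
        unfolding compose_eq[OF u] compose_eq[OF norm_in_conj[OF P g u]] using \<alpha>u by (simp add: conj_map_def)
    qed
    then show ?thesis
      using subsetD[OF norm_mult_subgroup(3)[OF P] g] subsetD[OF norm_mult_subgroup(3)[OF Q] y]
      unfolding ext_domain_def by blast
  qed
  then show ?thesis using \<alpha> by blast
qed

text \<open>Conjugation by c is trivial on \<open>R\<close>, so 1 is a witness for c.\<close>

lemma centralizer_in_ext_domain:
  assumes R: "cs R" and Q: "cs Q" and \<phi>: "\<phi> \<in> Iso E R Q"
    and c: "c \<in> T" and cent: "\<And>u. u \<in> R \<Longrightarrow> c \<otimes>\<^bsub>S\<^esub> u = u \<otimes>\<^bsub>S\<^esub> c"
  shows "c \<in> ext_domain D T R Q \<phi>"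
proof -
  have cc: "c \<in> carrier S" using c T_carrier by blast
  have Rc: "R \<subseteq> carrier S" and Qc: "Q \<subseteq> carrier S" using closed_subgroupD(3) R Q by auto
  have conj: "c \<otimes>\<^bsub>S\<^esub> u \<otimes>\<^bsub>S\<^esub> inv\<^bsub>S\<^esub> c = u" "inv\<^bsub>S\<^esub> c \<otimes>\<^bsub>S\<^esub> u \<otimes>\<^bsub>S\<^esub> c = u" if u: "u \<in> R" for u
  proof -
    have uc: "u \<in> carrier S" using u Rc by blast
    show "c \<otimes>\<^bsub>S\<^esub> u \<otimes>\<^bsub>S\<^esub> inv\<^bsub>S\<^esub> c = u" using cent[OF u] cc uc by (simp add: m_assoc)
    show "inv\<^bsub>S\<^esub> c \<otimes>\<^bsub>S\<^esub> u \<otimes>\<^bsub>S\<^esub> c = u"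
      using cent[OF u] cc uc by (simp add: m_assoc inv_mult_cancel flip: cent[OF u])
  qed
  then have "c \<in> norm_in D T R" using norm_in_iff[OF R] c by simp
  then have cN: "c \<in> norm_mult D T R" using norm_mult_subgroup(3)[OF R] by blast
  have "\<one>\<^bsub>S\<^esub> \<in> norm_mult D T Q" using subgroup.one_closed[OF norm_mult_subgroup(1)[OF Q]] .
  moreover have "\<phi> (c \<otimes>\<^bsub>S\<^esub> u \<otimes>\<^bsub>S\<^esub> inv\<^bsub>S\<^esub> c) = \<one>\<^bsub>S\<^esub> \<otimes>\<^bsub>S\<^esub> \<phi> u \<otimes>\<^bsub>S\<^esub> inv\<^bsub>S\<^esub> \<one>\<^bsub>S\<^esub>" if u: "u \<in> R" for u
    using conj(1)[OF u] subsetD[OF Qc E_mem[OF R Q Iso_E[OF \<phi>] u]] by simp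
  ultimately show ?thesis using cN unfolding ext_domain_def by blast
qed

text \<open>A failure of centricity may occur at another member of the class. Receptivity of
  \<open>Q\<close> extends an isomorphism onto \<open>Q\<close> over the offending centralizing
  element and carries it to one that centralizes \<open>Q\<close> itself.\<close>

lemma not_centric_centralizer:
  assumes Q: "open_subgroup D Q" and rec: "receptive D T E Q" and nc: "\<not> centric D T E Q"
  obtains d where "d \<in> T" "d \<notin> Q" "\<And>q. q \<in> Q \<Longrightarrow> d \<otimes>\<^bsub>S\<^esub> q = q \<otimes>\<^bsub>S\<^esub> d"
proof -
  have cQ: "cs Q" using open_closed_subgroup[OF Q] .
  obtain Q' \<theta>0 c where cQ': "cs Q'" and \<theta>0: "\<theta>0 \<in> Iso E Q Q'"
    and c: "c \<in> T" "c \<notin> Q'" "\<And>q. q \<in> Q' \<Longrightarrow> c \<otimes>\<^bsub>S\<^esub> q = q \<otimes>\<^bsub>S\<^esub> c"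
    using nc unfolding centric_def by blast
  have oQ': "open_subgroup D Q'" using Iso_index(1)[OF Q cQ' \<theta>0] .
  obtain \<theta> where \<theta>: "\<theta> \<in> Iso E Q' Q" using Iso_inverse[OF cQ cQ' \<theta>0] by blast
  obtain X' R \<phi>' where X: "X' = ext_domain D T Q' Q \<theta>" "open_subgroup D X'" "Q' \<subseteq> X'" "open_subgroup D R"
    "\<phi>' \<in> Iso E X' R" "restrict \<phi>' Q' = \<theta>" by (rule receptive_extension[OF rec oQ' Q \<theta>])
  have cX: "cs X'" and cR: "cs R" using open_closed_subgroup X(2,4) by auto
  note \<phi>' = cX cR Iso_E[OF X(5)]
  have cX': "c \<in> X'" using centralizer_in_ext_domain[OF cQ' cQ \<theta> c(1,3)] X(1) by blast
  have im: "\<phi>' ` Q' = Q" using Iso_image[OF cQ' cQ \<theta>] unfolding X(6)[symmetric] by simp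
  show thesis
  proof (rule that[of "\<phi>' c"])
    show "\<phi>' c \<in> T" using E_mem_T[OF \<phi>' cX'] c(1) by blast
    show "\<phi>' c \<notin> Q"
    proof
      assume "\<phi>' c \<in> Q"
      then obtain q where "q \<in> Q'" "\<phi>' c = \<phi>' q" using im by blast
      then show False using inj_onD[OF E_inj[OF \<phi>'], of c q] cX' X(3) c(2) by blast
    qed
    fix q assume "q \<in> Q"
    then obtain q' where q': "q' \<in> Q'" "q = \<phi>' q'" using im by blast
    have "q' \<in> X'" using q' X(3) by blast
    then show "\<phi>' c \<otimes>\<^bsub>S\<^esub> q = q \<otimes>\<^bsub>S\<^esub> \<phi>' c"
      using E_mult[OF \<phi>' cX', of q'] E_mult[OF \<phi>' _ cX', of q'] c(3)[OF q'(1)] q'(2) by simp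
  qed
qed

lemma Aut_decomposable:
  assumes IH: "\<forall>P P' \<phi>. open_subgroup D P \<longrightarrow> open_subgroup D P' \<longrightarrow> card (rcosets\<^bsub>S\<^esub> P) < n \<longrightarrow>
      \<phi> \<in> Iso E P P' \<longrightarrow> decomposable P P' \<phi>"
    and Q: "open_subgroup D Q" and n: "card (rcosets\<^bsub>S\<^esub> Q) = n" and fn: "fully_normalized p D T E Q"
    and TQ: "\<not> T \<subseteq> Q" and \<alpha>: "\<alpha> \<in> Aut E Q"
  shows "decomposable Q Q \<alpha>"
proof -
  have cQ: "cs Q" using open_closed_subgroup[OF Q] .
  note fnD = fully_normalizedD[OF fn]
  note extend = decomposable_of_extension[OF IH fnD(1) Q Q n]
  show ?thesis
  proof (cases "essential p D T E Q")
    case True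
    have "restrict \<alpha> Q = \<alpha>" using E_ext[OF cQ cQ Iso_E[OF \<alpha>]] by (rule extensional_restrict)
    then show ?thesis
      using decomposable.base[OF Q Q True fn \<alpha> subset_refl] Iso_image[OF cQ cQ \<alpha>] by simp
  next
    case ness: False
    show ?thesis
    proof (cases "centric D T E Q")
      case False
      obtain d where "d \<in> T" "d \<notin> Q" "\<And>q. q \<in> Q \<Longrightarrow> d \<otimes>\<^bsub>S\<^esub> q = q \<otimes>\<^bsub>S\<^esub> d"
        using not_centric_centralizer[OF Q fnD(1) False] by blast
      then show ?thesis using extend[OF \<alpha> centralizer_in_ext_domain[OF cQ cQ \<alpha>]] by blast
    next
      case centric: True
      interpret A: profinite_base "A Q" "aut_top D E Q" "idx D" "aut_kernel Q" by (rule profinite_aut[OF cQ])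
      let ?N = "Aut_by D (T \<inter> Q) Q" and ?P = "Aut_by D T Q"
      have N: "?N = (\<lambda>g. conj_map S g Q) ` (T \<inter> Q)" by (simp add: Aut_by_def norm_in_Int[OF cQ])
      have conn: "poset_connected (pro_p_poset p (A Q Mod ?N) (quotient_top (A Q) (aut_top D E Q) ?N))"
        using ness TQ centric unfolding essential_def Let_def by blast
      \<comment> \<open>If conjugation by some t in N_T(Q) outside \<open>Q\<close> agreed with that
        by some s in T \<inter> Q, then s^-1 t would centralize \<open>Q\<close>, hence lie in
        \<open>Q\<close> by centricity, and so would t.\<close>
      have NP: "?N \<subset> ?P"
      proof
        show "?N \<subseteq> ?P" unfolding N Aut_by_def[of D T Q] by (rule image_mono[OF subset_normalizer[OF cQ]])
        obtain t where t: "t \<in> norm_in D T Q" "t \<notin> Q" using exists_normalizing[OF Q TQ] by blast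
        have "conj_map S t Q \<notin> ?N"
        proof
          assume "conj_map S t Q \<in> ?N"
          then obtain s where s: "s \<in> T" "s \<in> Q" "conj_map S t Q = conj_map S s Q" unfolding N by blast
          have tc: "t \<in> carrier S" and sc: "s \<in> carrier S"
            using norm_in_carrier[OF t(1)] s(1) T_carrier by auto
          let ?z = "inv\<^bsub>S\<^esub> s \<otimes>\<^bsub>S\<^esub> t"
          have "?z \<in> T" using s(1) norm_in_T[OF t(1)] T_subgroup by (simp add: subgroup.m_closed subgroup.m_inv_closed)
          moreover have "?z \<otimes>\<^bsub>S\<^esub> q = q \<otimes>\<^bsub>S\<^esub> ?z" if q: "q \<in> Q" for q
          proof -
            have qc: "q \<in> carrier S" using q closed_subgroupD(3)[OF cQ] by blast
            have "t \<otimes>\<^bsub>S\<^esub> q \<otimes>\<^bsub>S\<^esub> inv\<^bsub>S\<^esub> t = s \<otimes>\<^bsub>S\<^esub> q \<otimes>\<^bsub>S\<^esub> inv\<^bsub>S\<^esub> s"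
              using fun_cong[OF s(3), of q] q by (simp add: conj_map_def)
            then have "t \<otimes>\<^bsub>S\<^esub> q \<otimes>\<^bsub>S\<^esub> inv\<^bsub>S\<^esub> t \<otimes>\<^bsub>S\<^esub> t = s \<otimes>\<^bsub>S\<^esub> q \<otimes>\<^bsub>S\<^esub> inv\<^bsub>S\<^esub> s \<otimes>\<^bsub>S\<^esub> t" by simp
            then have "t \<otimes>\<^bsub>S\<^esub> q = s \<otimes>\<^bsub>S\<^esub> (q \<otimes>\<^bsub>S\<^esub> ?z)" using tc sc qc by (simp add: m_assoc)
            then have "inv\<^bsub>S\<^esub> s \<otimes>\<^bsub>S\<^esub> (t \<otimes>\<^bsub>S\<^esub> q) = q \<otimes>\<^bsub>S\<^esub> ?z" using tc sc qc by (simp add: inv_mult_cancel)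
            then show ?thesis using tc sc qc by (simp add: m_assoc)
          qed
          ultimately have "?z \<in> Q" using centric cQ id_Iso[OF cQ] unfolding centric_def by blast
          then have "s \<otimes>\<^bsub>S\<^esub> ?z \<in> Q" using s(2) subgroup.m_closed[OF closed_subgroupD(1)[OF cQ]] by blast
          then show False using t(2) tc sc by (simp add: inv_mult_cancel)
        qed
        moreover have "conj_map S t Q \<in> ?P" unfolding Aut_by_def using t(1) by blast
        ultimately show "?N \<noteq> ?P" by blast
      qed
      \<comment> \<open>The subset to be shown to be everything: it is closed under products by
        \<open>decomposable_trans\<close>, and it contains every automorphism that extends
        properly.\<close>
      let ?Y = "{\<beta> \<in> Aut E Q. decomposable Q Q \<beta>}"
      have "\<alpha> \<in> ?Y"
      proof (rule A.poset_connected_generates[OF prime compact_aut[OF cQ] Aut_by_Int_normal[OF cQ] fnD(2,3) NP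
            _ Aut_by_index[OF cQ fn] conn])
        show "A.p_elt p \<beta>" if "\<beta> \<in> ?P" for \<beta>
          using that conj_p_elt[OF cQ] unfolding Aut_by_def by blast
        show "\<alpha> \<in> carrier (A Q)" using \<alpha> by simp
        show "\<beta> \<otimes>\<^bsub>A Q\<^esub> \<gamma> \<in> ?Y" if \<beta>: "\<beta> \<in> ?Y" and \<gamma>: "\<gamma> \<in> ?Y" for \<beta> \<gamma>
          using decomposable_trans[of Q Q \<beta> Q \<gamma>] aut_mult[OF cQ, of \<beta> \<gamma>] A.m_closed[of \<beta> \<gamma>] \<beta> \<gamma> by simp
        fix \<beta> b assume "\<beta> \<in> carrier (A Q)" and b: "b \<in> ?P - ?N"
          and conj: "\<beta> \<otimes>\<^bsub>A Q\<^esub> b \<otimes>\<^bsub>A Q\<^esub> inv\<^bsub>A Q\<^esub> \<beta> \<in> ?P"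
        then have \<beta>: "\<beta> \<in> Aut E Q" by simp
        obtain g where g: "g \<in> norm_in D T Q" "b = conj_map S g Q" using b unfolding Aut_by_def by blast
        obtain y where y: "y \<in> norm_in D T Q" "\<beta> \<otimes>\<^bsub>A Q\<^esub> b \<otimes>\<^bsub>A Q\<^esub> inv\<^bsub>A Q\<^esub> \<beta> = conj_map S y Q"
          using conj unfolding Aut_by_def by blast
        \<comment> \<open>Elements of T \<inter> Q induce members of \<open>?N\<close>, so g is
          outside \<open>Q\<close> and the extension over g is proper.\<close>
        have gQ: "g \<notin> Q" using b norm_in_T[OF g(1)] unfolding N g(2) by blast
        have bA: "b \<in> Aut E Q" using conj_Aut[OF cQ g(1)] g(2) by simp
        have ib: "inv\<^bsub>A Q\<^esub> \<beta> \<in> Aut E Q" using A.inv_closed \<beta> by simp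
        have bb: "\<beta> \<otimes>\<^bsub>A Q\<^esub> b \<in> Aut E Q" using A.m_closed \<beta> bA by simp
        have "\<beta> (g \<otimes>\<^bsub>S\<^esub> u \<otimes>\<^bsub>S\<^esub> inv\<^bsub>S\<^esub> g) = y \<otimes>\<^bsub>S\<^esub> \<beta> u \<otimes>\<^bsub>S\<^esub> inv\<^bsub>S\<^esub> y" if u: "u \<in> Q" for u
        proof -
          have \<beta>u: "\<beta> u \<in> Q" using Aut_mem[OF cQ \<beta> u] .
          have "conj_map S y Q (\<beta> u) = \<beta> (b ((inv\<^bsub>A Q\<^esub> \<beta>) (\<beta> u)))"
            unfolding y(2)[symmetric] aut_mult_apply[OF cQ bb ib \<beta>u]
              aut_mult_apply[OF cQ \<beta> bA Aut_mem[OF cQ ib \<beta>u]] ..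
          then show ?thesis
            unfolding aut_inv_apply(1)[OF cQ \<beta> u] using g(2) u \<beta>u by (simp add: conj_map_def)
        qed
        then have "g \<in> ext_domain D T Q Q \<beta>"
          using subsetD[OF norm_mult_subgroup(3)[OF cQ] g(1)] subsetD[OF norm_mult_subgroup(3)[OF cQ] y(1)]
          unfolding ext_domain_def by blast
        then show "\<beta> \<in> ?Y" using extend[OF \<beta> _ gQ] \<beta> by blast
      qed
      then show ?thesis by blast
    qed
  qed
qed

theorem Iso_decomposable:
  assumes sat: "saturated p D T E" and "open_subgroup D P" "open_subgroup D P'" "\<phi> \<in> Iso E P P'"
  shows "decomposable P P' \<phi>"
  using assms(2-)
proof (induction "card (rcosets\<^bsub>S\<^esub> P)" arbitrary: P P' \<phi> rule: less_induct)
  case less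
  note P = less.prems(1) and P' = less.prems(2) and \<phi> = less.prems(3)
  have cP: "cs P" and cP': "cs P'" using open_closed_subgroup P P' by auto
  obtain Q \<psi> where cQ: "cs Q" and \<psi>: "\<psi> \<in> Iso E P Q" and fn: "fully_normalized p D T E Q"
    using sat cP unfolding saturated_def by blast
  have Q: "open_subgroup D Q" and nQ: "card (rcosets\<^bsub>S\<^esub> Q) = card (rcosets\<^bsub>S\<^esub> P)"
    using Iso_index[OF P cQ \<psi>] by auto
  have nP': "card (rcosets\<^bsub>S\<^esub> P') = card (rcosets\<^bsub>S\<^esub> P)" using Iso_index(2)[OF P cP' \<phi>] .
  show ?case
  proof (cases "T \<subseteq> P")
    case True
    \<comment> \<open>In particular the fully normalized representative \<open>Q\<close> is
      \<open>P\<close> itself.\<close>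
    have eq: "P' = P" "Q = P" using T_le_iso[OF cP cP' True \<phi>] T_le_iso[OF cP cQ True \<psi>] by auto
    have "essential p D T E P" using True by (simp add: essential_def)
    moreover have "restrict \<phi> P = \<phi>" using E_ext[OF cP cP' Iso_E[OF \<phi>]] by (rule extensional_restrict)
    ultimately show ?thesis
      using decomposable.base[OF P P _ _ _ subset_refl, of \<phi>] fn \<phi> Iso_image[OF cP cP' \<phi>] eq by simp
  next
    case False
    have IH: "\<forall>R R' \<theta>. open_subgroup D R \<longrightarrow> open_subgroup D R' \<longrightarrow>
        card (rcosets\<^bsub>S\<^esub> R) < card (rcosets\<^bsub>S\<^esub> P) \<longrightarrow> \<theta> \<in> Iso E R R' \<longrightarrow> decomposable R R' \<theta>"
      using less.hyps by blast
    have TQ: "\<not> T \<subseteq> Q" using T_le_iso[OF cQ cP _ Iso_inverse[OF cP cQ \<psi>]] False by blast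
    \<comment> \<open>Stated for a general \<open>R\<close> because it serves both \<open>P\<close>
      and \<open>P'\<close>. The map \<theta> is recovered as \<alpha>^-1 after \<alpha> \<theta>,
      the latter extending over N_T(R) and the former being an automorphism of
      \<open>Q\<close>.\<close>
    have to_Q: "decomposable R Q \<theta>"
      if R: "open_subgroup D R" "\<not> T \<subseteq> R" "card (rcosets\<^bsub>S\<^esub> R) = card (rcosets\<^bsub>S\<^esub> P)"
        and \<theta>: "\<theta> \<in> Iso E R Q" for R \<theta>
    proof -
      have cR: "cs R" using open_closed_subgroup[OF R(1)] .
      obtain \<alpha> where \<alpha>: "\<alpha> \<in> Aut E Q" "norm_in D T R \<subseteq> ext_domain D T R Q (compose R \<alpha> \<theta>)"
        using exists_full_extension[OF cR cQ fn \<theta>] by blast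
      obtain t where t: "t \<in> norm_in D T R" "t \<notin> R" using exists_normalizing[OF R(1,2)] by blast
      have \<alpha>\<theta>: "compose R \<alpha> \<theta> \<in> Iso E R Q" by (rule Iso_compose[OF cR cQ cQ \<theta> \<alpha>(1)])
      have d1: "decomposable R Q (compose R \<alpha> \<theta>)"
        by (rule decomposable_of_extension[OF IH fully_normalizedD(1)[OF fn] R(1) Q R(3) \<alpha>\<theta>
              subsetD[OF \<alpha>(2) t(1)] t(2)])
      let ?\<beta> = "restrict (inv_into Q \<alpha>) Q"
      have "decomposable Q Q ?\<beta>"
        by (rule Aut_decomposable[OF IH Q nQ fn TQ Iso_inverse[OF cQ cQ \<alpha>(1)]])
      from decomposable_trans[OF this d1]
      have "decomposable R Q (compose R ?\<beta> (compose R \<alpha> \<theta>))" .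
      moreover have "compose R ?\<beta> (compose R \<alpha> \<theta>) = \<theta>"
      proof
        fix x
        show "compose R ?\<beta> (compose R \<alpha> \<theta>) x = \<theta> x"
        proof (cases "x \<in> R")
          case True
          then have \<theta>x: "\<theta> x \<in> Q" using E_mem[OF cR cQ Iso_E[OF \<theta>]] by blast
          then show ?thesis
            using True Aut_mem[OF cQ \<alpha>(1) \<theta>x] inv_into_f_f[OF E_inj[OF cQ cQ Iso_E[OF \<alpha>(1)]] \<theta>x]
            by (simp add: compose_def)
        next
          case False
          then show ?thesis using E_ext[OF cR cQ Iso_E[OF \<theta>]] by (simp add: compose_def extensional_def)
        qed
      qed
      ultimately show ?thesis by simp
    qed
    have TP': "\<not> T \<subseteq> P'" using T_le_iso[OF cP' cP _ Iso_inverse[OF cP cP' \<phi>]] False by blast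
    have i\<phi>: "restrict (inv_into P \<phi>) P' \<in> Iso E P' P" by (rule Iso_inverse[OF cP cP' \<phi>])
    \<comment> \<open>With \<theta> = \<psi> \<phi>^-1, both \<theta> and \<psi> end at
      \<open>Q\<close>, and \<phi> = \<theta>^-1 \<psi>.\<close>
    let ?\<theta> = "compose P' \<psi> (restrict (inv_into P \<phi>) P')"
    have \<theta>: "?\<theta> \<in> Iso E P' Q" by (rule Iso_compose[OF cP' cP cQ i\<phi> \<psi>])
    have d\<theta>: "decomposable Q P' (restrict (inv_into P' ?\<theta>) Q)"
      by (rule decomposable_inverse[OF to_Q[OF P' TP' nP' \<theta>]])
    have "decomposable P P' (compose P (restrict (inv_into P' ?\<theta>) Q) \<psi>)"
      by (rule decomposable_trans[OF d\<theta> to_Q[OF P False refl \<psi>]])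
    moreover have "compose P (restrict (inv_into P' ?\<theta>) Q) \<psi> = \<phi>"
    proof
      fix x
      show "compose P (restrict (inv_into P' ?\<theta>) Q) \<psi> x = \<phi> x"
      proof (cases "x \<in> P")
        case True
        have \<phi>x: "\<phi> x \<in> P'" "\<psi> x \<in> Q" using E_mem[OF cP cP' Iso_E[OF \<phi>] True] E_mem[OF cP cQ Iso_E[OF \<psi>] True] .
        have "?\<theta> (\<phi> x) = \<psi> x"
          using \<phi>x True inv_into_f_f[OF E_inj[OF cP cP' Iso_E[OF \<phi>]] True] by (simp add: compose_def)
        then have "inv_into P' ?\<theta> (\<psi> x) = \<phi> x"
          using inv_into_f_f[OF E_inj[OF cP' cQ Iso_E[OF \<theta>]] \<phi>x(1)] by simp
        then show ?thesis using True \<phi>x(2) by (simp add: compose_eq del: restrict_apply) simp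
      next
        case False
        then show ?thesis using E_ext[OF cP cP' Iso_E[OF \<phi>]] by (simp add: compose_def extensional_def)
      qed
    qed
    ultimately show ?thesis by simp
  qed
qed

end

theorem theorem6p9:
  fixes p :: nat
    and D :: "('i, 'a) fusion_diagram"
    and T P P' :: "('i \<Rightarrow> 'a) set"
    and E :: "('i \<Rightarrow> 'a) homs"
    and \<phi> :: "('i \<Rightarrow> 'a) \<Rightarrow> ('i \<Rightarrow> 'a)"
  assumes "Factorial_Ring.prime p"
    and "inverse_system p D"
    and "strongly_closed D T"
    and "subsystem D T E"
    and "saturated p D T E"
    and "open_subgroup D P"
    and "open_subgroup D P'"
    and "\<phi> \<in> Iso E P P'"
  shows "\<exists>(n :: nat) (Ps :: nat \<Rightarrow> ('i \<Rightarrow> 'a) set) (Qs :: nat \<Rightarrow> ('i \<Rightarrow> 'a) set)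
      (\<phi>s :: nat \<Rightarrow> ('i \<Rightarrow> 'a) \<Rightarrow> ('i \<Rightarrow> 'a)).
      n \<ge> 1 \<and> Ps 0 = P \<and> Ps n = P' \<and>
      (\<forall>i\<in>{0..n}. open_subgroup D (Ps i)) \<and>
      (\<forall>i\<in>{1..n}. open_subgroup D (Qs i) \<and> \<phi>s i \<in> Aut E (Qs i)) \<and>
      (\<forall>i\<in>{1..n}. essential p D T E (Qs i) \<and> fully_normalized p D T E (Qs i)) \<and>
      (\<forall>i\<in>{1..n}. Ps (i - 1) \<subseteq> Qs i \<and> Ps i \<subseteq> Qs i \<and> \<phi>s i ` Ps (i - 1) = Ps i) \<and>
      (\<forall>u\<in>P. \<phi> u = fold \<phi>s [1..<Suc n] u)"
proof -
  interpret pro_fusion_subsystem p D T E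
    using assms(1-4) by unfold_locales
  show ?thesis by (rule decomposable_sequence[OF Iso_decomposable[OF assms(5-8)]])
qed

end
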